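(* Let $0 \leq \beta \leq 1$, let $N\geq 1$, and let $\rho_{A\mathbb{B}}$ be any $(N+1)$-party quantum state of arbitrary (finite) local dimensions, where $\mathbb{B}$ consists of $N$ party subsystems. Then there exists an ordering (labelling) $\mathbb{B}=\{B_0, \ldots, B_{N-1}\}$ of the $N$ subsystems such that $$\left(E_a\left(\rho_{A|B_0 B_1 \cdots B_{N-1}}\right)\right)^{\beta} \leq \sum_{j=0}^{N-1}\beta^{\omega_{H}(\overrightarrow{j})}\left(E_a\left(\rho_{A|B_j}\right)\right)^{\beta},$$ where $E_a$ denotes the entanglement of assistance, $\rho_{AB_j}$ is the reduced density matrix of $\rho_{A\mathbb{B}}$ on subsystems $A$ and $B_j$, and $\omega_H(\overrightarrow{j})$ is the Hamming weight of the binary vector of $j$.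
   Context: A quantum state (density matrix) is a positive semidefinite operator of trace one on a tensor product of finite-dimensional complex Hilbert spaces, one tensor factor for each party. Reduced density matrices are obtained by partial trace over the remaining parties. Entropy of entanglement: for a bipartite pure state $|\psi\rangle_{XY}$ with reduced density matrix $\rho_X=\mathrm{tr}_Y|\psi\rangle\langle\psi|$, set $E(|\psi\rangle_{X|Y})=S(\rho_X)$, where $S(\rho)=-\mathrm{tr}\,\rho\log\rho$ is the von Neumann entropy (logarithm to base 2). Entanglement of assistance (EoA): for a bipartite state $\rho_{XY}$, $$E_a(\rho_{X|Y})=\max \sum_{i}p_i E\left(|\psi_i\rangle_{X|Y}\right),$$ where the maximum is over all pure-state decompositions $\rho_{XY}=\sum_i p_i|\psi_i\rangle_{XY}\langle\psi_i|$ (with $p_i\ge 0$, $\sum_i p_i=1$, and unit vectors $|\psi_i\rangle$). The quantity $E_a(\rho_{A|B_0\cdots B_{N-1}})$ is the EoA of the whole state across the bipartition into $X=A$ and $Y=B_0\cdots B_{N-1}$, and $E_a(\rho_{A|B_j})$ is the EoA of $\rho_{AB_j}$ across $A$ and $B_j$. Binary vector and Hamming weight: for a nonnegative integer $j=\sum_{i=0}^{n-1} j_i2^i$ with $j_i\in\{0,1\}$, set $\overrightarrow{j}=(j_0,\ldots,j_{n-1})$; its Hamming weight $\omega_H(\overrightarrow{j})$ is the number of coordinates equal to $1$, i.e. the number of $1$'s in the binary expansion of $j$. Convention: $0^0=1$ (relevant only when $\beta=0$). *)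

theory Defs
  imports
    Complex_Main
    "HOL-Library.FuncSet"
    "Jordan_Normal_Form.Schur_Decomposition"
begin

text \<open>
  Spectral calculus for matrices that are unitarily diagonalizable with real eigenvalues:
  \<open>A = U diag(l) U\<^sup>*\<close> is sent to \<open>U diag(f l) U\<^sup>*\<close>.  The result does not depend on the
  diagonalization, see \<open>mat_fun_eq\<close> below.
\<close>

definition mat_fun :: "(real \<Rightarrow> real) \<Rightarrow> complex mat \<Rightarrow> complex mat" where
  "mat_fun f A = (THE B. \<exists>U l.
     similar_mat_wit A (mat_diag (dim_row A) (\<lambda>i. complex_of_real (l i))) U (mat_adjoint U) \<and>
     B = U * mat_diag (dim_row A) (\<lambda>i. complex_of_real (f (l i))) * mat_adjoint U)"

definition mat_trace :: "complex mat \<Rightarrow> complex" where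
  "mat_trace A = (\<Sum>i<dim_row A. A $$ (i, i))"

text \<open>Since \<open>log 2 0 = 0\<close> in HOL, the convention \<open>0 log 0 = 0\<close> is built in.\<close>

definition vn_entropy :: "complex mat \<Rightarrow> real" where
  "vn_entropy A = - Re (mat_trace (A * mat_fun (log 2) A))"

lemma mat_fun_unique:
  fixes A :: "complex mat" and k l :: "nat \<Rightarrow> real"
  assumes U: "similar_mat_wit A (mat_diag n (\<lambda>i. complex_of_real (l i))) U U'"
    and V: "similar_mat_wit A (mat_diag n (\<lambda>i. complex_of_real (k i))) V V'"
    and A: "A \<in> carrier_mat n n"
  shows "U * mat_diag n (\<lambda>i. complex_of_real (f (l i))) * U' =
    V * mat_diag n (\<lambda>i. complex_of_real (f (k i))) * V'"
proof -
  let ?d = "\<lambda>g. mat_diag n (\<lambda>i. complex_of_real (g i))"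
  have d[simp]: "?d g \<in> carrier_mat n n" for g by simp
  note u = similar_mat_witD2[OF A U] and v = similar_mat_witD2[OF A V]
  note [simp] = u(6,7) v(6,7)
  note assoc = assoc_mult_mat[of _ n n _ n _ n]
  have mc[simp]: "X * Y \<in> carrier_mat n n"
    if "X \<in> carrier_mat n n" "Y \<in> carrier_mat n n" for X Y :: "complex mat"
    using that by (rule mult_carrier_mat)
  have cancel: "V' * (V * X) = X" if "X \<in> carrier_mat n n" for X
    using that v(2) assoc[of V' V X] by simp
  define W where "W = V' * U"
  have W[simp]: "W \<in> carrier_mat n n" unfolding W_def by simp
  have "W * ?d l = V' * (U * ?d l)" unfolding W_def by (simp add: assoc)
  also have "U * ?d l = A * U" unfolding u(3) using u(2) by (simp add: assoc right_mult_one_mat[of _ n n])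
  also have "V' * (A * U) = ?d k * W" unfolding v(3) W_def by (simp add: assoc cancel)
  finally have eq: "W * ?d l = ?d k * W" .
  have ent: "W $$ (i, j) * of_real (l j) = of_real (k i) * W $$ (i, j)" if "i < n" "j < n" for i j
    using arg_cong[OF eq, of "\<lambda>M. M $$ (i, j)"] that
    by (simp add: mat_diag_mult_left[OF W] mat_diag_mult_right[OF W] mult.commute)
  have "W * ?d (\<lambda>i. f (l i)) = ?d (\<lambda>i. f (k i)) * W"
  proof (rule eq_matI)
    fix i j assume "i < dim_row (?d (\<lambda>i. f (k i)) * W)" "j < dim_col (?d (\<lambda>i. f (k i)) * W)"
    then have ij: "i < n" "j < n" using carrier_matD[OF W] carrier_matD[OF d] by auto
    have "W $$ (i, j) = 0 \<or> l j = k i" using ent[OF ij] by (auto simp: mult.commute)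
    then show "(W * ?d (\<lambda>i. f (l i))) $$ (i, j) = (?d (\<lambda>i. f (k i)) * W) $$ (i, j)"
      using ij by (auto simp: mat_diag_mult_left[OF W] mat_diag_mult_right[OF W])
  qed (use carrier_matD[OF W] carrier_matD[OF d] in auto)
  then have "V * (W * ?d (\<lambda>i. f (l i))) * U' = V * (?d (\<lambda>i. f (k i)) * W) * U'" by simp
  moreover have "V * (W * ?d (\<lambda>i. f (l i))) = (V * V') * (U * ?d (\<lambda>i. f (l i)))"
    unfolding W_def by (simp add: assoc)
  moreover have "V * (?d (\<lambda>i. f (k i)) * W) * U' = V * ?d (\<lambda>i. f (k i)) * V' * (U * U')"
    unfolding W_def by (simp add: assoc)
  ultimately show ?thesis using u(1) v(1) by (simp add: left_mult_one_mat[of _ n n] right_mult_one_mat[of _ n n])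
qed

lemma mat_fun_eq:
  assumes "similar_mat_wit A (mat_diag (dim_row A) (\<lambda>i. complex_of_real (l i))) U (mat_adjoint U)"
  shows "mat_fun f A = U * mat_diag (dim_row A) (\<lambda>i. complex_of_real (f (l i))) * mat_adjoint U"
proof -
  have "A \<in> carrier_mat (dim_row A) (dim_row A)"
    using assms unfolding similar_mat_wit_def Let_def by auto
  then show ?thesis
    unfolding mat_fun_def using assms
    by (intro the_equality) (blast intro: mat_fun_unique)+
qed

text \<open>
  The Hilbert space with orthonormal basis indexed by a finite set \<open>I\<close> consists of functions
  \<open>\<psi>\<close> on \<open>I\<close>, and an operator on it is given by its matrix elements \<open>K x y\<close> with \<open>x, y \<in> I\<close>;
  values outside of \<open>I\<close> are irrelevant.  A product index set represents a tensor product.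
\<close>

type_synonym 'i ket = "'i \<Rightarrow> complex"
type_synonym 'i oper = "'i \<Rightarrow> 'i \<Rightarrow> complex"

text \<open>The order on \<open>complex\<close> makes \<open>0 \<le> z\<close> say that \<open>z\<close> is real and nonnegative, so that
  positive semidefinite operators are self-adjoint.\<close>

definition pos_semidef :: "'i set \<Rightarrow> 'i oper \<Rightarrow> bool" where
  "pos_semidef I K \<longleftrightarrow> (\<forall>v :: 'i ket. 0 \<le> (\<Sum>x\<in>I. \<Sum>y\<in>I. cnj (v x) * K x y * v y))"

definition density_operator :: "'i set \<Rightarrow> 'i oper \<Rightarrow> bool" where
  "density_operator I \<rho> \<longleftrightarrow> pos_semidef I \<rho> \<and> (\<Sum>x\<in>I. \<rho> x x) = 1"

definition unit_ket :: "'i set \<Rightarrow> 'i ket \<Rightarrow> bool" where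
  "unit_ket I \<psi> \<longleftrightarrow> (\<Sum>x\<in>I. (cmod (\<psi> x))\<^sup>2) = 1"

definition ket_bra :: "'i ket \<Rightarrow> 'i oper" where
  "ket_bra \<psi> = (\<lambda>x y. \<psi> x * cnj (\<psi> y))"

text \<open>Bipartite systems \<open>X|Y\<close> have the index set \<open>{..<m} \<times> J\<close>: \<open>X\<close> has dimension \<open>m\<close>, and
  the basis of \<open>Y\<close> is indexed by \<open>J\<close>.\<close>

definition trace_out_Y :: "nat \<Rightarrow> 'y set \<Rightarrow> (nat \<times> 'y) oper \<Rightarrow> complex mat" where
  "trace_out_Y m J K = mat m m (\<lambda>(a, a'). \<Sum>b\<in>J. K (a, b) (a', b))"

definition entropy_of_entanglement :: "nat \<Rightarrow> 'y set \<Rightarrow> (nat \<times> 'y) ket \<Rightarrow> real" where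
  "entropy_of_entanglement m J \<psi> = vn_entropy (trace_out_Y m J (ket_bra \<psi>))"

definition pure_state_decomposition ::
  "'i set \<Rightarrow> 'i oper \<Rightarrow> nat \<Rightarrow> (nat \<Rightarrow> real) \<Rightarrow> (nat \<Rightarrow> 'i ket) \<Rightarrow> bool" where
  "pure_state_decomposition I \<rho> n p \<psi> \<longleftrightarrow>
     (\<forall>i<n. 0 \<le> p i \<and> unit_ket I (\<psi> i)) \<and> (\<Sum>i<n. p i) = 1 \<and>
     (\<forall>x\<in>I. \<forall>y\<in>I. \<rho> x y = (\<Sum>i<n. complex_of_real (p i) * ket_bra (\<psi> i) x y))"

text \<open>The maximum over all decompositions, of any finite length, is expressed as a supremum;
  for a state the set below is nonempty and bounded by \<open>log 2 m\<close>, and the supremum is attained.\<close>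

definition EoA :: "nat \<Rightarrow> 'y set \<Rightarrow> (nat \<times> 'y) oper \<Rightarrow> real" where
  "EoA m J \<rho> = Sup {\<Sum>i<n. p i * entropy_of_entanglement m J (\<psi> i) | n p \<psi>.
     pure_state_decomposition ({..<m} \<times> J) \<rho> n p \<psi>}"

text \<open>The subsystems other than \<open>A\<close> are labelled by the elements of a finite set \<open>P\<close>, and
  \<open>d k\<close> is the dimension of subsystem \<open>k\<close>.\<close>

definition joint_index :: "'p set \<Rightarrow> ('p \<Rightarrow> nat) \<Rightarrow> ('p \<Rightarrow> nat) set" where
  "joint_index P d = (\<Pi>\<^sub>E k\<in>P. {..<d k})"

text \<open>Partial trace over all subsystems except \<open>A\<close> and \<open>j\<close>; the functions \<open>c(j := b)\<close> are the
  elements of \<open>joint_index P d\<close> that have value \<open>b\<close> at \<open>j\<close>.\<close>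

definition reduced_AB ::
  "'p set \<Rightarrow> ('p \<Rightarrow> nat) \<Rightarrow> 'p \<Rightarrow> (nat \<times> ('p \<Rightarrow> nat)) oper \<Rightarrow> (nat \<times> nat) oper" where
  "reduced_AB P d j \<rho> = (\<lambda>(a, b) (a', b').
     \<Sum>c\<in>joint_index (P - {j}) d. \<rho> (a, c(j := b)) (a', c(j := b')))"

definition hamming_weight :: "nat \<Rightarrow> nat" where
  "hamming_weight j = card {i. bit j i}"

text \<open>The library has \<open>0 powr 0 = 0\<close>, whereas \<open>0\<^sup>0 = 1\<close> is wanted here.\<close>

definition rpow :: "real \<Rightarrow> real \<Rightarrow> real" where
  "rpow x b = (if b = 0 then 1 else x powr b)"

end

theory Submission
  imports Defs
begin

text \<open>
  Everything rests on the polygamy inequality for \<open>\<beta> = 1\<close>; once the \<open>B\<^sub>j\<close> are ordered by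
  decreasing assisted entanglement, the weights \<open>\<beta>\<close> come from
  \<open>(x + y)\<^sup>\<beta> \<le> x\<^sup>\<beta> + \<beta> y\<^sup>\<beta>\<close> for \<open>y \<le> x\<close>, applied to the two halves of the index range
  \<open>{..<2\<^sup>n}\<close>: the index \<open>j + 2\<^sup>n\<close> has one binary digit \<open>1\<close> more than \<open>j\<close>.

  Concatenation of decompositions reduces the case \<open>\<beta> = 1\<close> to
  \<open>S(A) \<le> E\<^sub>a(A|B) + E\<^sub>a(A|C)\<close> for a pure state of \<open>ABC\<close>.  Measuring \<open>C\<close> in an eigenbasis of its
  reduced state and in an unbiased basis gives two decompositions of the state of \<open>AB\<close>, whose
  average entanglements add up to at least \<open>S(A) + S(B) - S(C)\<close>; the sum of this and of the
  bound with \<open>B\<close> and \<open>C\<close> exchanged is the claim.  The bound follows from the monotonicity of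
  the relative entropy under pinching.  The latter is seen from
  \<open>D(R, S) = \<integral>\<^sub>0\<^sup>1 q \<langle>R - S, (q L\<^sub>S + (1 - q) R\<^sub>R)\<^sup>-\<^sup>1 (R - S)\<rangle> dq\<close>, with \<open>L\<^sub>S\<close> and \<open>R\<^sub>R\<close> the left and
  right multiplications, because the integrand is a supremum over \<open>Y\<close> of expressions linear in \<open>(R, S)\<close>.
\<close>

section \<open>Brackets and orthonormal bases\<close>

text \<open>Vectors stay unnormalized: \<open>ent_weight\<close> is homogeneous of degree two, so
  the outcome vectors of a measurement form an ensemble as they stand, without division by
  probabilities that may vanish. Reduced states of pure states are Gram operators, and exchanging
  the two indices of a vector exchanges its two reduced states, which gives S(A) = S(BC). States may
  be singular; the relative entropy is therefore expressed through the overlaps of two eigensystems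
  under a support condition. The integral itself is never formed: \<open>rel_entr_path\<close> is an
  explicit antiderivative of the integrand, and a difference of two such functions is shown to
  increase on [0, 1]. Why unbiasedness: the reference state is the pinching in the eigenbasis, and
  the second pinching must turn it into the state of B divided by n on every block. For a unit
  vector the relative entropies before and after are then -S(A) + S(C) plus one average and S(B)
  minus the other average, because the ln n terms cancel.\<close>

definition braket :: "'i set \<Rightarrow> 'i ket \<Rightarrow> 'i ket \<Rightarrow> complex" where
  "braket I f g = (\<Sum>x\<in>I. cnj (f x) * g x)"

definition apply_op :: "'i set \<Rightarrow> 'i oper \<Rightarrow> 'i ket \<Rightarrow> 'i ket" where
  "apply_op I M v = (\<lambda>x. \<Sum>y\<in>I. M x y * v y)"

lemma braket_cong: "(\<And>x. x \<in> I \<Longrightarrow> f x = f' x) \<Longrightarrow> (\<And>x. x \<in> I \<Longrightarrow> g x = g' x) \<Longrightarrow>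
  braket I f g = braket I f' g'"
  by (simp add: braket_def)

lemma cnj_braket: "cnj (braket I f g) = braket I g f"
  by (simp add: braket_def cnj_sum mult.commute)

lemma braket_scale_right: "braket I f (\<lambda>x. c * g x) = c * braket I f g"
  by (simp add: braket_def sum_distrib_left mult_ac)

lemma braket_scale_left: "braket I (\<lambda>x. c * f x) g = cnj c * braket I f g"
  by (simp add: braket_def sum_distrib_left mult_ac)

lemma braket_sum_right: "braket I f (\<lambda>x. \<Sum>k\<in>K. g k x) = (\<Sum>k\<in>K. braket I f (g k))"
  unfolding braket_def by (simp add: sum_distrib_left sum.swap[of _ I K])

lemma braket_sum_left: "braket I (\<lambda>x. \<Sum>k\<in>K. f k x) g = (\<Sum>k\<in>K. braket I (f k) g)"
  unfolding braket_def by (simp add: sum_distrib_right sum.swap[of _ I K] cnj_sum)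

lemma braket_diff_right: "braket I f (\<lambda>x. g x - h x) = braket I f g - braket I f h"
  by (simp add: braket_def algebra_simps sum_subtractf)

lemma braket_add_right: "braket I f (\<lambda>x. g x + h x) = braket I f g + braket I f h"
  by (simp add: braket_def algebra_simps sum.distrib)

lemma braket_self: "braket I f f = of_real (\<Sum>x\<in>I. (cmod (f x))\<^sup>2)"
  unfolding braket_def of_real_sum
  by (intro sum.cong refl) (metis complex_norm_square mult.commute)

lemma sum_mult_of_bool:
  fixes g :: "'i \<Rightarrow> 'b::semiring_1"
  assumes "finite I" "y \<in> I"
  shows "(\<Sum>x\<in>I. g x * of_bool (x = y)) = g y" "(\<Sum>x\<in>I. g x * of_bool (y = x)) = g y"
    "(\<Sum>x\<in>I. of_bool (x = y) * g x) = g y" "(\<Sum>x\<in>I. of_bool (y = x) * g x) = g y"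
proof -
  have *: "(\<Sum>x\<in>I. if x = y then g x else 0) = g y" using assms by simp
  show "(\<Sum>x\<in>I. g x * of_bool (x = y)) = g y" "(\<Sum>x\<in>I. g x * of_bool (y = x)) = g y"
    "(\<Sum>x\<in>I. of_bool (x = y) * g x) = g y" "(\<Sum>x\<in>I. of_bool (y = x) * g x) = g y"
    by (subst *[symmetric], intro sum.cong refl, auto)+
qed

lemma braket_delta:
  assumes "finite I" "y \<in> I"
  shows "braket I f (\<lambda>x. of_bool (x = y)) = cnj (f y)"
  unfolding braket_def by (rule sum_mult_of_bool(1)[OF assms])

lemma apply_op_scale: "apply_op I M (\<lambda>x. c * v x) x = c * apply_op I M v x"
  by (simp add: apply_op_def sum_distrib_left mult_ac)

lemma braket_apply_op:
  "braket I f (apply_op I M g) = (\<Sum>x\<in>I. \<Sum>y\<in>I. cnj (f x) * M x y * g y)"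
  by (simp add: braket_def apply_op_def sum_distrib_left mult_ac)

lemma braket_apply_op_adjoint:
  assumes "\<And>x y. x \<in> I \<Longrightarrow> y \<in> I \<Longrightarrow> M y x = cnj (M x y)"
  shows "braket I f (apply_op I M g) = braket I (apply_op I M f) g"
proof -
  have "braket I (apply_op I M f) g = (\<Sum>x\<in>I. \<Sum>y\<in>I. cnj (M x y) * cnj (f y) * g x)"
    by (simp add: braket_def apply_op_def sum_distrib_right)
  also have "\<dots> = (\<Sum>x\<in>I. \<Sum>y\<in>I. cnj (M y x) * cnj (f x) * g y)"
    by (rule sum.swap)
  also have "\<dots> = braket I f (apply_op I M g)"
    unfolding braket_apply_op
  proof (intro sum.cong refl)
    fix x y assume "x \<in> I" "y \<in> I"
    from assms[OF this(2,1)] show "cnj (M y x) * cnj (f x) * g y = cnj (f x) * M x y * g y" by simp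
  qed
  finally show ?thesis by simp
qed

text \<open>\<open>K\<close> is separate from \<open>I\<close> and completeness is the resolution of
  the identity, so that product-indexed bases, as in \<open>eigensys_phase_blocks\<close>, need no
  comparison of cardinalities.\<close>

definition onb :: "'i set \<Rightarrow> 'k set \<Rightarrow> ('k \<Rightarrow> 'i ket) \<Rightarrow> bool" where
  "onb I K u \<longleftrightarrow> (\<forall>k\<in>K. \<forall>l\<in>K. braket I (u k) (u l) = of_bool (k = l)) \<and>
     (\<forall>x\<in>I. \<forall>y\<in>I. (\<Sum>k\<in>K. u k x * cnj (u k y)) = of_bool (x = y))"

definition eigensys :: "'i set \<Rightarrow> 'i oper \<Rightarrow> 'k set \<Rightarrow> ('k \<Rightarrow> real) \<Rightarrow> ('k \<Rightarrow> 'i ket) \<Rightarrow> bool" where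
  "eigensys I M K l u \<longleftrightarrow> onb I K u \<and>
     (\<forall>k\<in>K. \<forall>x\<in>I. apply_op I M (u k) x = of_real (l k) * u k x)"

lemma pos_semidef_braket: "pos_semidef I K \<longleftrightarrow> (\<forall>v. 0 \<le> braket I v (apply_op I K v))"
  by (simp add: pos_semidef_def braket_apply_op)

text \<open>Test vectors supported on two points recover the matrix elements.\<close>

lemma pos_semidef_hermitian:
  assumes "finite I" "pos_semidef I K" "x \<in> I" "y \<in> I"
  shows "K y x = cnj (K x y)"
proof -
  have key: "0 \<le> cnj s * (K x x * s + K x y * t) + cnj t * (K y x * s + K y y * t)" for s t
  proof -
    define v where "v = (\<lambda>a. s * of_bool (a = x) + t * of_bool (a = y))"
    have app: "apply_op I K v a = K a x * s + K a y * t" for a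
      using sum_mult_of_bool(1)[OF assms(1,3), of "\<lambda>b. K a b * s"]
        sum_mult_of_bool(1)[OF assms(1,4), of "\<lambda>b. K a b * t"]
      by (simp add: apply_op_def v_def algebra_simps sum.distrib)
    have "braket I v (apply_op I K v) = cnj (braket I (apply_op I K v) v)"
      by (simp add: cnj_braket)
    also have "braket I (apply_op I K v) v =
        s * cnj (apply_op I K v x) + t * cnj (apply_op I K v y)"
      unfolding v_def braket_add_right braket_scale_right
        braket_delta[OF assms(1,3)] braket_delta[OF assms(1,4)] by simp
    finally have "braket I v (apply_op I K v) =
        cnj s * (K x x * s + K x y * t) + cnj t * (K y x * s + K y y * t)"
      by (simp add: app[of x] app[of y])
    moreover have "0 \<le> braket I v (apply_op I K v)"
      using assms(2) by (simp add: pos_semidef_braket)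
    ultimately show ?thesis by simp
  qed
  \<comment> \<open>The first two choices make the diagonal entries real; the others make
    \<open>K x y + K y x\<close> and i times \<open>K x y - K y x\<close> real.\<close>
  from key[of 1 0] key[of 0 1] key[of 1 1] key[of 1 \<i>] show ?thesis
    by (auto simp: less_eq_complex_def complex_eq_iff)
qed

section \<open>Spectral theorem for positive semidefinite operators\<close>

lemma mat_trace_mult:
  fixes A B :: "complex mat"
  assumes "A \<in> carrier_mat n m" "B \<in> carrier_mat m n"
  shows "mat_trace (A * B) = (\<Sum>i<n. \<Sum>j<m. A $$ (i, j) * B $$ (j, i))"
  using carrier_matD[OF assms(1)] carrier_matD[OF assms(2)]
  by (auto simp: mat_trace_def scalar_prod_def atLeast0LessThan intro!: sum.cong)

lemma mat_trace_mult_commute: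
  fixes A B :: "complex mat"
  assumes "A \<in> carrier_mat n m" "B \<in> carrier_mat m n"
  shows "mat_trace (A * B) = mat_trace (B * A)"
  unfolding mat_trace_mult[OF assms] mat_trace_mult[OF assms(2,1)]
  by (subst sum.swap) (simp add: mult.commute)

text \<open>For a triangular form \<open>B\<close> of \<open>M\<close>, if \<open>B\<close> had zero diagonal then
  \<open>\<Sum> |M x y|\<^sup>2 = tr M\<^sup>2 = tr B\<^sup>2 = 0\<close>.\<close>

lemma hermitian_nonzero_eigenvector:
  fixes M :: "nat oper"
  assumes herm: "\<And>x y. x < n \<Longrightarrow> y < n \<Longrightarrow> M y x = cnj (M x y)"
    and nz: "x0 < n" "y0 < n" "M x0 y0 \<noteq> 0"
  shows "\<exists>c v. c \<noteq> 0 \<and> (\<forall>x<n. apply_op {..<n} M v x = c * v x) \<and> (\<exists>x<n. v x \<noteq> 0)"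
proof -
  define A where "A = mat n n (\<lambda>(x, y). M x y)"
  have A: "A \<in> carrier_mat n n" by (simp add: A_def)
  obtain es where es: "char_poly A = (\<Prod>e\<leftarrow>es. [:- e, 1:])"
    using char_poly_factorized[OF A] by blast
  obtain B P Q where "schur_decomposition A es = (B, P, Q)"
    by (cases "schur_decomposition A es") auto
  from schur_decomposition[OF A es this]
  have sim: "similar_mat_wit A B P Q" and ut: "upper_triangular B" and diag: "diag_mat B = es"
    by auto
  note w = similar_mat_witD2[OF A sim]
  note [simp] = w(5,6,7)
  have "\<exists>e\<in>set es. e \<noteq> 0"
  proof (rule ccontr)
    assume "\<not> ?thesis"
    then have dz: "B $$ (i, i) = 0" if "i < n" for i
      proof -
      have "B $$ (i, i) \<in> set es"
        using that diag carrier_matD[OF w(5)] by (auto simp: diag_mat_def)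
      then show ?thesis using \<open>\<not> (\<exists>e\<in>set es. e \<noteq> 0)\<close> by blast
    qed
    note assoc = assoc_mult_mat[of _ n n _ n _ n]
    have QPX: "Q * (P * X) = X" if "X \<in> carrier_mat n n" for X
      using that w(2) assoc[of Q P X] by simp
    have "A * A = (P * B * Q) * (P * B * Q)" by (rule arg_cong2[OF w(3) w(3)])
    also have "\<dots> = P * (B * (Q * (P * (B * Q))))"
      by (simp add: assoc mult_carrier_mat[of _ n n _ n])
    also have "Q * (P * (B * Q)) = B * Q"
      by (rule QPX) (simp add: mult_carrier_mat[of _ n n _ n])
    finally have "A * A = P * (B * (B * Q))" .
    then have "mat_trace (A * A) = mat_trace ((B * (B * Q)) * P)"
      using mat_trace_mult_commute[of P n n "B * (B * Q)"] by (simp add: mult_carrier_mat[of _ n n _ n])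
    also have "(B * (B * Q)) * P = B * B"
      using w(2) by (simp add: assoc mult_carrier_mat[of _ n n _ n] right_mult_one_mat[of _ n n])
    also have "mat_trace (B * B) = (\<Sum>i<n. \<Sum>j<n. B $$ (i, j) * B $$ (j, i))"
      by (rule mat_trace_mult[OF w(5,5)])
    also have "\<dots> = 0"
    proof (intro sum.neutral ballI)
      fix i j assume "i \<in> {..<n}" "j \<in> {..<n}"
      then show "B $$ (i, j) * B $$ (j, i) = 0"
        using dz[of i] upper_triangularD[OF ut, of i j] upper_triangularD[OF ut, of j i]
          carrier_matD[OF w(5)] by (cases i j rule: linorder_cases) auto
    qed
    finally have "0 = mat_trace (A * A)" by simp
    also have "\<dots> = (\<Sum>i<n. \<Sum>j<n. M i j * M j i)"
      unfolding mat_trace_mult[OF A A] by (intro sum.cong refl) (simp add: A_def)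
    also have "\<dots> = of_real (\<Sum>i<n. \<Sum>j<n. (cmod (M i j))\<^sup>2)"
      unfolding of_real_sum
    proof (intro sum.cong refl)
      fix i j assume "i \<in> {..<n}" "j \<in> {..<n}"
      then have "M j i = cnj (M i j)" by (intro herm) auto
      then show "M i j * M j i = of_real ((cmod (M i j))\<^sup>2)" by (metis complex_norm_square)
    qed
    finally have "(\<Sum>i<n. \<Sum>j<n. (cmod (M i j))\<^sup>2) = 0" by (metis of_real_eq_0_iff)
    then show False using nz by (auto simp: sum_nonneg_eq_0_iff sum_nonneg)
  qed
  then obtain e where e: "e \<in> set es" "e \<noteq> 0" by auto
  then have "poly (char_poly A) e = 0" unfolding es by (auto simp: poly_prod_list prod_list_zero_iff)
  then have "eigenvalue A e" using eigenvalue_root_char_poly[OF A] by simp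
  then obtain v where v: "v \<in> carrier_vec n" "v \<noteq> 0\<^sub>v n" "A *\<^sub>v v = e \<cdot>\<^sub>v v"
    using A by (auto simp: eigenvalue_def eigenvector_def)
  have "apply_op {..<n} M (($) v) x = e * v $ x" if "x < n" for x
    using arg_cong[OF v(3), of "\<lambda>w. w $ x"] that v(1) A
    by (simp add: apply_op_def A_def scalar_prod_def atLeast0LessThan)
  moreover have "\<exists>x<n. v $ x \<noteq> 0" using v(1,2) by (metis carrier_vecD eq_vecI index_zero_vec)
  ultimately show ?thesis using e(2) by blast
qed

lemma apply_op_rank_one_sum:
  "apply_op I (\<lambda>x y. \<Sum>k\<in>K. c k * u k x * cnj (w k y)) v x = (\<Sum>k\<in>K. c k * braket I (w k) v * u k x)"
  unfolding apply_op_def braket_def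
  by (simp add: sum_distrib_left sum_distrib_right mult_ac sum.swap[of _ I K])

text \<open>Bessel's inequality bounds the sum of \<open>|u i x|^2\<close> over \<open>i\<close> by
  1 for each coordinate \<open>x\<close>; summing over the \<open>n\<close> coordinates counts the
  \<open>k\<close> unit vectors.\<close>

lemma card_orthonormal_le:
  fixes u :: "nat \<Rightarrow> nat ket"
  assumes orth: "\<And>i j. i < k \<Longrightarrow> j < k \<Longrightarrow> braket {..<n} (u i) (u j) = of_bool (i = j)"
  shows "k \<le> n"
proof -
  have bessel: "(\<Sum>i<k. (cmod (u i x))\<^sup>2) \<le> 1" if x: "x < n" for x
  proof -
    \<comment> \<open>The part of the coordinate vector at \<open>x\<close> that is orthogonal to
      all \<open>u i\<close>.\<close>
    define z where "z = (\<lambda>y. of_bool (y = x) - (\<Sum>i<k. cnj (u i x) * u i y))"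
    have uz: "braket {..<n} (u j) z = 0" if "j < k" for j
    proof -
      have "braket {..<n} (u j) z = cnj (u j x) - (\<Sum>i<k. cnj (u i x) * of_bool (j = i))"
        using that x by (simp add: z_def braket_diff_right braket_sum_right braket_scale_right
            braket_delta orth)
      then show ?thesis using sum_mult_of_bool(2)[of "{..<k}" j "\<lambda>i. cnj (u i x)"] that by simp
    qed
    have "braket {..<n} z z = cnj (z x) - (\<Sum>i<k. cnj (u i x) * cnj (braket {..<n} (u i) z))"
      by (subst (2) z_def) (simp add: braket_diff_right braket_sum_right braket_scale_right cnj_braket
          braket_delta x)
    also have "\<dots> = cnj (z x)"
      using uz by simp
    also have "\<dots> = of_real (1 - (\<Sum>i<k. (cmod (u i x))\<^sup>2))"
      unfolding z_def of_real_diff of_real_sum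
      by (simp add: complex_norm_square mult.commute del: of_real_power)
    finally have "(\<Sum>y<n. (cmod (z y))\<^sup>2) = 1 - (\<Sum>i<k. (cmod (u i x))\<^sup>2)"
      unfolding braket_self of_real_eq_iff .
    then show ?thesis using sum_nonneg[of "{..<n}" "\<lambda>y. (cmod (z y))\<^sup>2"] by simp
  qed
  have "real k = (\<Sum>i<k. \<Sum>x<n. (cmod (u i x))\<^sup>2)"
  proof -
    have "(\<Sum>x<n. (cmod (u i x))\<^sup>2) = 1" if "i < k" for i
    proof -
      have "complex_of_real (\<Sum>x<n. (cmod (u i x))\<^sup>2) = of_real 1"
        using orth[OF that that] unfolding braket_self by simp
      then show ?thesis by (simp only: of_real_eq_iff)
    qed
    then show ?thesis by simp
  qed
  also have "\<dots> = (\<Sum>x<n. \<Sum>i<k. (cmod (u i x))\<^sup>2)" by (rule sum.swap)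
  also have "\<dots> \<le> (\<Sum>x<n. 1)" by (intro sum_mono bessel) simp
  finally show ?thesis by simp
qed

text \<open>Deflation: eigenvectors of \<open>H = K + 1\<close> are split off until nothing is left.  The shift
  makes \<open>H\<close> injective, so that the eigenvectors found in this way form a basis.\<close>

lemma spectral_theorem_nat:
  assumes psd: "pos_semidef {..<n} K"
  shows "\<exists>l u. eigensys {..<n::nat} K {..<n} l u \<and> (\<forall>k<n. 0 \<le> l k)"
proof -
  let ?I = "{..<n}"
  define H where "H = (\<lambda>x y. K x y + of_bool (x = y))"
  have hermK: "K y x = cnj (K x y)" if "x < n" "y < n" for x y
    by (rule pos_semidef_hermitian[OF _ psd]) (use that in auto)
  have hermH: "H y x = cnj (H x y)" if "x \<in> ?I" "y \<in> ?I" for x y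
    unfolding H_def complex_cnj_add by (rule arg_cong2[OF hermK]) (use that in auto)
  have H_app: "apply_op ?I H v x = apply_op ?I K v x + v x" if "x < n" for v x
    using sum_mult_of_bool(4)[of ?I x v] that by (simp add: apply_op_def H_def algebra_simps sum.distrib)
  \<comment> \<open>Taking the largest such \<open>k\<close> replaces an induction over orthogonal
    complements, which would need coordinates of their own.\<close>
  define Q where "Q k \<longleftrightarrow> (\<exists>(l::nat \<Rightarrow> real) u.
    (\<forall>i<k. \<forall>j<k. braket ?I (u i) (u j) = of_bool (i = j)) \<and>
    (\<forall>i<k. \<forall>x<n. apply_op ?I H (u i) x = of_real (l i) * u i x))" for k
  have "Q 0" by (simp add: Q_def)
  have bound: "k \<le> n" if "Q k" for k
    using that card_orthonormal_le unfolding Q_def by metis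
  define k where "k = Greatest Q"
  have "Q k" unfolding k_def using \<open>Q 0\<close> bound by (rule GreatestI_nat)
  have notQ: "\<not> Q (Suc k)" using Greatest_le_nat[of Q "Suc k" n] bound unfolding k_def by fastforce
  from \<open>Q k\<close> obtain l u where
    orth: "\<And>i j. i < k \<Longrightarrow> j < k \<Longrightarrow> braket ?I (u i) (u j) = of_bool (i = j)" and
    eig: "\<And>i x. i < k \<Longrightarrow> x < n \<Longrightarrow> apply_op ?I H (u i) x = of_real (l i) * u i x"
    unfolding Q_def by blast
  \<comment> \<open>If anything were left of \<open>H\<close>, an eigenvector of \<open>D\<close>
    with nonzero eigenvalue would be orthogonal to all \<open>u i\<close>, which \<open>D\<close>
    annihilates, and would extend the family beyond the maximal \<open>k\<close>.\<close>
  define D where "D = (\<lambda>x y. H x y - (\<Sum>i<k. of_real (l i) * u i x * cnj (u i y)))"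
  have hermD: "D y x = cnj (D x y)" if "x \<in> ?I" "y \<in> ?I" for x y
    using hermH[OF that] by (simp add: D_def mult_ac)
  have D_app: "apply_op ?I D v x = apply_op ?I H v x - (\<Sum>i<k. of_real (l i) * braket ?I (u i) v * u i x)" for v x
    using apply_op_rank_one_sum[of ?I "\<lambda>i. of_real (l i)" u u "{..<k}" v x]
    by (simp add: D_def apply_op_def algebra_simps sum_subtractf)
  have D_u: "apply_op ?I D (u j) x = 0" if "j < k" "x < n" for j x
    using that sum_mult_of_bool(1)[of "{..<k}" j "\<lambda>i. of_real (l i) * u i x"]
    by (simp add: D_app orth eig mult_ac)
  have D0: "D x y = 0" if xy: "x < n" "y < n" for x y
  proof (rule ccontr)
    assume "D x y \<noteq> 0"
    then obtain c v where c: "c \<noteq> 0" and v: "\<And>x. x < n \<Longrightarrow> apply_op ?I D v x = c * v x"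
      and v0: "\<exists>x<n. v x \<noteq> 0"
    proof -
      have "\<exists>c v. c \<noteq> 0 \<and> (\<forall>x<n. apply_op {..<n} D v x = c * v x) \<and> (\<exists>x<n. v x \<noteq> 0)"
        by (rule hermitian_nonzero_eigenvector[OF hermD xy \<open>D x y \<noteq> 0\<close>]) auto
      with that show ?thesis by blast
    qed
    have uv: "braket ?I (u j) v = 0" if "j < k" for j
    proof -
      have "c * braket ?I (u j) v = braket ?I (u j) (apply_op ?I D v)"
        unfolding braket_scale_right[symmetric] by (rule braket_cong) (simp_all add: v)
      also have "\<dots> = braket ?I (apply_op ?I D (u j)) v"
        by (rule braket_apply_op_adjoint) (rule hermD)
      also have "\<dots> = 0" using that by (simp add: braket_def D_u)
      finally show ?thesis using c by simp
    qed
    have Hv: "apply_op ?I H v x = c * v x" if "x < n" for x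
      using v[OF that] uv by (simp add: D_app)
    define r where "r = (\<Sum>x<n. (cmod (v x))\<^sup>2)"
    have r: "braket ?I v v = of_real r" unfolding r_def by (rule braket_self)
    have "r > 0" unfolding r_def using v0 by (auto intro!: sum_pos2)
    have "c * of_real r = braket ?I v (apply_op ?I H v)"
      unfolding r[symmetric] braket_scale_right[symmetric] by (rule braket_cong) (simp_all add: Hv)
    also have "\<dots> = braket ?I (apply_op ?I H v) v"
      by (rule braket_apply_op_adjoint) (rule hermH)
    also have "\<dots> = cnj c * of_real r"
      unfolding r[symmetric] braket_scale_left[symmetric] by (rule braket_cong) (simp_all add: Hv)
    finally have "cnj c = c" using \<open>r > 0\<close> by simp
    then have c_re: "c = of_real (Re c)" by (simp add: complex_eq_iff)
    define w where "w = (\<lambda>x. of_real (1 / sqrt r) * v x)"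
    have w1: "braket ?I w w = 1"
    proof -
      have "braket ?I w w = of_real (1 / sqrt r * (1 / sqrt r) * r)"
        unfolding w_def braket_scale_left braket_scale_right r complex_cnj_complex_of_real
        by (simp only: of_real_mult mult.assoc)
      also have "1 / sqrt r * (1 / sqrt r) * r = 1" using \<open>r > 0\<close> by (simp add: field_simps)
      finally show ?thesis by simp
    qed
    have uw: "braket ?I (u j) w = 0" if "j < k" for j
      unfolding w_def braket_scale_right by (simp add: uv that)
    then have wu: "braket ?I w (u j) = 0" if "j < k" for j
      using that by (metis cnj_braket complex_cnj_zero)
    have Hw: "apply_op ?I H w x = of_real (Re c) * w x" if "x < n" for x
      unfolding w_def apply_op_scale Hv[OF that] c_re[symmetric] by (rule mult.left_commute)
    have "Q (Suc k)"
      unfolding Q_def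
      by (rule exI[of _ "\<lambda>i. if i < k then l i else Re c"], rule exI[of _ "\<lambda>i. if i < k then u i else w"])
        (auto simp: less_Suc_eq orth eig w1 uw wu Hw)
    with notQ show False ..
  qed
  have H_eq: "H x y = (\<Sum>i<k. of_real (l i) * u i x * cnj (u i y))" if "x < n" "y < n" for x y
    using D0[OF that] by (simp add: D_def)
  have compl: "(\<Sum>i<k. u i x * cnj (u i y)) = of_bool (x = y)" if "x < n" "y < n" for x y
  proof -
    \<comment> \<open>The residual of a coordinate vector is orthogonal to all \<open>u i\<close>,
      so \<open>H z = 0\<close>; then \<open><z, K z> + |z|^2 = 0\<close> with \<open>K\<close>
      positive forces \<open>z = 0\<close>.\<close>
    define z where "z = (\<lambda>a. of_bool (a = y) - (\<Sum>i<k. cnj (u i y) * u i a))"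
    have uz: "braket ?I (u j) z = 0" if "j < k" for j
    proof -
      have "braket ?I (u j) z = cnj (u j y) - (\<Sum>i<k. cnj (u i y) * of_bool (j = i))"
        using that \<open>y < n\<close> by (simp add: z_def braket_diff_right braket_sum_right braket_scale_right
            braket_delta orth)
      then show ?thesis using sum_mult_of_bool(2)[of "{..<k}" j "\<lambda>i. cnj (u i y)"] that by simp
    qed
    have "apply_op ?I H z a = 0" if "a < n" for a
    proof -
      have "apply_op ?I H z a = apply_op ?I (\<lambda>x y. \<Sum>i<k. of_real (l i) * u i x * cnj (u i y)) z a"
        using that by (simp add: apply_op_def H_eq)
      also have "\<dots> = 0" unfolding apply_op_rank_one_sum by (simp add: uz)
      finally show ?thesis .
    qed
    then have "0 = braket ?I z (apply_op ?I H z)" by (simp add: braket_def)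
    also have "\<dots> = braket ?I z (\<lambda>a. apply_op ?I K z a + z a)"
      by (rule braket_cong) (simp_all add: H_app)
    also have "\<dots> = braket ?I z (apply_op ?I K z) + braket ?I z z"
      by (rule braket_add_right)
    finally have "Re (braket ?I z (apply_op ?I K z)) + (\<Sum>x<n. (cmod (z x))\<^sup>2) = 0"
      unfolding braket_self by (metis Re_complex_of_real plus_complex.simps(1) zero_complex.simps(1))
    moreover have "0 \<le> Re (braket ?I z (apply_op ?I K z))"
      using psd by (simp add: pos_semidef_braket less_eq_complex_def)
    ultimately have "(\<Sum>x<n. (cmod (z x))\<^sup>2) = 0"
      using sum_nonneg[of ?I "\<lambda>x. (cmod (z x))\<^sup>2"] by simp
    then have "z x = 0" using that by (simp add: sum_nonneg_eq_0_iff)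
    then show ?thesis by (simp add: z_def mult.commute)
  qed
  have "complex_of_nat k = (\<Sum>i<k. braket ?I (u i) (u i))" by (simp add: orth)
  also have "\<dots> = (\<Sum>x<n. \<Sum>i<k. u i x * cnj (u i x))"
    unfolding braket_def by (subst sum.swap) (simp add: mult.commute)
  also have "\<dots> = of_nat n" by (simp add: compl)
  finally have "k = n" by (simp only: of_nat_eq_iff)
  have K_eig: "apply_op ?I K (u i) x = of_real (l i - 1) * u i x" if "i < n" "x < n" for i x
    using H_app[OF that(2), of "u i"] eig[of i x] that \<open>k = n\<close> by (simp add: algebra_simps)
  have "0 \<le> l i - 1" if "i < n" for i
  proof -
    have "braket ?I (u i) (apply_op ?I K (u i)) = of_real (l i - 1) * braket ?I (u i) (u i)"
      unfolding braket_scale_right[symmetric] by (rule braket_cong) (simp_all only: K_eig that lessThan_iff)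
    also have "\<dots> = of_real (l i - 1)" using that \<open>k = n\<close> by (simp add: orth)
    finally have "0 \<le> complex_of_real (l i - 1)"
      using psd unfolding pos_semidef_braket by metis
    then show ?thesis by (simp add: less_eq_complex_def)
  qed
  moreover have "eigensys ?I K {..<n} (\<lambda>i. l i - 1) u"
    using orth compl K_eig \<open>k = n\<close> by (auto simp: eigensys_def onb_def)
  ultimately show ?thesis by blast
qed

section \<open>Eigensystems, Gram operators and entropies\<close>

lemma onb_orth: "onb I K u \<Longrightarrow> k \<in> K \<Longrightarrow> l \<in> K \<Longrightarrow> braket I (u k) (u l) = of_bool (k = l)"
  by (simp add: onb_def)

lemma onb_complete: "onb I K u \<Longrightarrow> x \<in> I \<Longrightarrow> y \<in> I \<Longrightarrow> (\<Sum>k\<in>K. u k x * cnj (u k y)) = of_bool (x = y)"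
  by (simp add: onb_def)

lemma onb_parseval:
  assumes "onb I K u" "finite I"
  shows "(\<Sum>k\<in>K. braket I f (u k) * braket I (u k) g) = braket I f g"
proof -
  have "(\<Sum>k\<in>K. braket I f (u k) * braket I (u k) g) =
      (\<Sum>k\<in>K. \<Sum>x\<in>I. \<Sum>y\<in>I. cnj (f x) * g y * (u k x * cnj (u k y)))"
    unfolding braket_def sum_product by (simp add: mult_ac)
  also have "\<dots> = (\<Sum>x\<in>I. \<Sum>k\<in>K. \<Sum>y\<in>I. cnj (f x) * g y * (u k x * cnj (u k y)))"
    by (rule sum.swap)
  also have "\<dots> = (\<Sum>x\<in>I. \<Sum>y\<in>I. \<Sum>k\<in>K. cnj (f x) * g y * (u k x * cnj (u k y)))"
    by (intro sum.cong refl sum.swap)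
  also have "\<dots> = (\<Sum>x\<in>I. \<Sum>y\<in>I. cnj (f x) * g y * of_bool (x = y))"
    unfolding sum_distrib_left[symmetric]
    by (intro sum.cong refl) (simp add: onb_complete[OF assms(1)])
  also have "\<dots> = braket I f g"
    unfolding braket_def
    by (intro sum.cong refl) (simp add: sum_mult_of_bool(2)[OF assms(2)])
  finally show ?thesis .
qed

lemma braket_cnj_swap: "cmod (braket I f g) = cmod (braket I g f)"
  by (metis cnj_braket complex_mod_cnj)

lemma onb_parseval_norm:
  assumes "onb I K u" "finite I"
  shows "(\<Sum>k\<in>K. (cmod (braket I (u k) g))\<^sup>2) = (\<Sum>x\<in>I. (cmod (g x))\<^sup>2)"
proof -
  have "complex_of_real (\<Sum>k\<in>K. (cmod (braket I (u k) g))\<^sup>2) = (\<Sum>k\<in>K. braket I g (u k) * braket I (u k) g)"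
    unfolding of_real_sum by (intro sum.cong refl) (metis cnj_braket complex_norm_square mult.commute)
  also have "\<dots> = of_real (\<Sum>x\<in>I. (cmod (g x))\<^sup>2)"
    unfolding onb_parseval[OF assms] by (rule braket_self)
  finally show ?thesis by (simp only: of_real_eq_iff)
qed

lemma eigensys_onb: "eigensys I M K l u \<Longrightarrow> onb I K u"
  by (simp add: eigensys_def)

lemma eigensys_apply: "eigensys I M K l u \<Longrightarrow> k \<in> K \<Longrightarrow> x \<in> I \<Longrightarrow>
  apply_op I M (u k) x = of_real (l k) * u k x"
  by (simp add: eigensys_def)

lemma eigensys_expand:
  assumes "eigensys I M K l u" "finite I" "x \<in> I" "y \<in> I"
  shows "M x y = (\<Sum>k\<in>K. of_real (l k) * u k x * cnj (u k y))"
proof -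
  have "(\<Sum>k\<in>K. of_real (l k) * u k x * cnj (u k y)) = (\<Sum>k\<in>K. apply_op I M (u k) x * cnj (u k y))"
    using assms by (intro sum.cong refl) (simp add: eigensys_apply)
  also have "\<dots> = (\<Sum>k\<in>K. \<Sum>z\<in>I. M x z * (u k z * cnj (u k y)))"
    by (simp add: apply_op_def sum_distrib_right mult.assoc)
  also have "\<dots> = (\<Sum>z\<in>I. M x z * (\<Sum>k\<in>K. u k z * cnj (u k y)))"
    unfolding sum_distrib_left by (rule sum.swap)
  also have "\<dots> = (\<Sum>z\<in>I. M x z * of_bool (z = y))"
    using assms by (intro sum.cong refl) (simp add: onb_complete[OF eigensys_onb])
  also have "\<dots> = M x y" using assms by (simp add: sum_mult_of_bool)
  finally show ?thesis by simp
qed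

lemma eigensys_hermitian:
  assumes "eigensys I M K l u" "finite I" "x \<in> I" "y \<in> I"
  shows "M y x = cnj (M x y)"
  unfolding eigensys_expand[OF assms] eigensys_expand[OF assms(1,2,4,3)]
  by (simp add: mult_ac)

lemma eigensys_braket_left:
  assumes "eigensys I M K l u" "finite I" "k \<in> K"
  shows "braket I (u k) (apply_op I M v) = of_real (l k) * braket I (u k) v"
proof -
  have "braket I (u k) (apply_op I M v) = braket I (apply_op I M (u k)) v"
    by (rule braket_apply_op_adjoint) (rule eigensys_hermitian[OF assms(1,2)])
  also have "\<dots> = braket I (\<lambda>x. of_real (l k) * u k x) v"
    using assms by (intro braket_cong) (simp_all add: eigensys_apply)
  finally show ?thesis by (simp add: braket_scale_left)
qed

lemma eigensys_braket_self:
  assumes "eigensys I M K l u" "finite I" "k \<in> K"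
  shows "braket I (u k) (apply_op I M (u k)) = of_real (l k)"
  using eigensys_braket_left[OF assms, of "u k"] onb_orth[OF eigensys_onb[OF assms(1)] assms(3,3)] by simp

lemma apply_op_cong:
  "(\<And>x y. x \<in> I \<Longrightarrow> y \<in> I \<Longrightarrow> M x y = M' x y) \<Longrightarrow> x \<in> I \<Longrightarrow> (\<And>x. x \<in> I \<Longrightarrow> v x = v' x) \<Longrightarrow>
    apply_op I M v x = apply_op I M' v' x"
  by (simp add: apply_op_def)

lemma eigensys_cong:
  assumes "eigensys I M K l u" "\<And>x y. x \<in> I \<Longrightarrow> y \<in> I \<Longrightarrow> M' x y = M x y"
  shows "eigensys I M' K l u"
proof -
  have "apply_op I M' v x = apply_op I M v x" if "x \<in> I" for v x
    by (rule apply_op_cong) (use assms that in auto)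
  then show ?thesis using assms(1) by (simp add: eigensys_def)
qed

lemma eigensys_scale:
  assumes "eigensys I M K l u"
  shows "eigensys I (\<lambda>x y. of_real c * M x y) K (\<lambda>k. c * l k) u"
proof -
  have "apply_op I (\<lambda>x y. of_real c * M x y) v x = of_real c * apply_op I M v x" for v x
    by (simp add: apply_op_def sum_distrib_left mult_ac)
  then show ?thesis using assms by (simp add: eigensys_def)
qed

lemma eigensys_trace:
  assumes "eigensys I M K l u" "finite I"
  shows "(\<Sum>x\<in>I. M x x) = of_real (\<Sum>k\<in>K. l k)"
proof -
  have "(\<Sum>x\<in>I. M x x) = (\<Sum>x\<in>I. \<Sum>k\<in>K. of_real (l k) * (cnj (u k x) * u k x))"
    using eigensys_expand[OF assms] by (simp add: mult_ac)
  also have "\<dots> = (\<Sum>k\<in>K. of_real (l k) * braket I (u k) (u k))"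
    unfolding braket_def sum_distrib_left by (rule sum.swap)
  also have "\<dots> = of_real (\<Sum>k\<in>K. l k)"
    using onb_orth[OF eigensys_onb[OF assms(1)]] by simp
  finally show ?thesis .
qed

lemma spectral_theorem:
  assumes "finite I" "pos_semidef I K"
  shows "\<exists>l u. eigensys I K {..<card I} l u \<and> (\<forall>k<card I. 0 \<le> l k)"
proof -
  let ?n = "card I"
  obtain h where h: "bij_betw h {..<?n} I"
    using ex_bij_betw_nat_finite[OF assms(1)] by (auto simp: atLeast0LessThan)
  define g where "g = the_inv_into {..<?n} h"
  have gh: "g (h i) = i" if "i < ?n" for i
    using h that by (simp add: g_def bij_betw_def the_inv_into_f_f)
  have hg: "h (g x) = x" and g: "g x < ?n" if "x \<in> I" for x
    using h that f_the_inv_into_f_bij_betw[OF h] the_inv_into_into[of h "{..<?n}" x "{..<?n}"]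
    by (auto simp: g_def bij_betw_def)
  have sum_h: "(\<Sum>x\<in>I. F x) = (\<Sum>i<?n. F (h i))" for F :: "_ \<Rightarrow> complex"
    using sum.reindex_bij_betw[OF h, of F] by simp
  have "pos_semidef {..<?n} (\<lambda>i j. K (h i) (h j))"
    unfolding pos_semidef_def
  proof
    fix v :: "nat \<Rightarrow> complex"
    have "0 \<le> (\<Sum>x\<in>I. \<Sum>y\<in>I. cnj (v (g x)) * K x y * v (g y))"
      using assms(2) unfolding pos_semidef_def by (rule spec)
    then show "0 \<le> (\<Sum>i<?n. \<Sum>j<?n. cnj (v i) * K (h i) (h j) * v j)"
      by (simp add: sum_h gh)
  qed
  from spectral_theorem_nat[OF this] obtain l u where
    e: "eigensys {..<?n} (\<lambda>i j. K (h i) (h j)) {..<?n} l u" and l: "\<forall>k<?n. 0 \<le> l k" by blast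
  have "eigensys I K {..<?n} l (\<lambda>k x. u k (g x))"
    unfolding eigensys_def onb_def
  proof (intro conjI ballI)
    fix k l assume "k \<in> {..<?n}" "l \<in> {..<?n}"
    then show "braket I (\<lambda>x. u k (g x)) (\<lambda>x. u l (g x)) = of_bool (k = l)"
      using onb_orth[OF eigensys_onb[OF e]] by (simp add: braket_def sum_h gh)
  next
    fix x y assume "x \<in> I" "y \<in> I"
    then have "(\<Sum>k<?n. u k (g x) * cnj (u k (g y))) = of_bool (g x = g y)"
      using onb_complete[OF eigensys_onb[OF e]] g by simp
    also have "g x = g y \<longleftrightarrow> x = y" using hg \<open>x \<in> I\<close> \<open>y \<in> I\<close> by metis
    finally show "(\<Sum>k<?n. u k (g x) * cnj (u k (g y))) = of_bool (x = y)" .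
  next
    fix k x assume "k \<in> {..<?n}" "x \<in> I"
    then show "apply_op I K (\<lambda>x. u k (g x)) x = of_real (l k) * u k (g x)"
      using eigensys_apply[OF e, of k "g x"] g hg by (simp add: apply_op_def sum_h gh)
  qed
  with l show ?thesis by blast
qed

text \<open>For a vector \<open>f a x\<close> of a bipartite system this is the reduced operator on
  \<open>I\<close>; the one on \<open>A\<close> is
  \<open>gram I (\<lambda>x a. f a x)\<close>.\<close>

definition gram :: "'a set \<Rightarrow> ('a \<Rightarrow> 'i ket) \<Rightarrow> 'i oper" where
  "gram A f = (\<lambda>x y. \<Sum>a\<in>A. f a x * cnj (f a y))"

lemma braket_gram: "braket I v (apply_op I (gram A f) w) = (\<Sum>a\<in>A. braket I v (f a) * braket I (f a) w)"
proof -
  have "apply_op I (gram A f) w = (\<lambda>x. \<Sum>a\<in>A. braket I (f a) w * f a x)"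
    using apply_op_rank_one_sum[of I "\<lambda>_. 1" f f A w] by (simp add: gram_def fun_eq_iff)
  then show ?thesis
    by (simp add: braket_sum_right braket_scale_right) (intro sum.cong refl mult.commute)
qed

lemma braket_gram_self:
  "braket I v (apply_op I (gram A f) v) = of_real (\<Sum>a\<in>A. (cmod (braket I (f a) v))\<^sup>2)"
  unfolding braket_gram of_real_sum
  by (intro sum.cong refl) (metis cnj_braket complex_norm_square mult.commute)

lemma pos_semidef_gram: "pos_semidef I (gram A f)"
  unfolding pos_semidef_braket braket_gram_self by (simp add: less_eq_complex_def sum_nonneg)

lemma gram_eigenvalue:
  assumes "eigensys I (gram A f) K l u" "finite I" "k \<in> K"
  shows "l k = (\<Sum>a\<in>A. (cmod (braket I (f a) (u k)))\<^sup>2)"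
  using eigensys_braket_self[OF assms] unfolding braket_gram_self of_real_eq_iff by simp

lemma gram_eigenvalue_nonneg:
  assumes "eigensys I (gram A f) K l u" "finite I" "k \<in> K"
  shows "0 \<le> l k"
  unfolding gram_eigenvalue[OF assms] by (rule sum_nonneg) simp

lemma gram_eigensys:
  assumes "finite I"
  obtains l u where "eigensys I (gram A f) {..<card I} l u"
  using spectral_theorem[OF assms pos_semidef_gram] by blast

text \<open>The weights \<open>|<u k \<otimes> v j, f>|\<^sup>2\<close> have marginals \<open>l\<close> and \<open>m\<close>, and they vanish
  unless \<open>l k = m j\<close>.\<close>

lemma gram_transpose_eigenvalue_sum:
  fixes g :: "real \<Rightarrow> real"
  assumes u: "eigensys I (gram A f) K l u" and v: "eigensys A (gram I (\<lambda>x a. f a x)) J m v"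
    and fin: "finite I" "finite A"
  shows "(\<Sum>k\<in>K. l k * g (l k)) = (\<Sum>j\<in>J. m j * g (m j))"
proof -
  define \<kappa> where "\<kappa> k j = (\<Sum>x\<in>I. \<Sum>a\<in>A. cnj (u k x) * cnj (v j a) * f a x)" for k j
  have \<kappa>1: "\<kappa> k j = braket A (v j) (\<lambda>a. braket I (u k) (f a))" for k j
    unfolding \<kappa>_def braket_def
    by (subst sum.swap) (simp add: sum_distrib_left mult_ac)
  have \<kappa>2: "\<kappa> k j = braket I (u k) (\<lambda>x. braket A (v j) (\<lambda>a. f a x))" for k j
    unfolding \<kappa>_def braket_def by (simp add: sum_distrib_left mult_ac)
  have l: "(\<Sum>j\<in>J. (cmod (\<kappa> k j))\<^sup>2) = l k" if "k \<in> K" for k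
    unfolding \<kappa>1 onb_parseval_norm[OF eigensys_onb[OF v] fin(2)] gram_eigenvalue[OF u fin(1) that]
    by (simp add: braket_cnj_swap)
  have m: "(\<Sum>k\<in>K. (cmod (\<kappa> k j))\<^sup>2) = m j" if "j \<in> J" for j
    unfolding \<kappa>2 onb_parseval_norm[OF eigensys_onb[OF u] fin(1)] gram_eigenvalue[OF v fin(2) that]
    by (simp add: braket_cnj_swap)
  have \<kappa>_eq: "of_real (l k) * \<kappa> k j = of_real (m j) * \<kappa> k j" if "k \<in> K" "j \<in> J" for k j
  proof -
    have "of_real (l k) * \<kappa> k j = braket I (u k) (apply_op I (gram A f) (\<lambda>x. braket A (v j) (\<lambda>a. f a x)))"
      unfolding \<kappa>2 by (rule eigensys_braket_left[OF u fin(1) that(1), symmetric])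
    also have "\<dots> = (\<Sum>a\<in>A. \<Sum>x\<in>I. \<Sum>a'\<in>A. \<Sum>y\<in>I.
        cnj (u k y) * f a y * cnj (f a x) * cnj (v j a') * f a' x)"
      unfolding braket_gram unfolding braket_def
      by (simp add: sum_distrib_left sum_distrib_right mult_ac)
    also have "\<dots> = (\<Sum>x\<in>I. \<Sum>a\<in>A. \<Sum>a'\<in>A. \<Sum>y\<in>I.
        cnj (u k y) * f a y * cnj (f a x) * cnj (v j a') * f a' x)"
      by (rule sum.swap)
    also have "\<dots> = (\<Sum>x\<in>I. \<Sum>a'\<in>A. \<Sum>a\<in>A. \<Sum>y\<in>I.
        cnj (u k y) * f a y * cnj (f a x) * cnj (v j a') * f a' x)"
      by (intro sum.cong refl sum.swap)
    also have "\<dots> = braket A (v j) (apply_op A (gram I (\<lambda>x a. f a x)) (\<lambda>a. braket I (u k) (f a)))"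
      unfolding braket_gram unfolding braket_def sum_product
      by (simp add: sum_distrib_left mult_ac)
    also have "\<dots> = of_real (m j) * \<kappa> k j"
      unfolding \<kappa>1 by (rule eigensys_braket_left[OF v fin(2) that(2)])
    finally show ?thesis .
  qed
  have eq: "(cmod (\<kappa> k j))\<^sup>2 * g (l k) = (cmod (\<kappa> k j))\<^sup>2 * g (m j)" if "k \<in> K" "j \<in> J" for k j
    using \<kappa>_eq[OF that] by (cases "\<kappa> k j = 0") auto
  have "(\<Sum>k\<in>K. l k * g (l k)) = (\<Sum>k\<in>K. \<Sum>j\<in>J. (cmod (\<kappa> k j))\<^sup>2 * g (l k))"
    by (simp add: sum_distrib_right[symmetric] l)
  also have "\<dots> = (\<Sum>k\<in>K. \<Sum>j\<in>J. (cmod (\<kappa> k j))\<^sup>2 * g (m j))"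
    by (intro sum.cong refl eq)
  also have "\<dots> = (\<Sum>j\<in>J. \<Sum>k\<in>K. (cmod (\<kappa> k j))\<^sup>2 * g (m j))"
    by (rule sum.swap)
  also have "\<dots> = (\<Sum>j\<in>J. m j * g (m j))"
    by (simp add: sum_distrib_right[symmetric] m)
  finally show ?thesis .
qed

text \<open>Natural units, and no normalization of the trace.  For Gram operators the choice of the
  eigensystem does not matter, see \<open>entr_gram\<close>.\<close>

definition entr :: "'i set \<Rightarrow> 'i oper \<Rightarrow> real" where
  "entr I M = (SOME e. \<exists>l u. eigensys I M {..<card I} l u \<and> e = - (\<Sum>k<card I. l k * ln (l k)))"

text \<open>Comparison with an eigensystem of the other reduced operator evaluates the choice inside
  \<open>entr\<close>, whatever it is. Transposing twice then gives \<open>entr_gram\<close> for the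
  original operator.\<close>

lemma entr_transpose:
  assumes "finite I" "finite A" "eigensys A (gram I (\<lambda>x a. f a x)) J m v"
  shows "entr I (gram A f) = - (\<Sum>j\<in>J. m j * ln (m j))"
proof -
  obtain l u where "eigensys I (gram A f) {..<card I} l u" by (rule gram_eigensys[OF assms(1)])
  then have "\<exists>e. \<exists>l u. eigensys I (gram A f) {..<card I} l u \<and> e = - (\<Sum>k<card I. l k * ln (l k))"
    by blast
  from someI_ex[OF this] obtain l u where lu: "eigensys I (gram A f) {..<card I} l u"
    "entr I (gram A f) = - (\<Sum>k<card I. l k * ln (l k))" unfolding entr_def by blast
  from lu(2) gram_transpose_eigenvalue_sum[OF lu(1) assms(3,1,2), of ln] show ?thesis by simp
qed

lemma entr_gram_transpose:
  assumes "finite I" "finite A"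
  shows "entr I (gram A f) = entr A (gram I (\<lambda>x a. f a x))"
proof -
  obtain l u where l: "eigensys I (gram A f) {..<card I} l u" by (rule gram_eigensys[OF assms(1)])
  obtain m v where m: "eigensys A (gram I (\<lambda>x a. f a x)) {..<card A} m v" by (rule gram_eigensys[OF assms(2)])
  show ?thesis
    unfolding entr_transpose[OF assms m] entr_transpose[OF assms(2,1), of "\<lambda>x a. f a x", OF l]
    by (simp add: gram_transpose_eigenvalue_sum[OF l m assms])
qed

lemma entr_gram:
  assumes "finite I" "finite A" "eigensys I (gram A f) K l u"
  shows "entr I (gram A f) = - (\<Sum>k\<in>K. l k * ln (l k))"
  unfolding entr_gram_transpose[OF assms(1,2)] by (rule entr_transpose[OF assms(2,1)]) (rule assms(3))

section \<open>Relative entropy and pinching\<close>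

definition hs_inner :: "'i set \<Rightarrow> 'i oper \<Rightarrow> 'i oper \<Rightarrow> complex" where
  "hs_inner I Y Z = (\<Sum>x\<in>I. \<Sum>y\<in>I. cnj (Y x y) * Z x y)"

definition op_mult :: "'i set \<Rightarrow> 'i oper \<Rightarrow> 'i oper \<Rightarrow> 'i oper" where
  "op_mult I M N = (\<lambda>x y. \<Sum>z\<in>I. M x z * N z y)"

lemma apply_op_mult: "apply_op I (op_mult I M N) v = apply_op I M (apply_op I N v)"
proof
  fix x
  have "apply_op I (op_mult I M N) v x = (\<Sum>y\<in>I. \<Sum>z\<in>I. M x z * (N z y * v y))"
    by (simp add: apply_op_def op_mult_def sum_distrib_right mult.assoc)
  also have "\<dots> = (\<Sum>z\<in>I. \<Sum>y\<in>I. M x z * (N z y * v y))" by (rule sum.swap)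
  also have "\<dots> = apply_op I M (apply_op I N v) x"
    by (simp add: apply_op_def sum_distrib_left)
  finally show "apply_op I (op_mult I M N) v x = apply_op I M (apply_op I N v) x" .
qed

text \<open>Rows are expanded in \<open>w\<close> and columns in \<open>u\<close>: in these mixed
  coordinates left multiplication by \<open>S\<close> and right multiplication by \<open>R\<close>
  become diagonal at once, even if \<open>R\<close> and \<open>S\<close> do not commute.\<close>

lemma hs_inner_parseval:
  assumes u: "onb I K u" and w: "onb I L w" and fin: "finite I"
  shows "(\<Sum>l\<in>L. \<Sum>k\<in>K. cnj (braket I (w l) (apply_op I Y (u k))) * braket I (w l) (apply_op I Z (u k))) =
    hs_inner I Y Z"
proof -
  have "(\<Sum>l\<in>L. \<Sum>k\<in>K. cnj (braket I (w l) (apply_op I Y (u k))) * braket I (w l) (apply_op I Z (u k))) =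
      (\<Sum>k\<in>K. \<Sum>l\<in>L. braket I (apply_op I Y (u k)) (w l) * braket I (w l) (apply_op I Z (u k)))"
    unfolding cnj_braket by (rule sum.swap)
  also have "\<dots> = (\<Sum>k\<in>K. braket I (apply_op I Y (u k)) (apply_op I Z (u k)))"
    by (simp add: onb_parseval[OF w fin])
  also have "\<dots> = (\<Sum>x\<in>I. \<Sum>k\<in>K. cnj (apply_op I Y (u k) x) * apply_op I Z (u k) x)"
    unfolding braket_def by (rule sum.swap)
  also have "\<dots> = (\<Sum>x\<in>I. \<Sum>k\<in>K. braket I (\<lambda>y. cnj (Z x y)) (u k) * braket I (u k) (\<lambda>y. cnj (Y x y)))"
    by (simp add: braket_def apply_op_def cnj_sum mult.commute)
  also have "\<dots> = hs_inner I Y Z"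
    unfolding onb_parseval[OF u fin] by (simp add: braket_def hs_inner_def mult.commute)
  finally show ?thesis .
qed

text \<open>With \<open>L\<^sub>S\<close>, \<open>R\<^sub>R\<close> the left and right multiplications by \<open>S\<close> and \<open>R\<close>, the supremum of this
  functional over \<open>Y\<close> is \<open>\<langle>R - S, (q L\<^sub>S + (1 - q) R\<^sub>R)\<^sup>-\<^sup>1 (R - S)\<rangle>\<close>.\<close>

definition variational :: "'i set \<Rightarrow> 'i oper \<Rightarrow> 'i oper \<Rightarrow> real \<Rightarrow> 'i oper \<Rightarrow> real" where
  "variational I R S q Y = 2 * Re (hs_inner I Y (\<lambda>x y. R x y - S x y))
     - q * Re (hs_inner I Y (op_mult I S Y)) - (1 - q) * Re (hs_inner I Y (op_mult I Y R))"

text \<open>The supremum in mixed coordinates. For nonnegative eigenvalues and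
  \<open>0 < q < 1\<close> a denominator vanishes only if \<open>r k = s l = 0\<close>, and the term
  is then rightly 0.\<close>

definition variational_sup ::
  "'i set \<Rightarrow> 'k set \<Rightarrow> ('k \<Rightarrow> real) \<Rightarrow> ('k \<Rightarrow> 'i ket) \<Rightarrow> 'l set \<Rightarrow> ('l \<Rightarrow> real) \<Rightarrow> ('l \<Rightarrow> 'i ket) \<Rightarrow> real \<Rightarrow> real" where
  "variational_sup I K r u L s w q =
     (\<Sum>l\<in>L. \<Sum>k\<in>K. (cmod (braket I (w l) (u k)))\<^sup>2 * ((r k - s l)\<^sup>2 / (q * s l + (1 - q) * r k)))"

text \<open>On the matrix element \<open><w l, Y (u k)>\<close> the two multiplications act as the
  numbers \<open>s l\<close> and \<open>r k\<close>, so the functional splits into independent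
  quadratics, one for each pair.\<close>

lemma variational_eigen:
  assumes R: "eigensys I R K r u" and S: "eigensys I S L s w" and fin: "finite I"
  shows "variational I R S q Y = (\<Sum>l\<in>L. \<Sum>k\<in>K.
    2 * Re (cnj (braket I (w l) (apply_op I Y (u k))) * (of_real (r k - s l) * braket I (w l) (u k)))
    - (q * s l + (1 - q) * r k) * (cmod (braket I (w l) (apply_op I Y (u k))))\<^sup>2)"
proof -
  define \<eta> where "\<eta> l k = braket I (w l) (apply_op I Y (u k))" for l k
  note pars = hs_inner_parseval[OF eigensys_onb[OF R] eigensys_onb[OF S] fin, of Y, symmetric]
  have Ru: "braket I f (apply_op I M (apply_op I R (u k))) = of_real (r k) * braket I f (apply_op I M (u k))"
    if "k \<in> K" for f M k
  proof -
    have "braket I f (apply_op I M (apply_op I R (u k))) = braket I f (apply_op I M (\<lambda>x. of_real (r k) * u k x))"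
      using that by (intro braket_cong refl apply_op_cong) (auto simp: eigensys_apply[OF R])
    also have "apply_op I M (\<lambda>x. of_real (r k) * u k x) = (\<lambda>x. of_real (r k) * apply_op I M (u k) x)"
      by (rule ext) (rule apply_op_scale)
    finally show ?thesis by (simp add: braket_scale_right)
  qed
  have lin: "braket I (w l) (apply_op I (\<lambda>x y. R x y - S x y) (u k)) = of_real (r k - s l) * braket I (w l) (u k)"
    if "l \<in> L" "k \<in> K" for l k
  proof -
    have "braket I (w l) (apply_op I (\<lambda>x y. R x y - S x y) (u k)) =
        braket I (w l) (\<lambda>x. apply_op I R (u k) x - apply_op I S (u k) x)"
      by (intro braket_cong refl) (simp add: apply_op_def algebra_simps sum_subtractf)
    also have "\<dots> = braket I (w l) (apply_op I R (u k)) - braket I (w l) (apply_op I S (u k))"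
      by (rule braket_diff_right)
    also have "braket I (w l) (apply_op I R (u k)) = braket I (w l) (\<lambda>x. of_real (r k) * u k x)"
      using that by (intro braket_cong refl) (auto simp: eigensys_apply[OF R])
    also have "braket I (w l) (apply_op I S (u k)) = of_real (s l) * braket I (w l) (u k)"
      by (rule eigensys_braket_left[OF S fin that(1)])
    finally show ?thesis by (simp add: braket_scale_right algebra_simps)
  qed
  have 1: "hs_inner I Y (\<lambda>x y. R x y - S x y) =
      (\<Sum>l\<in>L. \<Sum>k\<in>K. cnj (\<eta> l k) * (of_real (r k - s l) * braket I (w l) (u k)))"
    unfolding pars \<eta>_def by (intro sum.cong refl) (simp add: lin)
  have 2: "hs_inner I Y (op_mult I S Y) = of_real (\<Sum>l\<in>L. \<Sum>k\<in>K. s l * (cmod (\<eta> l k))\<^sup>2)"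
    unfolding pars \<eta>_def of_real_sum
  proof (intro sum.cong refl)
    fix l k assume "l \<in> L" "k \<in> K"
    then have "braket I (w l) (apply_op I (op_mult I S Y) (u k)) = of_real (s l) * braket I (w l) (apply_op I Y (u k))"
      by (simp add: apply_op_mult eigensys_braket_left[OF S fin])
    then show "cnj (braket I (w l) (apply_op I Y (u k))) * braket I (w l) (apply_op I (op_mult I S Y) (u k)) =
        of_real (s l * (cmod (braket I (w l) (apply_op I Y (u k))))\<^sup>2)"
      by (simp only: of_real_mult complex_norm_square mult_ac)
  qed
  have 3: "hs_inner I Y (op_mult I Y R) = of_real (\<Sum>l\<in>L. \<Sum>k\<in>K. r k * (cmod (\<eta> l k))\<^sup>2)"
    unfolding pars \<eta>_def of_real_sum
  proof (intro sum.cong refl)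
    fix l k assume "l \<in> L" "k \<in> K"
    then have "braket I (w l) (apply_op I (op_mult I Y R) (u k)) = of_real (r k) * braket I (w l) (apply_op I Y (u k))"
      by (simp add: apply_op_mult Ru)
    then show "cnj (braket I (w l) (apply_op I Y (u k))) * braket I (w l) (apply_op I (op_mult I Y R) (u k)) =
        of_real (r k * (cmod (braket I (w l) (apply_op I Y (u k))))\<^sup>2)"
      by (simp only: of_real_mult complex_norm_square mult_ac)
  qed
  show ?thesis
    unfolding variational_def 1 2 3 \<eta>_def[symmetric]
    by (simp add: sum_distrib_left sum_subtractf sum.distrib algebra_simps)
qed

lemma complete_square_le:
  fixes \<eta> g :: complex
  assumes "0 < c"
  shows "2 * Re (cnj \<eta> * (of_real d * g)) - c * (cmod \<eta>)\<^sup>2 \<le> (cmod g)\<^sup>2 * (d\<^sup>2 / c)"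
proof -
  have "0 \<le> ((c * Re \<eta> - d * Re g)\<^sup>2 + (c * Im \<eta> - d * Im g)\<^sup>2) / c" using assms by simp
  also have "\<dots> = (cmod g)\<^sup>2 * (d\<^sup>2 / c) - (2 * Re (cnj \<eta> * (of_real d * g)) - c * (cmod \<eta>)\<^sup>2)"
    using assms unfolding cmod_power2 by (simp add: field_simps power2_eq_square)
  finally show ?thesis by simp
qed

lemma variational_le_sup:
  assumes "eigensys I R K r u" "eigensys I S L s w" "finite I" "0 < q" "q < 1"
    and "\<And>k. k \<in> K \<Longrightarrow> 0 \<le> r k" "\<And>l. l \<in> L \<Longrightarrow> 0 \<le> s l"
  shows "variational I R S q Y \<le> variational_sup I K r u L s w q"
  unfolding variational_eigen[OF assms(1-3)] variational_sup_def
proof (intro sum_mono)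
  fix l k assume "l \<in> L" "k \<in> K"
  then have nn: "0 \<le> q * s l" "0 \<le> (1 - q) * r k" using assms by simp_all
  show "2 * Re (cnj (braket I (w l) (apply_op I Y (u k))) * (of_real (r k - s l) * braket I (w l) (u k)))
      - (q * s l + (1 - q) * r k) * (cmod (braket I (w l) (apply_op I Y (u k))))\<^sup>2
    \<le> (cmod (braket I (w l) (u k)))\<^sup>2 * ((r k - s l)\<^sup>2 / (q * s l + (1 - q) * r k))"
  proof (cases "q * s l + (1 - q) * r k = 0")
    case True
    then have "q * s l = 0" "(1 - q) * r k = 0" using nn by linarith+
    then have "s l = 0" "r k = 0" using assms(4,5) by simp_all
    then show ?thesis by simp
  next
    case False
    with nn have "0 < q * s l + (1 - q) * r k" by linarith
    then show ?thesis by (rule complete_square_le)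
  qed
qed

lemma variational_attained:
  assumes R: "eigensys I R K r u" and S: "eigensys I S L s w"
    and fin: "finite I" "finite K" "finite L"
  shows "\<exists>Y. variational I R S q Y = variational_sup I K r u L s w q"
proof -
  define c where "c l k = q * s l + (1 - q) * r k" for l k
  \<comment> \<open>The stationary point of each quadratic. If \<open>c l k = 0\<close>, division
    makes \<open>\<eta> l k = 0\<close>, and both values compared below vanish.\<close>
  define \<eta> where "\<eta> l k = of_real ((r k - s l) / c l k) * braket I (w l) (u k)" for l k
  \<comment> \<open>The factor 1 gives the sum the shape of
    \<open>apply_op_rank_one_sum\<close>.\<close>
  define Y where "Y = (\<lambda>x y. \<Sum>k\<in>K. 1 * (\<Sum>l\<in>L. \<eta> l k * w l x) * cnj (u k y))"
  have coef: "braket I (w l) (apply_op I Y (u k)) = \<eta> l k" if "l \<in> L" "k \<in> K" for l k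
  proof -
    have "apply_op I Y (u k) = (\<lambda>x. \<Sum>l\<in>L. \<eta> l k * w l x)"
    proof
      fix x
      have "apply_op I Y (u k) x = (\<Sum>k'\<in>K. (\<Sum>l\<in>L. \<eta> l k' * w l x) * of_bool (k' = k))"
        unfolding Y_def apply_op_rank_one_sum[where u = "\<lambda>k x. \<Sum>l\<in>L. \<eta> l k * w l x"]
        using onb_orth[OF eigensys_onb[OF R] _ that(2)] by (intro sum.cong refl) simp
      also have "\<dots> = (\<Sum>l\<in>L. \<eta> l k * w l x)" by (rule sum_mult_of_bool(1)[OF fin(2) that(2)])
      finally show "apply_op I Y (u k) x = (\<Sum>l\<in>L. \<eta> l k * w l x)" .
    qed
    then have "braket I (w l) (apply_op I Y (u k)) = (\<Sum>l'\<in>L. \<eta> l' k * of_bool (l = l'))"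
      using onb_orth[OF eigensys_onb[OF S] that(1)]
      by (simp add: braket_sum_right braket_scale_right)
    also have "\<dots> = \<eta> l k" by (rule sum_mult_of_bool(2)[OF fin(3) that(1)])
    finally show ?thesis .
  qed
  have "2 * Re (cnj (\<eta> l k) * (of_real (r k - s l) * braket I (w l) (u k))) - c l k * (cmod (\<eta> l k))\<^sup>2
      = (cmod (braket I (w l) (u k)))\<^sup>2 * ((r k - s l)\<^sup>2 / c l k)" for l k
    unfolding cmod_power2 \<eta>_def
    by (cases "c l k = 0") (simp_all add: field_simps power2_eq_square)
  then have "variational I R S q Y = variational_sup I K r u L s w q"
    unfolding variational_eigen[OF R S fin(1)] variational_sup_def
    by (intro sum.cong refl) (simp add: coef flip: c_def)
  then show ?thesis by (rule exI[of _ Y])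
qed

definition diag_block :: "('b \<times> 'x) oper \<Rightarrow> 'x \<Rightarrow> 'b oper" where
  "diag_block M x = (\<lambda>b b'. M (b, x) (b', x))"

text \<open>Paired with or multiplied by a block diagonal \<open>Y\<close>, the operators enter only
  through their diagonal blocks; such \<open>Y\<close> see nothing but the pinched
  operators.\<close>

lemma variational_block_diagonal:
  assumes "finite B" "finite X"
  shows "variational (B \<times> X) R S q (\<lambda>(b, x) (b', x'). Y x b b' * of_bool (x = x')) =
    (\<Sum>x\<in>X. variational B (diag_block R x) (diag_block S x) q (Y x))"
proof -
  let ?Y = "\<lambda>(b, x) (b', x'). Y x b b' * of_bool (x = x')"
  have hs: "hs_inner (B \<times> X) ?Y Z = (\<Sum>x\<in>X. hs_inner B (Y x) (diag_block Z x))" for Z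
  proof -
    have "hs_inner (B \<times> X) ?Y Z =
        (\<Sum>b\<in>B. \<Sum>x\<in>X. \<Sum>b'\<in>B. \<Sum>x'\<in>X. cnj (Y x b b') * Z (b, x) (b', x') * of_bool (x = x'))"
      unfolding hs_inner_def sum.cartesian_product' by (intro sum.cong refl) simp
    also have "\<dots> = (\<Sum>b\<in>B. \<Sum>x\<in>X. \<Sum>b'\<in>B. cnj (Y x b b') * Z (b, x) (b', x))"
      by (intro sum.cong refl sum_mult_of_bool(2) assms)
    also have "\<dots> = (\<Sum>x\<in>X. hs_inner B (Y x) (diag_block Z x))"
      unfolding hs_inner_def diag_block_def by (rule sum.swap)
    finally show ?thesis .
  qed
  have SY: "hs_inner B (Y x) (diag_block (op_mult (B \<times> X) S ?Y) x) = hs_inner B (Y x) (op_mult B (diag_block S x) (Y x))"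
    if "x \<in> X" for x
    unfolding hs_inner_def
  proof (intro sum.cong refl arg_cong2[of _ _ _ _ "(*)"])
    fix b b' assume "b \<in> B" "b' \<in> B"
    have "diag_block (op_mult (B \<times> X) S ?Y) x b b' = (\<Sum>c\<in>B. \<Sum>z\<in>X. S (b, x) (c, z) * Y z c b' * of_bool (z = x))"
      unfolding diag_block_def op_mult_def sum.cartesian_product' by (intro sum.cong refl) simp
    also have "\<dots> = (\<Sum>c\<in>B. S (b, x) (c, x) * Y x c b')"
      by (intro sum.cong refl sum_mult_of_bool(1) assms that)
    finally show "diag_block (op_mult (B \<times> X) S ?Y) x b b' = op_mult B (diag_block S x) (Y x) b b'"
      by (simp add: op_mult_def diag_block_def)
  qed
  have YR: "hs_inner B (Y x) (diag_block (op_mult (B \<times> X) ?Y R) x) = hs_inner B (Y x) (op_mult B (Y x) (diag_block R x))"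
    if "x \<in> X" for x
    unfolding hs_inner_def
  proof (intro sum.cong refl arg_cong2[of _ _ _ _ "(*)"])
    fix b b' assume "b \<in> B" "b' \<in> B"
    have "diag_block (op_mult (B \<times> X) ?Y R) x b b' = (\<Sum>c\<in>B. \<Sum>z\<in>X. Y x b c * R (c, z) (b', x) * of_bool (x = z))"
      unfolding diag_block_def op_mult_def sum.cartesian_product' by (intro sum.cong refl) simp
    also have "\<dots> = (\<Sum>c\<in>B. Y x b c * R (c, x) (b', x))"
      by (intro sum.cong refl sum_mult_of_bool(2) assms that)
    finally show "diag_block (op_mult (B \<times> X) ?Y R) x b b' = op_mult B (Y x) (diag_block R x) b b'"
      by (simp add: op_mult_def diag_block_def)
  qed
  have d: "diag_block (\<lambda>a b. R a b - S a b) x = (\<lambda>b b'. diag_block R x b b' - diag_block S x b b')" for x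
    by (simp add: diag_block_def)
  show ?thesis
    unfolding variational_def hs d
    by (simp add: SY YR Re_sum sum_subtractf sum_distrib_left del: split_paired_All)
qed

text \<open>This is \<open>tr (R ln R - R ln S) - tr R + tr S\<close>, see
  \<open>rel_entr_eq\<close>. The traces come from the linear part of \<open>rel_entr_path\<close>
  and cancel when they agree.\<close>

definition rel_entr ::
  "'i set \<Rightarrow> 'k set \<Rightarrow> ('k \<Rightarrow> real) \<Rightarrow> ('k \<Rightarrow> 'i ket) \<Rightarrow> 'l set \<Rightarrow> ('l \<Rightarrow> real) \<Rightarrow> ('l \<Rightarrow> 'i ket) \<Rightarrow> real" where
  "rel_entr I K r u L s w =
     (\<Sum>l\<in>L. \<Sum>k\<in>K. (cmod (braket I (w l) (u k)))\<^sup>2 * (r k * ln (r k) - r k * ln (s l) - r k + s l))"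

text \<open>An antiderivative of the integrand \<open>q * variational_sup\<close>; its values at 1
  and 0 supply the logarithms of \<open>s l\<close> and of \<open>r k\<close>.\<close>

definition rel_entr_path ::
  "'i set \<Rightarrow> 'k set \<Rightarrow> ('k \<Rightarrow> real) \<Rightarrow> ('k \<Rightarrow> 'i ket) \<Rightarrow> 'l set \<Rightarrow> ('l \<Rightarrow> real) \<Rightarrow> ('l \<Rightarrow> 'i ket) \<Rightarrow> real \<Rightarrow> real" where
  "rel_entr_path I K r u L s w q = (\<Sum>l\<in>L. \<Sum>k\<in>K. (cmod (braket I (w l) (u k)))\<^sup>2 *
     ((q * s l + (1 - q) * r k) - r k * ln (q * s l + (1 - q) * r k)))"

lemma rel_entr_path_diff: "rel_entr_path I K r u L s w 1 - rel_entr_path I K r u L s w 0 = rel_entr I K r u L s w"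
  unfolding rel_entr_path_def rel_entr_def sum_subtractf[symmetric]
  by (intro sum.cong refl) (simp add: algebra_simps)

text \<open>Positivity, and the kernel of \<open>S\<close> inside that of \<open>R\<close>.
  Otherwise the relative entropy is infinite, whereas the default \<open>ln 0 = 0\<close> would make
  \<open>rel_entr\<close> finite and \<open>rel_entr_path\<close> discontinuous at
  \<open>q = 1\<close>.\<close>

definition supp_le ::
  "'i set \<Rightarrow> 'k set \<Rightarrow> ('k \<Rightarrow> real) \<Rightarrow> ('k \<Rightarrow> 'i ket) \<Rightarrow> 'l set \<Rightarrow> ('l \<Rightarrow> real) \<Rightarrow> ('l \<Rightarrow> 'i ket) \<Rightarrow> bool" where
  "supp_le I K r u L s w \<longleftrightarrow> (\<forall>k\<in>K. 0 \<le> r k) \<and> (\<forall>l\<in>L. 0 \<le> s l) \<and>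
     (\<forall>k\<in>K. \<forall>l\<in>L. s l = 0 \<longrightarrow> r k = 0 \<or> braket I (w l) (u k) = 0)"

lemma rel_entr_path_deriv:
  assumes "supp_le I K r u L s w" "0 < q" "q < 1"
  shows "(rel_entr_path I K r u L s w has_real_derivative q * variational_sup I K r u L s w q) (at q)"
proof -
  have "((\<lambda>q. (q * s l + (1 - q) * r k) - r k * ln (q * s l + (1 - q) * r k)) has_real_derivative
      q * ((r k - s l)\<^sup>2 / (q * s l + (1 - q) * r k))) (at q)" if "l \<in> L" "k \<in> K" for l k
  proof (cases "r k = 0 \<and> s l = 0")
    case True
    then show ?thesis by simp
  next
    case False
    have nn: "0 \<le> q * s l" "0 \<le> (1 - q) * r k" using assms that by (auto simp: supp_le_def)
    have "0 < q * s l \<or> 0 < (1 - q) * r k" using False assms that by (force simp: supp_le_def)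
    with nn have v: "0 < q * s l + (1 - q) * r k" by linarith
    show ?thesis
      by (rule derivative_eq_intros refl v | use v in \<open>simp add: field_simps power2_eq_square\<close>)+
  qed
  then show ?thesis
    unfolding rel_entr_path_def[abs_def] variational_sup_def sum_distrib_left mult.left_commute[of q]
    by (intro DERIV_sum DERIV_cmult) auto
qed

lemma rel_entr_path_continuous:
  assumes "supp_le I K r u L s w"
  shows "continuous_on {0..1} (rel_entr_path I K r u L s w)"
  unfolding rel_entr_path_def[abs_def]
proof (intro continuous_on_sum)
  fix l k assume lk: "l \<in> L" "k \<in> K"
  \<comment> \<open>A vanishing overlap or \<open>r k = 0\<close> removes the logarithm; otherwise
    both eigenvalues are positive and its argument is positive up to the endpoints.\<close>
  consider "braket I (w l) (u k) = 0" | "r k = 0" | "0 < r k" "0 < s l"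
    using assms lk unfolding supp_le_def by force
  then show "continuous_on {0..1} (\<lambda>q. (cmod (braket I (w l) (u k)))\<^sup>2 *
     ((q * s l + (1 - q) * r k) - r k * ln (q * s l + (1 - q) * r k)))"
  proof cases
    case 3
    have "q * s l + (1 - q) * r k \<noteq> 0" if "q \<in> {0..1}" for q
    proof -
      have "0 \<le> q * s l" "0 \<le> (1 - q) * r k" using 3 that by auto
      moreover have "0 < q * s l \<or> 0 < (1 - q) * r k" using 3 that by (cases "q = 0") auto
      ultimately show ?thesis by linarith
    qed
    then show ?thesis by (intro continuous_intros) auto
  qed (auto intro!: continuous_intros)
qed

text \<open>On block diagonal \<open>Y\<close>, the variational functional of the whole system is the sum of
  those of the blocks.\<close>

lemma rel_entr_pinching:
  assumes fin: "finite B" "finite X" "finite K" "finite L"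
    and R: "eigensys (B \<times> X) R K r u" and S: "eigensys (B \<times> X) S L s w"
    and supp: "supp_le (B \<times> X) K r u L s w"
    and Rx: "\<And>x. x \<in> X \<Longrightarrow> eigensys B (diag_block R x) K' (r' x) (u' x)"
    and Sx: "\<And>x. x \<in> X \<Longrightarrow> eigensys B (diag_block S x) L' (s' x) (w' x)"
    and fin': "finite K'" "finite L'"
    and supp': "\<And>x. x \<in> X \<Longrightarrow> supp_le B K' (r' x) (u' x) L' (s' x) (w' x)"
  shows "(\<Sum>x\<in>X. rel_entr B K' (r' x) (u' x) L' (s' x) (w' x)) \<le> rel_entr (B \<times> X) K r u L s w"
proof -
  \<comment> \<open>The increment of \<open>f\<close> over [0, 1] is the difference of the two
    sides. The derivative is computed only inside the interval; continuity carries the sign to the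
    ends.\<close>
  define f where "f q = rel_entr_path (B \<times> X) K r u L s w q
    - (\<Sum>x\<in>X. rel_entr_path B K' (r' x) (u' x) L' (s' x) (w' x) q)" for q
  have "f 0 \<le> f 1"
  proof (rule DERIV_nonneg_imp_increasing_open[of 0 1 f])
    fix q :: real assume q: "0 < q" "q < 1"
    define V where "V x = variational_sup B K' (r' x) (u' x) L' (s' x) (w' x) q" for x
    \<comment> \<open>Optimal blocks, chosen separately for each \<open>x\<close>, assemble into one
      competitor for the whole system.\<close>
    have "\<exists>Y. \<forall>x\<in>X. variational B (diag_block R x) (diag_block S x) q (Y x) = V x"
      unfolding V_def by (intro bchoice ballI variational_attained Rx Sx fin fin')
    then obtain Y where Y: "\<And>x. x \<in> X \<Longrightarrow> variational B (diag_block R x) (diag_block S x) q (Y x) = V x"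
      by blast
    have "(\<Sum>x\<in>X. V x) = (\<Sum>x\<in>X. variational B (diag_block R x) (diag_block S x) q (Y x))"
      by (simp add: Y)
    also have "\<dots> = variational (B \<times> X) R S q (\<lambda>(b, x) (b', x'). Y x b b' * of_bool (x = x'))"
      by (rule variational_block_diagonal[OF fin(1,2), symmetric])
    also have "\<dots> \<le> variational_sup (B \<times> X) K r u L s w q"
      using supp by (intro variational_le_sup[OF R S _ q]) (auto simp: fin supp_le_def)
    finally have "(\<Sum>x\<in>X. V x) \<le> variational_sup (B \<times> X) K r u L s w q" .
    then have "0 \<le> q * variational_sup (B \<times> X) K r u L s w q - (\<Sum>x\<in>X. q * V x)"
      using q by (simp flip: sum_distrib_left)
    moreover have "(f has_real_derivative q * variational_sup (B \<times> X) K r u L s w q - (\<Sum>x\<in>X. q * V x)) (at q)"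
      unfolding f_def[abs_def] V_def
      by (rule DERIV_diff[OF rel_entr_path_deriv[OF supp q]], rule DERIV_sum)
        (rule rel_entr_path_deriv[OF supp' q])
    ultimately show "\<exists>y. (f has_real_derivative y) (at q) \<and> 0 \<le> y" by blast
  next
    show "continuous_on {0..1} f"
      unfolding f_def[abs_def]
      by (intro continuous_on_diff continuous_on_sum rel_entr_path_continuous supp supp')
  qed simp
  then have "0 \<le> f 1 - f 0" by simp
  also have "f 1 - f 0 = rel_entr (B \<times> X) K r u L s w - (\<Sum>x\<in>X. rel_entr B K' (r' x) (u' x) L' (s' x) (w' x))"
    unfolding f_def rel_entr_path_diff[symmetric] sum_subtractf by simp
  finally show ?thesis by simp
qed

section \<open>Complementary measurements\<close>

lemma entr_cong:
  assumes "\<And>x y. x \<in> I \<Longrightarrow> y \<in> I \<Longrightarrow> M x y = M' x y"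
  shows "entr I M = entr I M'"
proof -
  have "eigensys I M K l u \<longleftrightarrow> eigensys I M' K l u" for l u and K :: "nat set"
    using eigensys_cong[of I M K l u M'] eigensys_cong[of I M' K l u M] assms by metis
  then show ?thesis by (simp add: entr_def)
qed

lemma eigensys_expectation:
  assumes "eigensys I R K r u" "finite I"
  shows "braket I v (apply_op I R v) = of_real (\<Sum>k\<in>K. r k * (cmod (braket I v (u k)))\<^sup>2)"
proof -
  have "braket I v (apply_op I R v) = (\<Sum>k\<in>K. braket I v (u k) * braket I (u k) (apply_op I R v))"
    by (rule onb_parseval[OF eigensys_onb[OF assms(1)] assms(2), symmetric])
  also have "\<dots> = of_real (\<Sum>k\<in>K. r k * (cmod (braket I v (u k)))\<^sup>2)"
    unfolding of_real_sum
  proof (intro sum.cong refl)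
    fix k assume "k \<in> K"
    then have "braket I v (u k) * braket I (u k) (apply_op I R v) =
        of_real (r k) * (braket I v (u k) * cnj (braket I v (u k)))"
      by (simp add: eigensys_braket_left[OF assms] cnj_braket)
    then show "braket I v (u k) * braket I (u k) (apply_op I R v) =
        of_real (r k * (cmod (braket I v (u k)))\<^sup>2)"
      by (simp only: complex_norm_square of_real_mult)
  qed
  finally show ?thesis .
qed

text \<open>\<open><w l, R (w l)>\<close> is the sum of the nonnegative terms
  \<open>r k * |<w l, u k>|^2\<close>, so its vanishing kills each of them. The applications know
  exactly these expectation values.\<close>

lemma supp_leI:
  assumes "eigensys I R K r u" "finite I" "finite K"
    and "\<And>k. k \<in> K \<Longrightarrow> 0 \<le> r k" "\<And>l. l \<in> L \<Longrightarrow> 0 \<le> s l"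
    and e: "\<And>l. l \<in> L \<Longrightarrow> s l = 0 \<Longrightarrow> braket I (w l) (apply_op I R (w l)) = 0"
  shows "supp_le I K r u L s w"
  unfolding supp_le_def
proof (intro conjI ballI impI)
  fix k l assume kl: "k \<in> K" "l \<in> L" and "s l = 0"
  then have "(\<Sum>k\<in>K. r k * (cmod (braket I (w l) (u k)))\<^sup>2) = 0"
    using e[of l] unfolding eigensys_expectation[OF assms(1,2)] of_real_eq_0_iff by blast
  then have "r k * (cmod (braket I (w l) (u k)))\<^sup>2 = 0"
    using assms(3,4) kl by (subst (asm) sum_nonneg_eq_0_iff) auto
  then show "r k = 0 \<or> braket I (w l) (u k) = 0" by simp
qed (use assms in auto)

text \<open>The squared overlaps are doubly stochastic, which collapses every term except
  \<open>r k * ln (s l)\<close>; there the diagonal of \<open>R\<close> in the basis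
  \<open>w\<close> remains.\<close>

lemma rel_entr_eq:
  assumes R: "eigensys I R K r u" and w: "onb I L w" and fin: "finite I"
  shows "rel_entr I K r u L s w = (\<Sum>k\<in>K. r k * ln (r k))
    - (\<Sum>l\<in>L. Re (braket I (w l) (apply_op I R (w l))) * ln (s l)) - (\<Sum>k\<in>K. r k) + (\<Sum>l\<in>L. s l)"
proof -
  define G where "G l k = (cmod (braket I (w l) (u k)))\<^sup>2" for l k
  have one: "(\<Sum>x\<in>I. (cmod (v k x))\<^sup>2) = 1" if "onb I J v" "k \<in> J" for v k and J :: "'z set"
  proof -
    have "complex_of_real (\<Sum>x\<in>I. (cmod (v k x))\<^sup>2) = of_real 1"
      unfolding braket_self[symmetric] using onb_orth[OF that(1) that(2,2)] by simp
    then show ?thesis by (simp only: of_real_eq_iff)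
  qed
  have G1: "(\<Sum>l\<in>L. G l k) = 1" if "k \<in> K" for k
    unfolding G_def onb_parseval_norm[OF w fin] by (rule one[OF eigensys_onb[OF R] that])
  have G2: "(\<Sum>k\<in>K. G l k) = 1" if "l \<in> L" for l
    unfolding G_def braket_cnj_swap[of I "w l"] onb_parseval_norm[OF eigensys_onb[OF R] fin]
    by (rule one[OF w that])
  have G3: "Re (braket I (w l) (apply_op I R (w l))) = (\<Sum>k\<in>K. r k * G l k)" for l
    unfolding eigensys_expectation[OF R fin] G_def by simp
  have "rel_entr I K r u L s w =
      (\<Sum>l\<in>L. \<Sum>k\<in>K. G l k * (r k * ln (r k))) - (\<Sum>l\<in>L. \<Sum>k\<in>K. (r k * G l k) * ln (s l))
      - (\<Sum>l\<in>L. \<Sum>k\<in>K. G l k * r k) + (\<Sum>l\<in>L. \<Sum>k\<in>K. G l k * s l)"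
    unfolding rel_entr_def G_def[symmetric]
    by (simp add: algebra_simps sum.distrib sum_subtractf)
  moreover have "(\<Sum>l\<in>L. \<Sum>k\<in>K. G l k * g k) = (\<Sum>k\<in>K. g k)" for g :: "_ \<Rightarrow> real"
    by (subst sum.swap) (simp add: sum_distrib_right[symmetric] G1)
  moreover have "(\<Sum>l\<in>L. \<Sum>k\<in>K. G l k * s l) = (\<Sum>l\<in>L. s l)"
    by (simp add: sum_distrib_right[symmetric] G2)
  moreover have "(\<Sum>l\<in>L. \<Sum>k\<in>K. (r k * G l k) * ln (s l)) = (\<Sum>l\<in>L. Re (braket I (w l) (apply_op I R (w l))) * ln (s l))"
    unfolding G3 sum_distrib_right ..
  ultimately show ?thesis by simp
qed

text \<open>The discrete Fourier matrix. Orthogonality is the geometric sum of a nontrivial root of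
  unity, and the symmetry of the matrix turns one orthogonality relation into the other.\<close>

lemma unimodular_unitary:
  assumes "0 < n"
  obtains h :: "nat \<Rightarrow> nat \<Rightarrow> complex" where
    "\<And>x y. x < n \<Longrightarrow> y < n \<Longrightarrow> (\<Sum>z<n. cnj (h x z) * h y z) = of_bool (x = y)"
    "\<And>y z. y < n \<Longrightarrow> z < n \<Longrightarrow> (\<Sum>x<n. h x y * cnj (h x z)) = of_bool (y = z)"
    "\<And>x z. cnj (h x z) * h x z = 1 / of_nat n"
proof -
  define \<zeta> where "\<zeta> x = cis (2 * pi * real x / real n)" for x :: nat
  define h where "h x z = \<zeta> x ^ z / of_real (sqrt n)" for x z
  have sq: "complex_of_real (sqrt n) * of_real (sqrt n) = of_nat n"
    by (simp flip: of_real_mult)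
  have \<zeta>1: "cnj (\<zeta> x) * \<zeta> x = 1" for x
    by (simp add: \<zeta>_def cis_cnj cis_mult)
  have \<zeta>n: "\<zeta> x ^ n = 1" for x
    unfolding \<zeta>_def DeMoivre using assms by (simp add: cis_multiple_2pi)
  have inj: "\<zeta> x = \<zeta> y \<Longrightarrow> x < n \<Longrightarrow> y < n \<Longrightarrow> x = y" for x y
    using bij_betw_roots_unity[OF assms] unfolding \<zeta>_def bij_betw_def inj_on_def by auto
  have prod: "cnj (h x z) * h y z = (cnj (\<zeta> x) * \<zeta> y) ^ z / of_nat n" for x y z
    by (simp add: h_def power_mult_distrib flip: sq)
  have 1: "(\<Sum>z<n. cnj (h x z) * h y z) = of_bool (x = y)" if "x < n" "y < n" for x y
  proof (cases "x = y")
    case True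
    then show ?thesis using assms by (simp add: prod \<zeta>1)
  next
    case False
    define \<omega> where "\<omega> = cnj (\<zeta> x) * \<zeta> y"
    have "\<omega> \<noteq> 1"
    proof
      assume "\<omega> = 1"
      then have "\<zeta> x * \<omega> = \<zeta> x" by simp
      moreover have "\<zeta> x * \<omega> = \<zeta> y" using \<zeta>1[of x] by (simp add: \<omega>_def mult.commute flip: mult.assoc)
      ultimately show False using inj[OF _ that] False by simp
    qed
    moreover have "\<omega> ^ n = 1"
      by (simp add: \<omega>_def power_mult_distrib \<zeta>n flip: complex_cnj_power)
    ultimately have "(\<Sum>z<n. \<omega> ^ z) = 0" by (simp add: geometric_sum)
    then show ?thesis using False by (simp add: prod \<omega>_def flip: sum_divide_distrib)
  qed
  have sym: "h x z = h z x" for x z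
    unfolding h_def \<zeta>_def DeMoivre by (simp add: mult_ac)
  have "(\<Sum>x<n. h x y * cnj (h x z)) = of_bool (y = z)" if "y < n" "z < n" for y z
  proof -
    have "(\<Sum>x<n. h x y * cnj (h x z)) = (\<Sum>x<n. cnj (h z x) * h y x)"
      by (intro sum.cong refl) (metis sym mult.commute)
    then show ?thesis using 1[OF that(2,1)] by auto
  qed
  moreover have "cnj (h x z) * h x z = 1 / of_nat n" for x z
    by (simp add: prod \<zeta>1)
  ultimately show ?thesis using that[of h] 1 by blast
qed

text \<open>\<open>t\<close> times the entropy of entanglement (in natural units) of \<open>\<psi> / \<surd>t\<close>, where
  \<open>t\<close> is the squared norm of \<open>\<psi>\<close>.\<close>

definition ent_weight :: "'a set \<Rightarrow> 'b set \<Rightarrow> ('a \<Rightarrow> 'b \<Rightarrow> complex) \<Rightarrow> real" where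
  "ent_weight A B \<psi> = entr A (gram B (\<lambda>b a. \<psi> a b)) +
     (\<Sum>a\<in>A. \<Sum>b\<in>B. (cmod (\<psi> a b))\<^sup>2) * ln (\<Sum>a\<in>A. \<Sum>b\<in>B. (cmod (\<psi> a b))\<^sup>2)"

text \<open>The unnormalized vector of \<open>AB\<close> after outcome \<open>k\<close> of a
  measurement of \<open>C\<close> in the basis \<open>e\<close>; its squared norm is the weight of
  that outcome.\<close>

definition slice :: "'c set \<Rightarrow> ('a \<Rightarrow> 'b \<Rightarrow> 'c ket) \<Rightarrow> ('k \<Rightarrow> 'c ket) \<Rightarrow> 'k \<Rightarrow> 'a \<Rightarrow> 'b \<Rightarrow> complex" where
  "slice C \<phi> e k = (\<lambda>a b. braket C (e k) (\<phi> a b))"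

text \<open>Parseval: summing over the outcomes forgets the basis, so every basis of
  \<open>C\<close> decomposes the same state of \<open>AB\<close>.\<close>

lemma slice_sum:
  assumes "onb C K e" "finite C"
  shows "(\<Sum>k\<in>K. slice C \<phi> e k a b * cnj (slice C \<phi> e k a' b')) = (\<Sum>c\<in>C. \<phi> a b c * cnj (\<phi> a' b' c))"
proof -
  have "(\<Sum>k\<in>K. slice C \<phi> e k a b * cnj (slice C \<phi> e k a' b')) =
      (\<Sum>k\<in>K. braket C (\<phi> a' b') (e k) * braket C (e k) (\<phi> a b))"
    by (simp add: slice_def cnj_braket mult.commute)
  also have "\<dots> = (\<Sum>c\<in>C. \<phi> a b c * cnj (\<phi> a' b' c))"
    unfolding onb_parseval[OF assms] by (simp add: braket_def mult.commute)
  finally show ?thesis .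
qed

lemma gram_trace: "(\<Sum>x\<in>I. gram A f x x) = of_real (\<Sum>a\<in>A. \<Sum>x\<in>I. (cmod (f a x))\<^sup>2)"
  unfolding gram_def of_real_sum by (subst sum.swap) (simp only: complex_norm_square)

lemma gram_eigenvalue_sum:
  assumes "eigensys I (gram A f) K l u" "finite I"
  shows "(\<Sum>k\<in>K. l k) = (\<Sum>a\<in>A. \<Sum>x\<in>I. (cmod (f a x))\<^sup>2)"
  using eigensys_trace[OF assms] unfolding gram_trace of_real_eq_iff by simp

lemma sum_Times: "(\<Sum>p\<in>A \<times> B. f p) = (\<Sum>a\<in>A. \<Sum>b\<in>B. f (a, b))"
  by (simp add: sum.cartesian_product')

text \<open>The operator is the sum over \<open>z\<close> of \<open>\<beta> z\<close> tensored with
  the projector onto the vector with components \<open>cnj (h x z)\<close>. These vectors are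
  orthonormal, so product vectors diagonalize it. It will be the state of \<open>BC\<close> pinched
  in \<open>v\<close>, in the coordinates of \<open>e\<close>.\<close>

lemma eigensys_phase_blocks:
  fixes h :: "nat \<Rightarrow> nat \<Rightarrow> complex"
  assumes h1: "\<And>x y. x < n \<Longrightarrow> y < n \<Longrightarrow> (\<Sum>z<n. cnj (h x z) * h y z) = of_bool (x = y)"
    and h2: "\<And>y z. y < n \<Longrightarrow> z < n \<Longrightarrow> (\<Sum>x<n. h x y * cnj (h x z)) = of_bool (y = z)"
    and E: "\<And>z. z < n \<Longrightarrow> eigensys B (\<beta> z) J (s z) (w z)" and fin: "finite B"
  shows "eigensys (B \<times> {..<n}) (\<lambda>(b, x) (b', x'). \<Sum>z<n. cnj (h x z) * h x' z * \<beta> z b b')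
    ({..<n} \<times> J) (\<lambda>(z, j). s z j) (\<lambda>(z, j) (b, x). w z j b * cnj (h x z))"
proof -
  let ?W = "\<lambda>(z, j) (b, x). w z j b * cnj (h x z)"
  have orth: "braket (B \<times> {..<n}) (?W (z, j)) (?W (z', j')) = of_bool ((z, j) = (z', j'))"
    if "z < n" "j \<in> J" "z' < n" "j' \<in> J" for z j z' j'
  proof -
    have "braket (B \<times> {..<n}) (?W (z, j)) (?W (z', j')) =
        (\<Sum>b\<in>B. (cnj (w z j b) * w z' j' b) * (\<Sum>x<n. h x z * cnj (h x z')))"
      unfolding braket_def sum_Times by (simp add: sum_distrib_left mult_ac)
    also have "\<dots> = braket B (w z j) (w z' j') * of_bool (z = z')"
      using that by (simp add: h2 braket_def sum_distrib_right)
    also have "\<dots> = of_bool ((z, j) = (z', j'))"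
      using that onb_orth[OF eigensys_onb[OF E], of z j j'] by (cases "z = z'") auto
    finally show ?thesis .
  qed
  have compl: "(\<Sum>p\<in>{..<n} \<times> J. ?W p (b, x) * cnj (?W p (b', x'))) = of_bool ((b, x) = (b', x'))"
    if "b \<in> B" "x < n" "b' \<in> B" "x' < n" for b x b' x'
  proof -
    have "(\<Sum>p\<in>{..<n} \<times> J. ?W p (b, x) * cnj (?W p (b', x'))) =
        (\<Sum>z<n. (cnj (h x z) * h x' z) * (\<Sum>j\<in>J. w z j b * cnj (w z j b')))"
      unfolding sum_Times by (simp add: sum_distrib_left mult_ac)
    also have "\<dots> = (\<Sum>z<n. (cnj (h x z) * h x' z) * of_bool (b = b'))"
      using that by (simp add: onb_complete[OF eigensys_onb[OF E]])
    also have "\<dots> = of_bool (x = x') * of_bool (b = b')"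
      unfolding sum_distrib_right[symmetric] using that by (simp add: h1)
    also have "\<dots> = of_bool ((b, x) = (b', x'))" by auto
    finally show ?thesis .
  qed
  have eig: "apply_op (B \<times> {..<n}) (\<lambda>(b, x) (b', x'). \<Sum>z<n. cnj (h x z) * h x' z * \<beta> z b b') (?W (z, j)) (b, x)
      = of_real (s z j) * ?W (z, j) (b, x)"
    if "z < n" "j \<in> J" "b \<in> B" "x < n" for z j b x
  proof -
    have "apply_op (B \<times> {..<n}) (\<lambda>(b, x) (b', x'). \<Sum>z<n. cnj (h x z) * h x' z * \<beta> z b b') (?W (z, j)) (b, x)
        = (\<Sum>b'\<in>B. \<Sum>x'<n. \<Sum>z'<n. cnj (h x z') * \<beta> z' b b' * w z j b' * (h x' z' * cnj (h x' z)))"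
      unfolding apply_op_def sum_Times by (simp add: sum_distrib_left sum_distrib_right mult_ac)
    also have "\<dots> = (\<Sum>b'\<in>B. \<Sum>z'<n. \<Sum>x'<n. cnj (h x z') * \<beta> z' b b' * w z j b' * (h x' z' * cnj (h x' z)))"
      by (intro sum.cong refl sum.swap)
    also have "\<dots> = (\<Sum>b'\<in>B. \<Sum>z'<n. cnj (h x z') * \<beta> z' b b' * w z j b' * of_bool (z' = z))"
      using that by (simp add: h2 flip: sum_distrib_left)
    also have "\<dots> = (\<Sum>b'\<in>B. cnj (h x z) * \<beta> z b b' * w z j b')"
      using that by (intro sum.cong refl sum_mult_of_bool(1)) auto
    also have "\<dots> = cnj (h x z) * apply_op B (\<beta> z) (w z j) b"
      by (simp add: apply_op_def sum_distrib_left mult_ac)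
    also have "\<dots> = of_real (s z j) * ?W (z, j) (b, x)"
      using that by (simp add: eigensys_apply[OF E])
    finally show ?thesis .
  qed
  show ?thesis
    unfolding eigensys_def onb_def
    using orth compl eig by (auto simp del: of_bool_eq_iff)
qed

lemma mult_ln_divide:
  assumes "0 \<le> x" "0 < c"
  shows "x * ln (x / c) = x * ln x - x * ln (c::real)"
  using assms by (cases "x = 0") (auto simp: ln_div algebra_simps)

text \<open>\<open>C\<close> is measured in an eigenbasis \<open>v\<close> of its reduced state, or in a basis \<open>e\<close> that is
  unbiased with respect to \<open>v\<close>.  The bound is the monotonicity of the relative entropy of the
  reduced state of \<open>BC\<close> with respect to its pinching in \<open>v\<close>, under the pinching in \<open>e\<close>.\<close>

lemma complementary_measurements:
  fixes \<phi> :: "'a \<Rightarrow> 'b \<Rightarrow> 'c \<Rightarrow> complex"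
  assumes fin: "finite A" "finite B" "finite C" and ne: "C \<noteq> {}"
  defines "t \<equiv> (\<Sum>a\<in>A. \<Sum>b\<in>B. \<Sum>c\<in>C. (cmod (\<phi> a b c))\<^sup>2)"
  shows "\<exists>e v. onb C {..<card C} e \<and> onb C {..<card C} v \<and>
    entr A (gram (B \<times> C) (\<lambda>(b, c) a. \<phi> a b c)) + entr B (gram (A \<times> C) (\<lambda>(a, c) b. \<phi> a b c))
      - entr C (gram (A \<times> B) (\<lambda>(a, b). \<phi> a b)) + t * ln t
    \<le> (\<Sum>k<card C. ent_weight A B (slice C \<phi> e k)) + (\<Sum>k<card C. ent_weight A B (slice C \<phi> v k))"
proof -
  define n where "n = card C"
  have n: "0 < n" using fin ne by (simp add: n_def card_gt_0_iff)
  let ?X = "{..<n}" and ?J = "{..<card B}"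
  define \<rho>C where "\<rho>C = gram (A \<times> B) (\<lambda>(a, b). \<phi> a b)"
  obtain p v where v: "eigensys C \<rho>C ?X p v"
    unfolding \<rho>C_def n_def by (rule gram_eigensys[OF fin(3)])
  have onb_v: "onb C ?X v" by (rule eigensys_onb[OF v])
  have p0: "0 \<le> p z" if "z < n" for z
    using gram_eigenvalue_nonneg[OF v[unfolded \<rho>C_def] fin(3)] that by simp
  have slice_norm: "(\<Sum>a\<in>A. \<Sum>b\<in>B. (cmod (slice C \<phi> e k a b))\<^sup>2) = Re (braket C (e k) (apply_op C \<rho>C (e k)))"
    for e :: "nat \<Rightarrow> 'c ket" and k
    unfolding \<rho>C_def braket_gram_self sum_Times slice_def by (simp add: braket_cnj_swap)
  have p_norm: "(\<Sum>a\<in>A. \<Sum>b\<in>B. (cmod (slice C \<phi> v z a b))\<^sup>2) = p z" if "z < n" for z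
    unfolding slice_norm using eigensys_braket_self[OF v fin(3), of z] that by simp
  have p_sum: "(\<Sum>z<n. p z) = t"
    using gram_eigenvalue_sum[OF v[unfolded \<rho>C_def] fin(3)]
    unfolding sum_Times t_def by (simp add: case_prod_beta)
  obtain h :: "nat \<Rightarrow> nat \<Rightarrow> complex" where
    h1: "\<And>x y. x < n \<Longrightarrow> y < n \<Longrightarrow> (\<Sum>z<n. cnj (h x z) * h y z) = of_bool (x = y)" and
    h2: "\<And>y z. y < n \<Longrightarrow> z < n \<Longrightarrow> (\<Sum>x<n. h x y * cnj (h x z)) = of_bool (y = z)" and
    h3: "\<And>x z. cnj (h x z) * h x z = 1 / of_nat n"
    using unimodular_unitary[OF n] by blast
  \<comment> \<open>The Fourier transform of \<open>v\<close>: all overlaps with \<open>v\<close>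
    have squared modulus \<open>1 / n\<close>.\<close>
  define e where "e x = (\<lambda>c. \<Sum>z<n. h x z * v z c)" for x
  have e_braket: "braket C (e x) g = (\<Sum>z<n. cnj (h x z) * braket C (v z) g)" for x g
    unfolding e_def braket_sum_left braket_scale_left ..
  have onb_e: "onb C ?X e"
    unfolding onb_def
  proof (intro conjI ballI)
    fix x y assume xy: "x \<in> ?X" "y \<in> ?X"
    have "braket C (v z) (e y) = h y z" if "z < n" for z
    proof -
      have "braket C (v z) (e y) = (\<Sum>z'<n. h y z' * of_bool (z = z'))"
        unfolding e_def braket_sum_right braket_scale_right using that onb_orth[OF onb_v] by simp
      also have "\<dots> = h y z" using that by (intro sum_mult_of_bool(2)) auto
      finally show ?thesis .
    qed
    then show "braket C (e x) (e y) = of_bool (x = y)"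
      unfolding e_braket using h1[of x y] xy by simp
  next
    fix c c' assume c: "c \<in> C" "c' \<in> C"
    have "(\<Sum>x<n. e x c * cnj (e x c')) = (\<Sum>x<n. \<Sum>z<n. \<Sum>z'<n. (v z c * cnj (v z' c')) * (h x z * cnj (h x z')))"
      by (simp add: e_def sum_product mult_ac)
    also have "\<dots> = (\<Sum>z<n. \<Sum>x<n. \<Sum>z'<n. (v z c * cnj (v z' c')) * (h x z * cnj (h x z')))"
      by (rule sum.swap)
    also have "\<dots> = (\<Sum>z<n. \<Sum>z'<n. \<Sum>x<n. (v z c * cnj (v z' c')) * (h x z * cnj (h x z')))"
      by (intro sum.cong refl sum.swap)
    also have "\<dots> = (\<Sum>z<n. \<Sum>z'<n. (v z c * cnj (v z' c')) * of_bool (z = z'))"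
      by (simp add: h2 flip: sum_distrib_left)
    also have "\<dots> = (\<Sum>z<n. v z c * cnj (v z c'))"
      by (intro sum.cong refl sum_mult_of_bool(2)) auto
    also have "\<dots> = of_bool (c = c')" by (rule onb_complete[OF onb_v c])
    finally show "(\<Sum>x<n. e x c * cnj (e x c')) = of_bool (c = c')" .
  qed
  have slice_e: "slice C \<phi> e x a b = (\<Sum>z<n. cnj (h x z) * slice C \<phi> v z a b)" for x a b
    by (simp add: slice_def e_braket)

  \<comment> \<open>The state of \<open>BC\<close> with \<open>C\<close> in the coordinates of
    \<open>e\<close>, so that the pinching in \<open>e\<close> just keeps diagonal blocks.\<close>
  define R where "R = gram A (\<lambda>a (b, x). slice C \<phi> e x a b)"
  have finX: "finite (B \<times> ?X)" using fin by simp
  obtain r u where R: "eigensys (B \<times> ?X) R {..<card (B \<times> ?X)} r u"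
    unfolding R_def by (rule gram_eigensys[OF finX])
  let ?K = "{..<card (B \<times> ?X)}"
  have r0: "0 \<le> r k" if "k \<in> ?K" for k
    using gram_eigenvalue_nonneg[OF R[unfolded R_def] finX that] .

  define \<beta> where "\<beta> z = gram A (\<lambda>a b. slice C \<phi> v z a b)" for z
  have "\<exists>lu. eigensys B (\<beta> z) ?J (fst lu) (snd lu)" for z
    unfolding \<beta>_def by (rule gram_eigensys[OF fin(2)]) auto
  then obtain sw where sw: "\<And>z. eigensys B (\<beta> z) ?J (fst (sw z)) (snd (sw z))" by metis
  define s w where "s z = fst (sw z)" and "w z = snd (sw z)" for z
  have \<beta>: "eigensys B (\<beta> z) ?J (s z) (w z)" for z unfolding s_def w_def by (rule sw)
  have s0: "0 \<le> s z j" if "j \<in> ?J" for z j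
    using gram_eigenvalue_nonneg[OF \<beta>[unfolded \<beta>_def] fin(2) that] .
  \<comment> \<open>The pinching of \<open>R\<close> in \<open>v\<close>: in the coordinates of
    \<open>e\<close> the vector \<open>v z\<close> has components
    \<open>cnj (h x z)\<close>.\<close>
  define S where "S = (\<lambda>(b, x) (b', x'). \<Sum>z<n. cnj (h x z) * h x' z * \<beta> z b b')"
  define W where "W = (\<lambda>(z, j) (b, x). w z j b * cnj (h x z))"
  have S: "eigensys (B \<times> ?X) S (?X \<times> ?J) (\<lambda>(z, j). s z j) W"
    unfolding S_def W_def by (rule eigensys_phase_blocks[OF h1 h2 \<beta> fin(2)])
  \<comment> \<open>As \<open>S\<close> is a pinching of \<open>R\<close>, the diagonal of
    \<open>R\<close> in the eigenbasis of \<open>S\<close> is the spectrum of \<open>S\<close>. This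
    yields the support condition and turns the cross term of the relative entropy into the entropy
    of \<open>S\<close>.\<close>
  have WRW: "braket (B \<times> ?X) (W (z, j)) (apply_op (B \<times> ?X) R (W (z, j))) = of_real (s z j)"
    if "z < n" "j \<in> ?J" for z j
  proof -
    have "braket (B \<times> ?X) (W (z, j)) (\<lambda>(b, x). slice C \<phi> e x a b) = braket B (w z j) (slice C \<phi> v z a)" for a
    proof -
      have "braket (B \<times> ?X) (W (z, j)) (\<lambda>(b, x). slice C \<phi> e x a b) =
          (\<Sum>b\<in>B. \<Sum>x<n. \<Sum>z'<n. (cnj (w z j b) * slice C \<phi> v z' a b) * (h x z * cnj (h x z')))"
        unfolding braket_def sum_Times by (simp add: W_def slice_e sum_distrib_left mult_ac)
      also have "\<dots> = (\<Sum>b\<in>B. \<Sum>z'<n. \<Sum>x<n. (cnj (w z j b) * slice C \<phi> v z' a b) * (h x z * cnj (h x z')))"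
        by (intro sum.cong refl sum.swap)
      also have "\<dots> = (\<Sum>b\<in>B. \<Sum>z'<n. (cnj (w z j b) * slice C \<phi> v z' a b) * of_bool (z = z'))"
        using that by (simp add: h2 flip: sum_distrib_left)
      also have "\<dots> = (\<Sum>b\<in>B. cnj (w z j b) * slice C \<phi> v z a b)"
        using that by (intro sum.cong refl sum_mult_of_bool(2)) auto
      finally show ?thesis by (simp add: braket_def)
    qed
    then have "braket (B \<times> ?X) (W (z, j)) (apply_op (B \<times> ?X) R (W (z, j))) =
        of_real (\<Sum>a\<in>A. (cmod (braket B (w z j) (slice C \<phi> v z a)))\<^sup>2)"
      unfolding R_def braket_gram_self by (simp add: braket_cnj_swap[of _ _ "W (z, j)"])
    also have "\<dots> = of_real (s z j)"
      unfolding gram_eigenvalue[OF \<beta>[unfolded \<beta>_def] fin(2) that(2)] by (simp add: braket_cnj_swap)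
    finally show ?thesis .
  qed
  have supp: "supp_le (B \<times> ?X) ?K r u (?X \<times> ?J) (\<lambda>(z, j). s z j) W"
    by (rule supp_leI[OF R finX]) (auto simp: r0 s0 WRW)

  define \<rho>B where "\<rho>B = gram (A \<times> C) (\<lambda>(a, c) b. \<phi> a b c)"
  obtain q y where \<rho>B: "eigensys B \<rho>B ?J q y"
    unfolding \<rho>B_def by (rule gram_eigensys[OF fin(2)])
  have q0: "0 \<le> q j" if "j \<in> ?J" for j
    using gram_eigenvalue_nonneg[OF \<rho>B[unfolded \<rho>B_def] fin(2) that] .
  have q_sum: "(\<Sum>j\<in>?J. q j) = t"
  proof -
    have "(\<Sum>j\<in>?J. q j) = (\<Sum>a\<in>A. \<Sum>c\<in>C. \<Sum>b\<in>B. (cmod (\<phi> a b c))\<^sup>2)"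
      using gram_eigenvalue_sum[OF \<rho>B[unfolded \<rho>B_def] fin(2)] unfolding sum_Times by simp
    also have "\<dots> = t" unfolding t_def by (intro sum.cong refl sum.swap)
    finally show ?thesis .
  qed
  have sum_slices: "(\<Sum>k<n. gram A (\<lambda>a b. slice C \<phi> f k a b) b b') = \<rho>B b b'" if "onb C ?X f" for f b b'
    unfolding gram_def \<rho>B_def sum_Times by (subst sum.swap) (simp add: slice_sum[OF that fin(3)])
  define Rx where "Rx x = gram A (\<lambda>a b. slice C \<phi> e x a b)" for x
  have "\<exists>lu. eigensys B (Rx x) ?J (fst lu) (snd lu)" for x
    unfolding Rx_def by (rule gram_eigensys[OF fin(2)]) auto
  then obtain ru where ru: "\<And>x. eigensys B (Rx x) ?J (fst (ru x)) (snd (ru x))" by metis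
  define r' u' where "r' x = fst (ru x)" and "u' x = snd (ru x)" for x
  have Rx: "eigensys B (Rx x) ?J (r' x) (u' x)" for x unfolding r'_def u'_def by (rule ru)
  have r'0: "0 \<le> r' x j" if "j \<in> ?J" for x j
    using gram_eigenvalue_nonneg[OF Rx[unfolded Rx_def] fin(2) that] .
  have block_R: "diag_block R x = Rx x" for x
    by (simp add: diag_block_def R_def Rx_def gram_def)
  \<comment> \<open>Unbiasedness enters here: all weights \<open>|h x z|^2\<close> equal
    \<open>1 / n\<close>, so the sum over \<open>z\<close> restores \<open>\<rho>B\<close> in every
    block.\<close>
  have block_S: "diag_block S x b b' = of_real (1 / n) * \<rho>B b b'" for x b b'
  proof -
    have "diag_block S x b b' = (1 / of_nat n) * (\<Sum>z<n. \<beta> z b b')"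
      by (simp add: diag_block_def S_def h3 sum_distrib_left)
    then show ?thesis unfolding \<beta>_def sum_slices[OF onb_v] by simp
  qed
  have Sx: "eigensys B (diag_block S x) ?J (\<lambda>j. 1 / n * q j) y" for x
    by (rule eigensys_cong[OF eigensys_scale[OF \<rho>B]]) (rule block_S)
  define \<mu> where "\<mu> x j = Re (braket B (y j) (apply_op B (Rx x) (y j)))" for x j
  have \<mu>: "braket B (y j) (apply_op B (Rx x) (y j)) = of_real (\<mu> x j)" for x j
    unfolding \<mu>_def Rx_def braket_gram_self by simp
  have \<mu>0: "0 \<le> \<mu> x j" for x j
    unfolding \<mu>_def Rx_def braket_gram_self by (simp add: sum_nonneg)
  have \<mu>_sum: "(\<Sum>x<n. \<mu> x j) = q j" if "j \<in> ?J" for j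
  proof -
    have "complex_of_real (\<Sum>x<n. \<mu> x j) = braket B (y j) (\<lambda>b. \<Sum>x<n. apply_op B (Rx x) (y j) b)"
      by (simp add: \<mu>[symmetric] braket_sum_right)
    also have "(\<lambda>b. \<Sum>x<n. apply_op B (Rx x) (y j) b) = apply_op B \<rho>B (y j)"
      unfolding apply_op_def Rx_def
      by (subst sum.swap) (simp add: sum_slices[OF onb_e] flip: sum_distrib_right)
    also have "braket B (y j) \<dots> = of_real (q j)"
      by (rule eigensys_braket_self[OF \<rho>B fin(2) that])
    finally show ?thesis by (simp only: of_real_eq_iff)
  qed
  have supp': "supp_le B ?J (r' x) (u' x) ?J (\<lambda>j. 1 / n * q j) y" if "x \<in> ?X" for x
  proof (rule supp_leI[OF Rx fin(2)])
    fix j assume j: "j \<in> ?J" "1 / n * q j = 0"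
    then have "(\<Sum>x<n. \<mu> x j) = 0" using n by (simp add: \<mu>_sum)
    then have "\<mu> x j = 0" using that \<mu>0 by (subst (asm) sum_nonneg_eq_0_iff) auto
    then show "braket B (y j) (apply_op B (Rx x) (y j)) = 0" by (simp add: \<mu>)
  qed (use r'0 q0 in auto)

  have mono: "(\<Sum>x<n. rel_entr B ?J (r' x) (u' x) ?J (\<lambda>j. 1 / n * q j) y)
      \<le> rel_entr (B \<times> ?X) ?K r u (?X \<times> ?J) (\<lambda>(z, j). s z j) W"
    by (rule rel_entr_pinching[OF fin(2) _ _ _ R S supp _ Sx]) (use Rx block_R supp' in auto)

  have entr_A: "entr A (gram (B \<times> C) (\<lambda>(b, c) a. \<phi> a b c)) = - (\<Sum>k\<in>?K. r k * ln (r k))"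
  proof -
    have "entr A (gram (B \<times> C) (\<lambda>(b, c) a. \<phi> a b c)) =
        entr A (gram (B \<times> ?X) (\<lambda>bx a. (\<lambda>(b, x). slice C \<phi> e x a b) bx))"
      by (rule entr_cong) (simp add: gram_def sum_Times slice_sum[OF onb_e fin(3)])
    also have "\<dots> = entr (B \<times> ?X) R"
      unfolding R_def by (rule entr_gram_transpose[OF fin(1) finX])
    also have "\<dots> = - (\<Sum>k\<in>?K. r k * ln (r k))"
      unfolding R_def by (rule entr_gram[OF finX fin(1)]) (rule R[unfolded R_def])
    finally show ?thesis .
  qed
  have entr_B: "entr B \<rho>B = - (\<Sum>j\<in>?J. q j * ln (q j))"
    unfolding \<rho>B_def by (rule entr_gram[OF fin(2) _ \<rho>B[unfolded \<rho>B_def]]) (use fin in simp)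
  have entr_C: "entr C \<rho>C = - (\<Sum>z<n. p z * ln (p z))"
    unfolding \<rho>C_def by (rule entr_gram[OF fin(3) _ v[unfolded \<rho>C_def]]) (use fin in simp)
  have weight_v: "ent_weight A B (slice C \<phi> v z) = - (\<Sum>j\<in>?J. s z j * ln (s z j)) + p z * ln (p z)" if "z < n" for z
    unfolding ent_weight_def p_norm[OF that] entr_gram_transpose[OF fin(1,2)]
      entr_gram[OF fin(2,1) \<beta>[unfolded \<beta>_def]] ..
  have e_norm: "(\<Sum>a\<in>A. \<Sum>b\<in>B. (cmod (slice C \<phi> e x a b))\<^sup>2) = t / n" if "x < n" for x
  proof -
    have vez: "(cmod (braket C (e x) (v z)))\<^sup>2 = 1 / n" if "z < n" for z
    proof -
      have "braket C (e x) (v z) = (\<Sum>z'<n. cnj (h x z') * of_bool (z' = z))"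
        unfolding e_braket using that onb_orth[OF onb_v] by simp
      also have "\<dots> = cnj (h x z)" using that by (intro sum_mult_of_bool(1)) auto
      finally have "complex_of_real ((cmod (braket C (e x) (v z)))\<^sup>2) = of_real (1 / n)"
        using h3[of x z] unfolding complex_norm_square by simp
      then show ?thesis by (simp only: of_real_eq_iff)
    qed
    show ?thesis
      unfolding slice_norm eigensys_expectation[OF v fin(3)]
      by (simp add: vez p_sum flip: sum_divide_distrib)
  qed
  have t0: "0 \<le> t" unfolding t_def by (intro sum_nonneg) simp
  have weight_e: "ent_weight A B (slice C \<phi> e x) = - (\<Sum>j\<in>?J. r' x j * ln (r' x j)) + t / n * ln (t / n)" if "x < n" for x
    unfolding ent_weight_def e_norm[OF that] entr_gram_transpose[OF fin(1,2)]
      entr_gram[OF fin(2,1) Rx[unfolded Rx_def]] ..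

  \<comment> \<open>The outcome weights \<open>p z\<close> split the entropy of \<open>S\<close>
    into the entropy of \<open>C\<close> and the average over the outcomes of
    \<open>v\<close>.\<close>
  have "rel_entr (B \<times> ?X) ?K r u (?X \<times> ?J) (\<lambda>(z, j). s z j) W =
      (\<Sum>k\<in>?K. r k * ln (r k)) - (\<Sum>z<n. \<Sum>j\<in>?J. s z j * ln (s z j)) - (\<Sum>k\<in>?K. r k) + (\<Sum>z<n. \<Sum>j\<in>?J. s z j)"
    unfolding rel_entr_eq[OF R eigensys_onb[OF S] finX] sum_Times by (simp add: WRW)
  also have "(\<Sum>k\<in>?K. r k) = t"
  proof -
    have "complex_of_real (\<Sum>k\<in>?K. r k) = (\<Sum>b\<in>B. \<Sum>x<n. R (b, x) (b, x))"
      unfolding eigensys_trace[OF R finX, symmetric] sum_Times ..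
    also have "\<dots> = (\<Sum>b\<in>B. \<rho>B b b)"
      unfolding sum_slices[OF onb_e, symmetric] by (simp add: R_def gram_def)
    also have "\<dots> = of_real t"
      unfolding eigensys_trace[OF \<rho>B fin(2)] q_sum ..
    finally show ?thesis by (simp only: of_real_eq_iff)
  qed
  also have "(\<Sum>z<n. \<Sum>j\<in>?J. s z j) = t"
    using gram_eigenvalue_sum[OF \<beta>[unfolded \<beta>_def] fin(2)] by (simp add: p_norm p_sum)
  finally have big: "rel_entr (B \<times> ?X) ?K r u (?X \<times> ?J) (\<lambda>(z, j). s z j) W =
      - entr A (gram (B \<times> C) (\<lambda>(b, c) a. \<phi> a b c)) + (\<Sum>z<n. ent_weight A B (slice C \<phi> v z)) + entr C \<rho>C"
    unfolding entr_A entr_C by (simp add: weight_v sum.distrib sum_negf sum_subtractf)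

  \<comment> \<open>All outcomes of \<open>e\<close> have weight \<open>t / n\<close>; the two
    contributions \<open>t * ln n\<close>, from these weights and from the blocks
    \<open>\<rho>B / n\<close>, cancel.\<close>
  have "(\<Sum>x<n. rel_entr B ?J (r' x) (u' x) ?J (\<lambda>j. 1 / n * q j) y) =
      (\<Sum>x<n. \<Sum>j\<in>?J. r' x j * ln (r' x j)) - (\<Sum>x<n. \<Sum>j\<in>?J. \<mu> x j * ln (q j / n))
      - (\<Sum>x<n. \<Sum>j\<in>?J. r' x j) + (\<Sum>x<n. (\<Sum>j\<in>?J. q j) / n)"
    unfolding rel_entr_eq[OF Rx eigensys_onb[OF \<rho>B] fin(2)] \<mu>_def[symmetric]
    by (simp add: sum.distrib sum_subtractf sum_divide_distrib)
  also have "(\<Sum>x<n. (\<Sum>j\<in>?J. q j) / n) = t" unfolding q_sum using n by simp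
  also have "(\<Sum>x<n. \<Sum>j\<in>?J. r' x j) = t"
    using gram_eigenvalue_sum[OF Rx[unfolded Rx_def] fin(2)] n by (simp add: e_norm)
  also have "(\<Sum>x<n. \<Sum>j\<in>?J. \<mu> x j * ln (q j / n)) = (\<Sum>j\<in>?J. q j * ln (q j / n))"
    by (subst sum.swap) (simp add: \<mu>_sum flip: sum_distrib_right)
  also have "\<dots> = (\<Sum>j\<in>?J. q j * ln (q j)) - t * ln n"
    using n q0 by (simp add: mult_ln_divide sum_subtractf flip: sum_distrib_right q_sum)
  also have "(\<Sum>x<n. \<Sum>j\<in>?J. r' x j * ln (r' x j)) = t * ln t - t * ln n - (\<Sum>x<n. ent_weight A B (slice C \<phi> e x))"
    using n mult_ln_divide[OF t0, of "real n"] by (simp add: weight_e sum_subtractf)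
  finally have small: "(\<Sum>x<n. rel_entr B ?J (r' x) (u' x) ?J (\<lambda>j. 1 / n * q j) y) =
      t * ln t - (\<Sum>x<n. ent_weight A B (slice C \<phi> e x)) + entr B \<rho>B"
    unfolding entr_B by simp

  have "entr A (gram (B \<times> C) (\<lambda>(b, c) a. \<phi> a b c)) + entr B \<rho>B - entr C \<rho>C + t * ln t
    \<le> (\<Sum>k<n. ent_weight A B (slice C \<phi> e k)) + (\<Sum>k<n. ent_weight A B (slice C \<phi> v k))"
    using mono unfolding big small by simp
  then show ?thesis
    using onb_e onb_v unfolding \<rho>B_def \<rho>C_def n_def by blast
qed

section \<open>Pure tripartite states\<close>

text \<open>The better of the two bases achieves at least half of the sum, hence the factor
  2.\<close>

lemma assisted_entropy_bound:
  fixes \<phi> :: "'a \<Rightarrow> 'b \<Rightarrow> 'c \<Rightarrow> complex"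
  assumes fin: "finite A" "finite B" "finite C" and ne: "C \<noteq> {}"
  defines "t \<equiv> (\<Sum>a\<in>A. \<Sum>b\<in>B. \<Sum>c\<in>C. (cmod (\<phi> a b c))\<^sup>2)"
  shows "\<exists>e. onb C {..<card C} e \<and>
    entr A (gram (B \<times> C) (\<lambda>(b, c) a. \<phi> a b c)) + entr B (gram (A \<times> C) (\<lambda>(a, c) b. \<phi> a b c))
      - entr C (gram (A \<times> B) (\<lambda>(a, b) c. \<phi> a b c)) + t * ln t
    \<le> 2 * (\<Sum>k<card C. ent_weight A B (slice C \<phi> e k))"
proof -
  define X where "X = entr A (gram (B \<times> C) (\<lambda>(b, c) a. \<phi> a b c)) + entr B (gram (A \<times> C) (\<lambda>(a, c) b. \<phi> a b c))
      - entr C (gram (A \<times> B) (\<lambda>(a, b) c. \<phi> a b c)) + t * ln t"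
  obtain e v where e: "onb C {..<card C} e" and v: "onb C {..<card C} v" and
    "X \<le> (\<Sum>k<card C. ent_weight A B (slice C \<phi> e k)) + (\<Sum>k<card C. ent_weight A B (slice C \<phi> v k))"
    using complementary_measurements[OF assms(1-4), of \<phi>] unfolding X_def t_def by blast
  then have "X \<le> 2 * (\<Sum>k<card C. ent_weight A B (slice C \<phi> e k)) \<or>
      X \<le> 2 * (\<Sum>k<card C. ent_weight A B (slice C \<phi> v k))" by linarith
  with e v show ?thesis unfolding X_def by blast
qed

lemma polygamy_tripartite_pure:
  fixes \<phi> :: "'a \<Rightarrow> 'b \<Rightarrow> 'c \<Rightarrow> complex"
  assumes fin: "finite A" "finite B" "finite C" and ne: "B \<noteq> {}" "C \<noteq> {}"
  shows "\<exists>e f. onb C {..<card C} e \<and> onb B {..<card B} f \<and>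
    ent_weight A (B \<times> C) (\<lambda>a (b, c). \<phi> a b c) \<le>
      (\<Sum>k<card C. ent_weight A B (slice C \<phi> e k)) +
      (\<Sum>k<card B. ent_weight A C (slice B (\<lambda>a c b. \<phi> a b c) f k))"
proof -
  define t where "t = (\<Sum>a\<in>A. \<Sum>b\<in>B. \<Sum>c\<in>C. (cmod (\<phi> a b c))\<^sup>2)"
  have t': "(\<Sum>a\<in>A. \<Sum>c\<in>C. \<Sum>b\<in>B. (cmod (\<phi> a b c))\<^sup>2) = t"
    unfolding t_def by (intro sum.cong refl sum.swap)
  have swap: "entr A (gram (C \<times> B) (\<lambda>(c, b) a. \<phi> a b c)) = entr A (gram (B \<times> C) (\<lambda>(b, c) a. \<phi> a b c))"
    by (rule entr_cong) (simp add: gram_def sum_Times sum.swap[of _ C B])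
  obtain e where e: "onb C {..<card C} e" and e_le:
    "entr A (gram (B \<times> C) (\<lambda>(b, c) a. \<phi> a b c)) + entr B (gram (A \<times> C) (\<lambda>(a, c) b. \<phi> a b c))
      - entr C (gram (A \<times> B) (\<lambda>(a, b) c. \<phi> a b c)) + t * ln t
    \<le> 2 * (\<Sum>k<card C. ent_weight A B (slice C \<phi> e k))"
    using assisted_entropy_bound[OF fin ne(2), of \<phi>] unfolding t_def by blast
  obtain f where f: "onb B {..<card B} f" and f_le:
    "entr A (gram (B \<times> C) (\<lambda>(b, c) a. \<phi> a b c)) + entr C (gram (A \<times> B) (\<lambda>(a, b) c. \<phi> a b c))
      - entr B (gram (A \<times> C) (\<lambda>(a, c) b. \<phi> a b c)) + t * ln t
    \<le> 2 * (\<Sum>k<card B. ent_weight A C (slice B (\<lambda>a c b. \<phi> a b c) f k))"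
    using assisted_entropy_bound[OF fin(1,3,2) ne(1), of "\<lambda>a c b. \<phi> a b c"] unfolding t' swap by blast
  have "ent_weight A (B \<times> C) (\<lambda>a (b, c). \<phi> a b c) = entr A (gram (B \<times> C) (\<lambda>(b, c) a. \<phi> a b c)) + t * ln t"
    unfolding ent_weight_def sum_Times t_def by (simp add: case_prod_unfold)
  with e f e_le f_le show ?thesis by (intro exI[of _ e] exI[of _ f]) simp
qed

section \<open>Elementary properties of \<open>ent_weight\<close>\<close>

lemma ent_weight_eigen:
  assumes "finite A" "finite B"
  obtains l where "\<And>k. k < card A \<Longrightarrow> 0 \<le> l k"
    "(\<Sum>k<card A. l k) = (\<Sum>a\<in>A. \<Sum>b\<in>B. (cmod (\<psi> a b))\<^sup>2)"
    "ent_weight A B \<psi> = - (\<Sum>k<card A. l k * ln (l k)) + (\<Sum>k<card A. l k) * ln (\<Sum>k<card A. l k)"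
    "\<And>c. entr A (gram B (\<lambda>b a. of_real c * \<psi> a b)) = - (\<Sum>k<card A. (c\<^sup>2 * l k) * ln (c\<^sup>2 * l k))"
proof -
  obtain l u where lu: "eigensys A (gram B (\<lambda>b a. \<psi> a b)) {..<card A} l u"
    by (rule gram_eigensys[OF assms(1)])
  have s: "(\<Sum>k<card A. l k) = (\<Sum>a\<in>A. \<Sum>b\<in>B. (cmod (\<psi> a b))\<^sup>2)"
    unfolding gram_eigenvalue_sum[OF lu assms(1)] by (rule sum.swap)
  show ?thesis
  proof (rule that[of l])
    show "0 \<le> l k" if "k < card A" for k
      using gram_eigenvalue_nonneg[OF lu assms(1)] that by simp
    show "ent_weight A B \<psi> = - (\<Sum>k<card A. l k * ln (l k)) + (\<Sum>k<card A. l k) * ln (\<Sum>k<card A. l k)"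
      unfolding ent_weight_def s entr_gram[OF assms lu] ..
    \<comment> \<open>Scaling keeps the eigenvectors, so one family \<open>l\<close> serves all
      \<open>c\<close>, as the comparison in \<open>ent_weight_scale\<close> requires.\<close>
    show "entr A (gram B (\<lambda>b a. of_real c * \<psi> a b)) = - (\<Sum>k<card A. (c\<^sup>2 * l k) * ln (c\<^sup>2 * l k))" for c
    proof (rule entr_gram[OF assms])
      show "eigensys A (gram B (\<lambda>b a. of_real c * \<psi> a b)) {..<card A} (\<lambda>k. c\<^sup>2 * l k) u"
        by (rule eigensys_cong[OF eigensys_scale[OF lu]])
          (simp add: gram_def sum_distrib_left power2_eq_square mult_ac)
    qed
  qed (rule s)
qed

lemma ent_weight_nonneg:
  assumes "finite A" "finite B"
  shows "0 \<le> ent_weight A B \<psi>"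
proof -
  obtain l where l: "\<And>k. k < card A \<Longrightarrow> 0 \<le> l k" and
    e: "ent_weight A B \<psi> = - (\<Sum>k<card A. l k * ln (l k)) + (\<Sum>k<card A. l k) * ln (\<Sum>k<card A. l k)"
    by (rule ent_weight_eigen[OF assms, of \<psi>]) (rule that)
  have "l k * ln (l k) \<le> l k * ln (\<Sum>k<card A. l k)" if "k < card A" for k
  proof (cases "l k = 0")
    case False
    then have "0 < l k" using l[OF that] by simp
    moreover have "l k \<le> (\<Sum>k<card A. l k)" using l that by (intro member_le_sum) auto
    ultimately show ?thesis by (intro mult_left_mono) auto
  qed simp
  then have "(\<Sum>k<card A. l k * ln (l k)) \<le> (\<Sum>k<card A. l k * ln (\<Sum>k<card A. l k))"
    by (intro sum_mono) simp
  then show ?thesis unfolding e by (simp add: sum_distrib_right)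
qed

lemma ent_weight_eq_0:
  assumes "finite A" "finite B" "(\<Sum>a\<in>A. \<Sum>b\<in>B. (cmod (\<psi> a b))\<^sup>2) = 0"
  shows "ent_weight A B \<psi> = 0"
proof -
  obtain l where l: "\<And>k. k < card A \<Longrightarrow> 0 \<le> l k" "(\<Sum>k<card A. l k) = (\<Sum>a\<in>A. \<Sum>b\<in>B. (cmod (\<psi> a b))\<^sup>2)" and
    e: "ent_weight A B \<psi> = - (\<Sum>k<card A. l k * ln (l k)) + (\<Sum>k<card A. l k) * ln (\<Sum>k<card A. l k)"
    by (rule ent_weight_eigen[OF assms(1,2), of \<psi>]) (rule that)
  have "\<forall>k\<in>{..<card A}. l k = 0"
    using l assms(3) by (subst sum_nonneg_eq_0_iff[symmetric]) auto
  then show ?thesis unfolding e by simp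
qed

text \<open>Uses \<open>ln y \<le> y - 1\<close> at \<open>y = 1 / x\<close>. The bound makes the
  set under the supremum in \<open>EoA\<close> bounded.\<close>

lemma ent_weight_le_card:
  assumes "finite A" "finite B" "(\<Sum>a\<in>A. \<Sum>b\<in>B. (cmod (\<psi> a b))\<^sup>2) = 1"
  shows "ent_weight A B \<psi> \<le> card A"
proof -
  obtain l where l: "\<And>k. k < card A \<Longrightarrow> 0 \<le> l k" "(\<Sum>k<card A. l k) = (\<Sum>a\<in>A. \<Sum>b\<in>B. (cmod (\<psi> a b))\<^sup>2)" and
    e: "ent_weight A B \<psi> = - (\<Sum>k<card A. l k * ln (l k)) + (\<Sum>k<card A. l k) * ln (\<Sum>k<card A. l k)"
    by (rule ent_weight_eigen[OF assms(1,2), of \<psi>]) (rule that)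
  have "- (l k * ln (l k)) \<le> 1" if "k < card A" for k
  proof (cases "l k = 0")
    case False
    then have pos: "0 < l k" using l(1)[OF that] by simp
    then have "- ln (l k) \<le> 1 / l k - 1"
      using ln_le_minus_one[of "1 / l k"] by (simp add: ln_div)
    then have "l k * - ln (l k) \<le> l k * (1 / l k - 1)" using pos by (intro mult_left_mono) auto
    also have "\<dots> = 1 - l k" using pos by (simp add: algebra_simps)
    finally show ?thesis using pos by simp
  qed simp
  then have "(\<Sum>k<card A. - (l k * ln (l k))) \<le> (\<Sum>k<card A. 1)" by (intro sum_mono) simp
  then show ?thesis unfolding e l(2) assms(3) by (simp add: sum_negf)
qed

lemma mult_ln_mult:
  assumes "0 \<le> x" "0 < c"
  shows "(c * x) * ln (c * x) = c * (x * ln x) + c * ln c * (x::real)"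
  using assms by (cases "x = 0") (auto simp: ln_mult algebra_simps)

text \<open>The terms with \<open>ln (c^2)\<close> from the entropy and from the squared norm
  cancel; this is the purpose of the term \<open>t * ln t\<close> in \<open>ent_weight\<close>. With
  \<open>c = sqrt p\<close> a probability is absorbed into its vector.\<close>

lemma ent_weight_scale:
  assumes "finite A" "finite B"
  shows "ent_weight A B (\<lambda>a b. of_real c * \<psi> a b) = c\<^sup>2 * ent_weight A B \<psi>"
proof (cases "c = 0")
  case True
  then show ?thesis using ent_weight_eq_0[OF assms, of "\<lambda>a b. 0"] by simp
next
  case False
  then have c: "0 < c\<^sup>2" by simp
  obtain l where l: "\<And>k. k < card A \<Longrightarrow> 0 \<le> l k" "(\<Sum>k<card A. l k) = (\<Sum>a\<in>A. \<Sum>b\<in>B. (cmod (\<psi> a b))\<^sup>2)" and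
    e: "ent_weight A B \<psi> = - (\<Sum>k<card A. l k * ln (l k)) + (\<Sum>k<card A. l k) * ln (\<Sum>k<card A. l k)" and
    ec: "\<And>c. entr A (gram B (\<lambda>b a. of_real c * \<psi> a b)) = - (\<Sum>k<card A. (c\<^sup>2 * l k) * ln (c\<^sup>2 * l k))"
    by (rule ent_weight_eigen[OF assms, of \<psi>]) (rule that)
  have S0: "0 \<le> (\<Sum>k<card A. l k)" by (intro sum_nonneg) (use l(1) in auto)
  have "(\<Sum>a\<in>A. \<Sum>b\<in>B. (cmod (of_real c * \<psi> a b))\<^sup>2) = c\<^sup>2 * (\<Sum>k<card A. l k)"
    unfolding l(2) by (simp add: norm_mult power_mult_distrib sum_distrib_left)
  then have "ent_weight A B (\<lambda>a b. of_real c * \<psi> a b) =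
      - (\<Sum>k<card A. c\<^sup>2 * (l k * ln (l k)) + c\<^sup>2 * ln (c\<^sup>2) * l k)
      + (c\<^sup>2 * ((\<Sum>k<card A. l k) * ln (\<Sum>k<card A. l k)) + c\<^sup>2 * ln (c\<^sup>2) * (\<Sum>k<card A. l k))"
    unfolding ent_weight_def ec using l(1) c mult_ln_mult[OF S0 c] by (simp add: mult_ln_mult)
  also have "\<dots> = c\<^sup>2 * ent_weight A B \<psi>"
    unfolding e by (simp add: sum.distrib sum_distrib_left sum_distrib_right algebra_simps)
  finally show ?thesis .
qed

text \<open>Base case of the induction over subsystems: with none left, the joint index set has one
  element and \<open>A\<close> is in a pure state.\<close>

lemma ent_weight_singleton:
  assumes "finite A"
  shows "ent_weight A {c} \<psi> = 0"
proof -
  define t where "t = (\<Sum>a\<in>A. (cmod (\<psi> a c))\<^sup>2)"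
  have "gram A \<psi> c c = of_real t"
    unfolding gram_def t_def of_real_sum by (intro sum.cong refl) (simp only: complex_norm_square)
  then have "eigensys {c} (gram A \<psi>) {()} (\<lambda>_. t) (\<lambda>_ _. 1)"
    by (simp add: eigensys_def onb_def braket_def apply_op_def)
  from entr_gram[OF _ assms this] show ?thesis
    unfolding ent_weight_def entr_gram_transpose[OF assms finite.insertI[OF finite.emptyI]]
    by (simp add: t_def)
qed

section \<open>From matrices and \<open>vn_entropy\<close> to eigensystems\<close>

lemma index_mult_mat_sum:
  assumes "A \<in> carrier_mat n k" "B \<in> carrier_mat k m" "i < n" "j < m"
  shows "(A * B) $$ (i, j) = (\<Sum>l<k. A $$ (i, l) * B $$ (l, j))"
  using carrier_matD[OF assms(1)] carrier_matD[OF assms(2)] assms(3,4)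
  by (simp add: scalar_prod_def atLeast0LessThan)

lemma mat_adjoint_index:
  fixes U :: "complex mat"
  assumes "U \<in> carrier_mat n m" "i < m" "j < n"
  shows "mat_adjoint U $$ (i, j) = cnj (U $$ (j, i))"
  using assms by (simp add: mat_adjoint_def mat_of_rows_def)

text \<open>The eigenvectors are the columns of a unitary \<open>U\<close>, and
  \<open>mat_fun_eq\<close> accepts any such diagonalization. The trace then reduces to the
  expectation values of \<open>M\<close> in the \<open>u k\<close>.\<close>

lemma vn_entropy_eigensys:
  assumes e: "eigensys {..<m} M {..<m} l u"
  shows "vn_entropy (mat m m (\<lambda>(a, a'). M a a')) = - (\<Sum>k<m. l k * log 2 (l k))"
proof -
  let ?A = "mat m m (\<lambda>(a, a'). M a a')"
  define U where "U = mat m m (\<lambda>(x, k). u k x)"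
  have U: "U \<in> carrier_mat m m" by (simp add: U_def)
  have U': "mat_adjoint U \<in> carrier_mat m m"
    using carrier_matD[OF U] by (intro carrier_matI) (simp_all add: mat_adjoint_def)
  have adj: "mat_adjoint U $$ (k, x) = cnj (u k x)" if "k < m" "x < m" for k x
    using mat_adjoint_index[OF U that] that by (simp add: U_def)
  have UDU: "U * mat_diag m f * mat_adjoint U = mat m m (\<lambda>(x, y). \<Sum>k<m. f k * u k x * cnj (u k y))" for f
  proof (rule eq_matI)
    fix x y assume "x < dim_row (mat m m (\<lambda>(x, y). \<Sum>k<m. f k * u k x * cnj (u k y)))"
      "y < dim_col (mat m m (\<lambda>(x, y). \<Sum>k<m. f k * u k x * cnj (u k y)))"
    then have xy: "x < m" "y < m" by simp_all
    have "(U * mat_diag m f * mat_adjoint U) $$ (x, y) = (\<Sum>k<m. (U * mat_diag m f) $$ (x, k) * mat_adjoint U $$ (k, y))"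
      by (rule index_mult_mat_sum[OF mult_carrier_mat[OF U] U' xy]) simp
    also have "\<dots> = (\<Sum>k<m. f k * u k x * cnj (u k y))"
    proof (intro sum.cong refl)
      fix k assume "k \<in> {..<m}"
      then have k: "k < m" by simp
      have "(U * mat_diag m f) $$ (x, k) = U $$ (x, k) * f k"
        using xy k by (simp add: mat_diag_mult_right[OF U])
      also have "U $$ (x, k) = u k x" using xy k by (simp add: U_def)
      finally show "(U * mat_diag m f) $$ (x, k) * mat_adjoint U $$ (k, y) = f k * u k x * cnj (u k y)"
        using adj[OF k xy(2)] by simp
    qed
    finally show "(U * mat_diag m f * mat_adjoint U) $$ (x, y) = mat m m (\<lambda>(x, y). \<Sum>k<m. f k * u k x * cnj (u k y)) $$ (x, y)"
      using xy by simp
  qed (use U U' in auto)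
  have "U * mat_adjoint U = 1\<^sub>m m"
  proof (rule eq_matI)
    fix x y assume "x < dim_row (1\<^sub>m m)" "y < dim_col (1\<^sub>m m)"
    then have xy: "x < m" "y < m" by simp_all
    have "(U * mat_adjoint U) $$ (x, y) = (\<Sum>k<m. u k x * cnj (u k y))"
      using xy by (simp add: index_mult_mat_sum[OF U U'] adj) (simp add: U_def)
    then show "(U * mat_adjoint U) $$ (x, y) = 1\<^sub>m m $$ (x, y)"
      using xy onb_complete[OF eigensys_onb[OF e]] by simp
  qed (use U U' in auto)
  moreover have "mat_adjoint U * U = 1\<^sub>m m"
  proof (rule eq_matI)
    fix k j assume "k < dim_row (1\<^sub>m m)" "j < dim_col (1\<^sub>m m)"
    then have kj: "k < m" "j < m" by simp_all
    have "(mat_adjoint U * U) $$ (k, j) = braket {..<m} (u k) (u j)"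
      using kj by (simp add: index_mult_mat_sum[OF U' U] adj braket_def) (simp add: U_def)
    then show "(mat_adjoint U * U) $$ (k, j) = 1\<^sub>m m $$ (k, j)"
      using kj onb_orth[OF eigensys_onb[OF e]] by simp
  qed (use U U' in auto)
  moreover have "?A = U * mat_diag m (\<lambda>i. complex_of_real (l i)) * mat_adjoint U"
    unfolding UDU using eigensys_expand[OF e] by (intro eq_matI) auto
  ultimately have "similar_mat_wit ?A (mat_diag (dim_row ?A) (\<lambda>i. complex_of_real (l i))) U (mat_adjoint U)"
    using U U' mult_carrier_mat[OF mult_carrier_mat[OF U mat_diag_dim] U']
    by (simp add: similar_mat_wit_def Let_def)
  from mat_fun_eq[OF this, of "log 2"]
  have "mat_fun (log 2) ?A = mat m m (\<lambda>(x, y). \<Sum>k<m. of_real (log 2 (l k)) * u k x * cnj (u k y))"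
    by (simp add: UDU)
  then have "mat_trace (?A * mat_fun (log 2) ?A) =
      (\<Sum>x<m. \<Sum>y<m. \<Sum>k<m. of_real (log 2 (l k)) * (cnj (u k x) * M x y * u k y))"
    by (simp add: mat_trace_mult[of _ m m] sum_distrib_left mult_ac)
  also have "\<dots> = (\<Sum>x<m. \<Sum>k<m. \<Sum>y<m. of_real (log 2 (l k)) * (cnj (u k x) * M x y * u k y))"
    by (intro sum.cong refl sum.swap)
  also have "\<dots> = (\<Sum>k<m. \<Sum>x<m. \<Sum>y<m. of_real (log 2 (l k)) * (cnj (u k x) * M x y * u k y))"
    by (rule sum.swap)
  also have "\<dots> = (\<Sum>k<m. of_real (log 2 (l k)) * braket {..<m} (u k) (apply_op {..<m} M (u k)))"
    unfolding braket_apply_op by (simp only: sum_distrib_left)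
  also have "\<dots> = of_real (\<Sum>k<m. l k * log 2 (l k))"
    by (simp add: eigensys_braket_self[OF e] mult.commute)
  finally show ?thesis by (simp add: vn_entropy_def)
qed

lemma entropy_of_entanglement_eq:
  assumes "finite J" "unit_ket ({..<m} \<times> J) \<psi>"
  shows "entropy_of_entanglement m J \<psi> = ent_weight {..<m} J (\<lambda>a b. \<psi> (a, b)) / ln 2"
proof -
  obtain l u where e: "eigensys {..<m} (gram J (\<lambda>b a. \<psi> (a, b))) {..<card {..<m}} l u"
    by (rule gram_eigensys[OF finite_lessThan])
  have "trace_out_Y m J (ket_bra \<psi>) = mat m m (\<lambda>(a, a'). gram J (\<lambda>b a. \<psi> (a, b)) a a')"
    by (simp add: trace_out_Y_def ket_bra_def gram_def)
  then have "entropy_of_entanglement m J \<psi> = - (\<Sum>k<m. l k * log 2 (l k))"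
    using vn_entropy_eigensys e by (simp add: entropy_of_entanglement_def)
  also have "\<dots> = entr {..<m} (gram J (\<lambda>b a. \<psi> (a, b))) / ln 2"
    unfolding entr_gram[OF finite_lessThan assms(1) e] by (simp add: log_def sum_divide_distrib)
  also have "(\<Sum>a<m. \<Sum>b\<in>J. (cmod (\<psi> (a, b)))\<^sup>2) = 1"
    using assms(2) by (simp add: unit_ket_def sum_Times)
  then have "entr {..<m} (gram J (\<lambda>b a. \<psi> (a, b))) = ent_weight {..<m} J (\<lambda>a b. \<psi> (a, b))"
    by (simp add: ent_weight_def)
  finally show ?thesis .
qed

section \<open>Ensembles and entanglement of assistance\<close>

lemma decomposition_value:
  assumes "finite J" "pure_state_decomposition ({..<m} \<times> J) \<rho> n p \<psi>"
  shows "(\<Sum>i<n. p i * entropy_of_entanglement m J (\<psi> i)) =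
    (\<Sum>i<n. p i * ent_weight {..<m} J (\<lambda>a b. \<psi> i (a, b))) / ln 2"
  using assms(2) unfolding pure_state_decomposition_def sum_divide_distrib
  by (intro sum.cong refl) (simp add: entropy_of_entanglement_eq[OF assms(1)])

lemma bdd_above_decomposition_values:
  assumes "finite J"
  shows "bdd_above {\<Sum>i<n. p i * entropy_of_entanglement m J (\<psi> i) | n p \<psi>.
    pure_state_decomposition ({..<m} \<times> J) \<rho> n p \<psi>}"
proof (rule bdd_aboveI)
  fix x assume "x \<in> {\<Sum>i<n. p i * entropy_of_entanglement m J (\<psi> i) | n p \<psi>.
    pure_state_decomposition ({..<m} \<times> J) \<rho> n p \<psi>}"
  then obtain n p \<psi> where x: "x = (\<Sum>i<n. p i * entropy_of_entanglement m J (\<psi> i))"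
    and dec: "pure_state_decomposition ({..<m} \<times> J) \<rho> n p \<psi>" by blast
  have "ent_weight {..<m} J (\<lambda>a b. \<psi> i (a, b)) \<le> m" if "i < n" for i
    using ent_weight_le_card[of "{..<m}" J "\<lambda>a b. \<psi> i (a, b)"] dec that assms
    by (simp add: pure_state_decomposition_def unit_ket_def sum_Times)
  then have "(\<Sum>i<n. p i * ent_weight {..<m} J (\<lambda>a b. \<psi> i (a, b))) \<le> (\<Sum>i<n. p i * m)"
    using dec by (intro sum_mono mult_left_mono) (auto simp: pure_state_decomposition_def)
  also have "\<dots> = m" using dec by (simp add: pure_state_decomposition_def flip: sum_distrib_right)
  finally show "x \<le> m / ln 2"
    unfolding x decomposition_value[OF assms dec] by (simp add: divide_right_mono)
qed

text \<open>Vectors of any norm, over any finite index set, become a decomposition once normalized;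
  by homogeneity the squared norms as probabilities restore the same total.\<close>

lemma ensemble_le_EoA:
  fixes \<phi> :: "'s \<Rightarrow> (nat \<times> 'y) ket"
  assumes fin: "finite J" "finite S"
    and \<rho>: "\<And>x y. x \<in> {..<m} \<times> J \<Longrightarrow> y \<in> {..<m} \<times> J \<Longrightarrow> \<rho> x y = (\<Sum>s\<in>S. ket_bra (\<phi> s) x y)"
    and tr: "(\<Sum>x\<in>{..<m} \<times> J. \<rho> x x) = 1"
  shows "(\<Sum>s\<in>S. ent_weight {..<m} J (\<lambda>a b. \<phi> s (a, b))) \<le> ln 2 * EoA m J \<rho>"
proof -
  let ?I = "{..<m} \<times> J" and ?n = "card S"
  have finI: "finite ?I" using fin by simp
  obtain x0 where x0: "x0 \<in> ?I" using tr by (metis sum.empty all_not_in_conv zero_neq_one)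
  obtain g where g: "bij_betw g {..<?n} S"
    using ex_bij_betw_nat_finite[OF fin(2)] by (auto simp: atLeast0LessThan)
  have sum_g: "(\<Sum>s\<in>S. F s) = (\<Sum>i<?n. F (g i))" for F :: "_ \<Rightarrow> 'z::comm_monoid_add"
    using sum.reindex_bij_betw[OF g, of F] by simp
  define N where "N i = (\<Sum>x\<in>?I. (cmod (\<phi> (g i) x))\<^sup>2)" for i
  have N0: "0 \<le> N i" for i unfolding N_def by (intro sum_nonneg) simp
  \<comment> \<open>A zero vector has probability 0 but must still be given some unit vector;
    \<open>x0\<close> exists because an empty trace would not be 1.\<close>
  define \<psi> where "\<psi> i = (if N i = 0 then (\<lambda>x. of_bool (x = x0)) else (\<lambda>x. of_real (1 / sqrt (N i)) * \<phi> (g i) x))" for i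
  have \<phi>0: "\<phi> (g i) x = 0" if "N i = 0" "x \<in> ?I" for i x
    using that finI unfolding N_def by (subst (asm) sum_nonneg_eq_0_iff) auto
  have unit: "unit_ket ?I (\<psi> i)" for i
  proof (cases "N i = 0")
    case True
    have "(\<Sum>x\<in>?I. (cmod (\<psi> i x))\<^sup>2) = (\<Sum>x\<in>?I. 1 * of_bool (x = x0))"
      using True by (intro sum.cong) (auto simp: \<psi>_def)
    also have "\<dots> = 1" by (rule sum_mult_of_bool(1)[OF finI x0])
    finally show ?thesis by (simp add: unit_ket_def)
  next
    case False
    have "(\<Sum>x\<in>?I. (cmod (\<psi> i x))\<^sup>2) = (\<Sum>x\<in>?I. (cmod (\<phi> (g i) x))\<^sup>2 / N i)"
      using False N0[of i] by (intro sum.cong refl) (simp add: \<psi>_def norm_mult norm_divide power_divide)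
    also have "\<dots> = 1" using False unfolding sum_divide_distrib[symmetric] N_def[symmetric] by simp
    finally show ?thesis by (simp add: unit_ket_def)
  qed
  have kb: "of_real (N i) * ket_bra (\<psi> i) x y = ket_bra (\<phi> (g i)) x y" if "x \<in> ?I" "y \<in> ?I" for i x y
  proof (cases "N i = 0")
    case True
    then show ?thesis using \<phi>0[OF True that(1)] by (simp add: ket_bra_def)
  next
    case False
    have "complex_of_real (N i) * (of_real (1 / sqrt (N i)) * of_real (1 / sqrt (N i))) = of_real (N i * (1 / sqrt (N i) * (1 / sqrt (N i))))"
      by (simp only: of_real_mult)
    also have "N i * (1 / sqrt (N i) * (1 / sqrt (N i))) = 1"
      using False N0[of i] by (simp add: field_simps)
    finally have "complex_of_real (N i) * (of_real (1 / sqrt (N i)) * of_real (1 / sqrt (N i))) = 1" by simp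
    moreover have "of_real (N i) * ket_bra (\<psi> i) x y =
        (of_real (N i) * (of_real (1 / sqrt (N i)) * of_real (1 / sqrt (N i)))) * ket_bra (\<phi> (g i)) x y"
      using False unfolding ket_bra_def \<psi>_def by (simp only: if_False complex_cnj_mult complex_cnj_complex_of_real mult_ac)
    ultimately show ?thesis by simp
  qed
  have "complex_of_real (\<Sum>i<?n. N i) = (\<Sum>i<?n. \<Sum>x\<in>?I. ket_bra (\<phi> (g i)) x x)"
    unfolding N_def of_real_sum ket_bra_def by (simp only: complex_norm_square)
  also have "\<dots> = (\<Sum>x\<in>?I. \<Sum>i<?n. ket_bra (\<phi> (g i)) x x)" by (rule sum.swap)
  also have "\<dots> = (\<Sum>x\<in>?I. \<rho> x x)" by (intro sum.cong refl) (simp add: \<rho> sum_g)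
  finally have N1: "(\<Sum>i<?n. N i) = 1" unfolding tr by (metis of_real_1 of_real_eq_iff)
  have dec: "pure_state_decomposition ?I \<rho> ?n N \<psi>"
    unfolding pure_state_decomposition_def using N0 N1 unit kb by (simp add: \<rho> sum_g)
  have "N i * ent_weight {..<m} J (\<lambda>a b. \<psi> i (a, b)) = ent_weight {..<m} J (\<lambda>a b. \<phi> (g i) (a, b))" for i
  proof (cases "N i = 0")
    case True
    then have "ent_weight {..<m} J (\<lambda>a b. \<phi> (g i) (a, b)) = 0"
      by (intro ent_weight_eq_0 fin) (simp_all add: \<phi>0)
    then show ?thesis using True by simp
  next
    case False
    have "ent_weight {..<m} J (\<lambda>a b. \<psi> i (a, b)) = (1 / sqrt (N i))\<^sup>2 * ent_weight {..<m} J (\<lambda>a b. \<phi> (g i) (a, b))"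
      unfolding \<psi>_def using False ent_weight_scale[OF finite_lessThan fin(1), of m "1 / sqrt (N i)"] by simp
    then show ?thesis using False N0[of i] by (simp add: power_divide)
  qed
  then have "(\<Sum>s\<in>S. ent_weight {..<m} J (\<lambda>a b. \<phi> s (a, b))) / ln 2 = (\<Sum>i<?n. N i * entropy_of_entanglement m J (\<psi> i))"
    unfolding decomposition_value[OF fin(1) dec] by (simp add: sum_g)
  also have "\<dots> \<le> EoA m J \<rho>"
    unfolding EoA_def using dec by (intro cSup_upper bdd_above_decomposition_values fin) blast
  finally show ?thesis by (simp add: field_simps)
qed

text \<open>The eigendecomposition keeps the supremum in \<open>EoA\<close> from ranging over the
  empty set.\<close>

lemma density_ensemble:
  assumes "finite I" "density_operator I \<rho>"
  shows "\<exists>p \<psi>. pure_state_decomposition I \<rho> (card I) p \<psi>"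
proof -
  obtain l u where lu: "eigensys I \<rho> {..<card I} l u" "\<forall>k<card I. 0 \<le> l k"
    using spectral_theorem[OF assms(1), of \<rho>] assms(2) unfolding density_operator_def by blast
  have "unit_ket I (u k)" if "k < card I" for k
  proof -
    have "complex_of_real (\<Sum>x\<in>I. (cmod (u k x))\<^sup>2) = of_real 1"
      unfolding braket_self[symmetric] using onb_orth[OF eigensys_onb[OF lu(1)], of k k] that by simp
    then show ?thesis unfolding unit_ket_def by (simp only: of_real_eq_iff)
  qed
  moreover have "(\<Sum>k<card I. l k) = 1"
    using eigensys_trace[OF lu(1) assms(1)] assms(2) unfolding density_operator_def
    by (metis of_real_1 of_real_eq_iff)
  moreover have "\<rho> x y = (\<Sum>k<card I. of_real (l k) * ket_bra (u k) x y)" if "x \<in> I" "y \<in> I" for x y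
    using eigensys_expand[OF lu(1) assms(1) that] by (simp add: ket_bra_def mult.assoc)
  ultimately show ?thesis using lu(2) unfolding pure_state_decomposition_def by blast
qed

lemma decomposition_ensemble:
  assumes "finite J" "pure_state_decomposition ({..<m} \<times> J) \<rho> n p \<psi>"
  shows "(\<Sum>i<n. p i * entropy_of_entanglement m J (\<psi> i)) =
      (\<Sum>i<n. ent_weight {..<m} J (\<lambda>a b. of_real (sqrt (p i)) * \<psi> i (a, b))) / ln 2"
    "\<And>x y. x \<in> {..<m} \<times> J \<Longrightarrow> y \<in> {..<m} \<times> J \<Longrightarrow>
      \<rho> x y = (\<Sum>i<n. ket_bra (\<lambda>x. of_real (sqrt (p i)) * \<psi> i x) x y)"
proof -
  have p0: "0 \<le> p i" if "i < n" for i using assms(2) that by (simp add: pure_state_decomposition_def)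
  show "(\<Sum>i<n. p i * entropy_of_entanglement m J (\<psi> i)) =
      (\<Sum>i<n. ent_weight {..<m} J (\<lambda>a b. of_real (sqrt (p i)) * \<psi> i (a, b))) / ln 2"
    unfolding decomposition_value[OF assms] ent_weight_scale[OF finite_lessThan assms(1)]
    by (simp add: p0)
  fix x y assume "x \<in> {..<m} \<times> J" "y \<in> {..<m} \<times> J"
  then have "\<rho> x y = (\<Sum>i<n. of_real (p i) * ket_bra (\<psi> i) x y)"
    using assms(2) unfolding pure_state_decomposition_def by blast
  also have "\<dots> = (\<Sum>i<n. ket_bra (\<lambda>x. of_real (sqrt (p i)) * \<psi> i x) x y)"
  proof (intro sum.cong refl)
    fix i assume "i \<in> {..<n}"
    then have "complex_of_real (p i) = of_real (sqrt (p i)) * of_real (sqrt (p i))"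
      using p0[of i] by (simp flip: of_real_mult)
    then show "of_real (p i) * ket_bra (\<psi> i) x y = ket_bra (\<lambda>x. of_real (sqrt (p i)) * \<psi> i x) x y"
      by (simp add: ket_bra_def)
  qed
  finally show "\<rho> x y = (\<Sum>i<n. ket_bra (\<lambda>x. of_real (sqrt (p i)) * \<psi> i x) x y)" .
qed

section \<open>Joint index sets and induction over the subsystems\<close>

lemma finite_joint_index: "finite P \<Longrightarrow> finite (joint_index P d)"
  unfolding joint_index_def by (intro finite_PiE) auto

lemma sum_joint_index_insert:
  assumes "k \<notin> P"
  shows "(\<Sum>c\<in>joint_index (insert k P) d. F c) = (\<Sum>b<d k. \<Sum>c\<in>joint_index P d. F (c(k := b)))"
proof -
  have "(\<Sum>c\<in>joint_index (insert k P) d. F c) =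
      (\<Sum>p\<in>{..<d k} \<times> joint_index P d. F ((\<lambda>(b, c). c(k := b)) p))"
    unfolding joint_index_def PiE_insert_eq
    by (subst sum.reindex[OF inj_combinator[OF assms]]) simp
  then show ?thesis by (simp add: sum_Times)
qed

lemma joint_index_insert_upd: "b < d k \<Longrightarrow> c \<in> joint_index P d \<Longrightarrow> c(k := b) \<in> joint_index (insert k P) d"
  unfolding joint_index_def by (auto simp: PiE_insert_eq)

lemma sum_ket_bra_slices:
  assumes "onb C K e" "finite C"
  shows "(\<Sum>\<kappa>\<in>K. ket_bra (\<lambda>(a, b). slice C \<phi> e \<kappa> a b) (a, b) (a', b')) = (\<Sum>c\<in>C. \<phi> a b c * cnj (\<phi> a' b' c))"
  using slice_sum[OF assms] by (simp add: ket_bra_def)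

text \<open>Stated for ensembles, since discarding subsystem \<open>k\<close> turns each member into
  several vectors, one for each outcome on \<open>k\<close>. With \<open>B\<close> the subsystem
  \<open>k\<close> and \<open>C\<close> all the others, measuring \<open>C\<close> gives an ensemble
  for the state of \<open>A\<close> and \<open>k\<close>, and measuring \<open>B\<close> gives one
  for the state of \<open>A\<close> and the rest, to which the induction hypothesis applies.\<close>

lemma polygamy_ensemble:
  fixes n :: nat and \<rho> :: "(nat \<times> ('p \<Rightarrow> nat)) oper"
  assumes "finite P"
    and "\<And>x y. x \<in> {..<m} \<times> joint_index P d \<Longrightarrow> y \<in> {..<m} \<times> joint_index P d \<Longrightarrow>
      \<rho> x y = (\<Sum>i<n. ket_bra (\<psi> i) x y)"
    and "(\<Sum>x\<in>{..<m} \<times> joint_index P d. \<rho> x x) = 1"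
  shows "(\<Sum>i<n. ent_weight {..<m} (joint_index P d) (\<lambda>a c. \<psi> i (a, c))) \<le>
    ln 2 * (\<Sum>k\<in>P. EoA m {..<d k} (reduced_AB P d k \<rho>))"
  using assms
proof (induction P arbitrary: n \<psi> \<rho> rule: finite_induct)
  case empty
  then show ?case by (simp add: joint_index_def ent_weight_singleton)
next
  case (insert k P)
  note \<rho> = insert.prems(1) and tr = insert.prems(2)
  let ?A = "{..<m}" and ?B = "{..<d k}" and ?C = "joint_index P d" and ?J = "joint_index (insert k P) d"
  have fin: "finite ?A" "finite ?B" "finite ?C" using insert.hyps(1) by (simp_all add: finite_joint_index)
  have sumJ: "(\<Sum>c\<in>?J. F c) = (\<Sum>b\<in>?B. \<Sum>c\<in>?C. F (c(k := b)))" for F :: "_ \<Rightarrow> 'z::comm_monoid_add"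
    by (rule sum_joint_index_insert[OF insert.hyps(2)])
  have upd: "c(k := b) \<in> ?J" if "b \<in> ?B" "c \<in> ?C" for b c
    using that by (intro joint_index_insert_upd) auto
  have ne: "?B \<noteq> {}" "?C \<noteq> {}" using tr unfolding sum_Times sumJ by auto
  define \<phi> where "\<phi> i a b c = \<psi> i (a, c(k := b))" for i a b c
  have \<rho>': "\<rho> (a, c(k := b)) (a', c'(k := b')) = (\<Sum>i<n. \<phi> i a b c * cnj (\<phi> i a' b' c'))"
    if "a < m" "a' < m" "b \<in> ?B" "b' \<in> ?B" "c \<in> ?C" "c' \<in> ?C" for a a' b b' c c'
    using that upd by (subst \<rho>) (auto simp: ket_bra_def \<phi>_def)
  have whole: "ent_weight ?A ?J (\<lambda>a c. \<psi> i (a, c)) = ent_weight ?A (?B \<times> ?C) (\<lambda>a (b, c). \<phi> i a b c)" for i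
  proof -
    have "entr ?A (gram ?J (\<lambda>c a. \<psi> i (a, c))) = entr ?A (gram (?B \<times> ?C) (\<lambda>p a. case p of (b, c) \<Rightarrow> \<phi> i a b c))"
      by (rule entr_cong) (simp add: gram_def sumJ sum_Times \<phi>_def)
    then show ?thesis by (simp add: ent_weight_def sumJ sum_Times \<phi>_def)
  qed
  define Q where "Q i e f \<longleftrightarrow> onb ?C {..<card ?C} e \<and> onb ?B {..<card ?B} f \<and>
    ent_weight ?A (?B \<times> ?C) (\<lambda>a (b, c). \<phi> i a b c) \<le>
      (\<Sum>\<kappa><card ?C. ent_weight ?A ?B (slice ?C (\<phi> i) e \<kappa>)) +
      (\<Sum>\<kappa><card ?B. ent_weight ?A ?C (slice ?B (\<lambda>a c b. \<phi> i a b c) f \<kappa>))" for i e f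
  have "\<exists>e f. Q i e f" for i
    unfolding Q_def by (rule polygamy_tripartite_pure[OF fin ne])
  then obtain e f where Q: "\<And>i. Q i (e i) (f i)" by metis
  have e: "onb ?C {..<card ?C} (e i)" and f: "onb ?B {..<card ?B} (f i)" and
    le: "ent_weight ?A (?B \<times> ?C) (\<lambda>a (b, c). \<phi> i a b c) \<le>
      (\<Sum>\<kappa><card ?C. ent_weight ?A ?B (slice ?C (\<phi> i) (e i) \<kappa>)) +
      (\<Sum>\<kappa><card ?B. ent_weight ?A ?C (slice ?B (\<lambda>a c b. \<phi> i a b c) (f i) \<kappa>))" for i
    using Q[of i] by (simp_all add: Q_def)
  have Pk: "insert k P - {k} = P" using insert.hyps(2) by simp

  have "(\<Sum>s\<in>{..<n} \<times> {..<card ?C}. ent_weight ?A ?B (\<lambda>a b. (\<lambda>(i, \<kappa>) (a, b). slice ?C (\<phi> i) (e i) \<kappa> a b) s (a, b)))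
    \<le> ln 2 * EoA m ?B (reduced_AB (insert k P) d k \<rho>)"
  proof (rule ensemble_le_EoA)
    fix x y assume "x \<in> ?A \<times> ?B" "y \<in> ?A \<times> ?B"
    then obtain a b a' b' where xy: "x = (a, b)" "y = (a', b')" "a < m" "a' < m" "b \<in> ?B" "b' \<in> ?B" by auto
    have "(\<Sum>s\<in>{..<n} \<times> {..<card ?C}. ket_bra ((\<lambda>(i, \<kappa>) (a, b). slice ?C (\<phi> i) (e i) \<kappa> a b) s) x y) =
        (\<Sum>i<n. \<Sum>c\<in>?C. \<phi> i a b c * cnj (\<phi> i a' b' c))"
      unfolding sum_Times xy(1,2) by (simp add: sum_ket_bra_slices[OF e fin(3)])
    also have "\<dots> = (\<Sum>c\<in>?C. \<Sum>i<n. \<phi> i a b c * cnj (\<phi> i a' b' c))" by (rule sum.swap)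
    also have "\<dots> = reduced_AB (insert k P) d k \<rho> x y"
      unfolding reduced_AB_def Pk xy(1,2) using xy by (simp add: \<rho>')
    finally show "reduced_AB (insert k P) d k \<rho> x y =
        (\<Sum>s\<in>{..<n} \<times> {..<card ?C}. ket_bra ((\<lambda>(i, \<kappa>) (a, b). slice ?C (\<phi> i) (e i) \<kappa> a b) s) x y)" ..
  next
    show "(\<Sum>x\<in>?A \<times> ?B. reduced_AB (insert k P) d k \<rho> x x) = 1"
      using tr unfolding reduced_AB_def Pk by (simp add: sum_Times sumJ)
  qed simp_all
  then have part1: "(\<Sum>i<n. \<Sum>\<kappa><card ?C. ent_weight ?A ?B (slice ?C (\<phi> i) (e i) \<kappa>))
      \<le> ln 2 * EoA m ?B (reduced_AB (insert k P) d k \<rho>)"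
    by (simp add: sum_Times)

  \<comment> \<open>The partial trace over \<open>k\<close>. Its ensemble \<open>\<chi>\<close> is
    indexed by pairs, which \<open>g\<close> renumbers to fit the induction hypothesis.\<close>
  define \<rho>2 where "\<rho>2 = (\<lambda>(a, c) (a', c'). \<Sum>b\<in>?B. \<rho> (a, c(k := b)) (a', c'(k := b)))"
  define \<chi> where "\<chi> = (\<lambda>(i, \<kappa>) (a, c). slice ?B (\<lambda>a c b. \<phi> i a b c) (f i) \<kappa> a c)"
  let ?S = "{..<n} \<times> {..<card ?B}"
  obtain g where g: "bij_betw g {..<card ?S} ?S"
    using ex_bij_betw_nat_finite[of ?S] by (auto simp: atLeast0LessThan)
  have sum_g: "(\<Sum>i<card ?S. F (g i)) = (\<Sum>s\<in>?S. F s)" for F :: "_ \<Rightarrow> 'z::comm_monoid_add"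
    using sum.reindex_bij_betw[OF g, of F] by simp
  have "(\<Sum>j<card ?S. ent_weight ?A ?C (\<lambda>a c. \<chi> (g j) (a, c))) \<le>
    ln 2 * (\<Sum>j\<in>P. EoA m {..<d j} (reduced_AB P d j \<rho>2))"
  proof (rule insert.IH)
    fix x y assume "x \<in> ?A \<times> ?C" "y \<in> ?A \<times> ?C"
    then obtain a c a' c' where xy: "x = (a, c)" "y = (a', c')" "a < m" "a' < m" "c \<in> ?C" "c' \<in> ?C" by auto
    have "(\<Sum>j<card ?S. ket_bra (\<chi> (g j)) x y) = (\<Sum>i<n. \<Sum>b\<in>?B. \<phi> i a b c * cnj (\<phi> i a' b c'))"
      unfolding sum_g[of "\<lambda>s. ket_bra (\<chi> s) x y"] unfolding sum_Times xy(1,2) \<chi>_def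
      by (simp add: sum_ket_bra_slices[OF f fin(2)] del: card_lessThan)
    also have "\<dots> = (\<Sum>b\<in>?B. \<Sum>i<n. \<phi> i a b c * cnj (\<phi> i a' b c'))" by (rule sum.swap)
    also have "\<dots> = \<rho>2 x y"
      unfolding \<rho>2_def xy(1,2) using xy by (simp add: \<rho>')
    finally show "\<rho>2 x y = (\<Sum>j<card ?S. ket_bra (\<chi> (g j)) x y)" ..
  next
    show "(\<Sum>x\<in>?A \<times> ?C. \<rho>2 x x) = 1"
      using tr unfolding \<rho>2_def by (simp add: sum_Times sumJ sum.swap[of _ ?C ?B])
  qed
  also have "(\<Sum>j\<in>P. EoA m {..<d j} (reduced_AB P d j \<rho>2)) = (\<Sum>j\<in>P. EoA m {..<d j} (reduced_AB (insert k P) d j \<rho>))"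
  proof (intro sum.cong refl)
    fix j assume j: "j \<in> P"
    then have kj: "k \<noteq> j" using insert.hyps(2) by auto
    have ins: "insert k P - {j} = insert k (P - {j})" "k \<notin> P - {j}" using kj insert.hyps(2) by auto
    \<comment> \<open>Partial traces compose: first over \<open>k\<close>, then over the rest except
      \<open>j\<close>.\<close>
    have "reduced_AB P d j \<rho>2 = reduced_AB (insert k P) d j \<rho>"
      unfolding reduced_AB_def \<rho>2_def ins(1) sum_joint_index_insert[OF ins(2)]
      by (simp add: fun_eq_iff fun_upd_twist[OF kj] sum.swap[of _ "joint_index (P - {j}) d" ?B])
    then show "EoA m {..<d j} (reduced_AB P d j \<rho>2) = EoA m {..<d j} (reduced_AB (insert k P) d j \<rho>)" by simp
  qed
  also have "(\<Sum>j<card ?S. ent_weight ?A ?C (\<lambda>a c. \<chi> (g j) (a, c))) =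
      (\<Sum>i<n. \<Sum>\<kappa><card ?B. ent_weight ?A ?C (slice ?B (\<lambda>a c b. \<phi> i a b c) (f i) \<kappa>))"
    unfolding sum_g[of "\<lambda>s. ent_weight ?A ?C (\<lambda>a c. \<chi> s (a, c))"] unfolding sum_Times by (simp add: \<chi>_def)
  finally have part2: "(\<Sum>i<n. \<Sum>\<kappa><card ?B. ent_weight ?A ?C (slice ?B (\<lambda>a c b. \<phi> i a b c) (f i) \<kappa>))
      \<le> ln 2 * (\<Sum>j\<in>P. EoA m {..<d j} (reduced_AB (insert k P) d j \<rho>))" .

  have "(\<Sum>i<n. ent_weight ?A ?J (\<lambda>a c. \<psi> i (a, c))) \<le>
      (\<Sum>i<n. (\<Sum>\<kappa><card ?C. ent_weight ?A ?B (slice ?C (\<phi> i) (e i) \<kappa>)) +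
        (\<Sum>\<kappa><card ?B. ent_weight ?A ?C (slice ?B (\<lambda>a c b. \<phi> i a b c) (f i) \<kappa>)))"
    unfolding whole by (intro sum_mono le)
  also have "\<dots> \<le> ln 2 * (\<Sum>j\<in>insert k P. EoA m {..<d j} (reduced_AB (insert k P) d j \<rho>))"
    using part1 part2 insert.hyps by (simp add: sum.distrib distrib_left)
  finally show ?case .
qed

lemma polygamy_EoA:
  assumes "finite P" "density_operator ({..<m} \<times> joint_index P d) \<rho>"
  shows "EoA m (joint_index P d) \<rho> \<le> (\<Sum>k\<in>P. EoA m {..<d k} (reduced_AB P d k \<rho>))"
proof -
  let ?J = "joint_index P d"
  have finJ: "finite ?J" by (rule finite_joint_index[OF assms(1)])
  have tr: "(\<Sum>x\<in>{..<m} \<times> ?J. \<rho> x x) = 1" using assms(2) by (simp add: density_operator_def)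
  show ?thesis
    unfolding EoA_def[of m ?J]
  proof (rule cSup_least)
    show "{\<Sum>i<n. p i * entropy_of_entanglement m ?J (\<psi> i) | n p \<psi>.
        pure_state_decomposition ({..<m} \<times> ?J) \<rho> n p \<psi>} \<noteq> {}"
      using density_ensemble[OF _ assms(2)] finJ by blast
  next
    fix x assume "x \<in> {\<Sum>i<n. p i * entropy_of_entanglement m ?J (\<psi> i) | n p \<psi>.
        pure_state_decomposition ({..<m} \<times> ?J) \<rho> n p \<psi>}"
    then obtain n p \<psi> where x: "x = (\<Sum>i<n. p i * entropy_of_entanglement m ?J (\<psi> i))"
      and dec: "pure_state_decomposition ({..<m} \<times> ?J) \<rho> n p \<psi>" by blast
    have "(\<Sum>i<n. ent_weight {..<m} ?J (\<lambda>a b. of_real (sqrt (p i)) * \<psi> i (a, b))) \<le>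
        ln 2 * (\<Sum>k\<in>P. EoA m {..<d k} (reduced_AB P d k \<rho>))"
      by (rule polygamy_ensemble[OF assms(1) decomposition_ensemble(2)[OF finJ dec] tr])
    then show "x \<le> (\<Sum>k\<in>P. EoA m {..<d k} (reduced_AB P d k \<rho>))"
      unfolding x decomposition_ensemble(1)[OF finJ dec] by (simp add: field_simps)
  qed
qed

section \<open>Nonnegativity of the entanglement of assistance\<close>

lemma EoA_nonneg_ensemble:
  fixes \<phi> :: "'s \<Rightarrow> (nat \<times> 'y) ket"
  assumes "finite J" "finite S"
    and "\<And>x y. x \<in> {..<m} \<times> J \<Longrightarrow> y \<in> {..<m} \<times> J \<Longrightarrow> \<rho> x y = (\<Sum>s\<in>S. ket_bra (\<phi> s) x y)"
    and "(\<Sum>x\<in>{..<m} \<times> J. \<rho> x x) = 1"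
  shows "0 \<le> EoA m J \<rho>"
proof -
  have "0 \<le> (\<Sum>s\<in>S. ent_weight {..<m} J (\<lambda>a b. \<phi> s (a, b)))"
    using assms(1) by (intro sum_nonneg ent_weight_nonneg) auto
  also have "\<dots> \<le> ln 2 * EoA m J \<rho>" by (rule ensemble_le_EoA[OF assms])
  finally show ?thesis by (simp add: zero_le_mult_iff)
qed

lemma EoA_nonneg:
  assumes "finite J" "density_operator ({..<m} \<times> J) \<rho>"
  shows "0 \<le> EoA m J \<rho>"
proof -
  obtain n p \<psi> where dec: "pure_state_decomposition ({..<m} \<times> J) \<rho> n p \<psi>"
    using density_ensemble[OF _ assms(2)] assms(1) by blast
  show ?thesis
    by (rule EoA_nonneg_ensemble[OF assms(1) finite_lessThan decomposition_ensemble(2)[OF assms(1) dec]])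
      (use assms(2) in \<open>simp_all add: density_operator_def\<close>)
qed

text \<open>An ensemble of the whole state yields one of the reduced state: measuring the discarded
  subsystems in the standard basis with outcome \<open>c\<close> leaves the vector
  \<open>\<phi> i (a, c(k := b))\<close>.\<close>

lemma EoA_reduced_nonneg:
  assumes "finite P" "k \<in> P" "density_operator ({..<m} \<times> joint_index P d) \<rho>"
  shows "0 \<le> EoA m {..<d k} (reduced_AB P d k \<rho>)"
proof -
  let ?J = "joint_index P d" and ?C = "joint_index (P - {k}) d"
  have finJ: "finite ?J" "finite ?C" using assms(1) by (simp_all add: finite_joint_index)
  obtain n p \<psi> where dec: "pure_state_decomposition ({..<m} \<times> ?J) \<rho> n p \<psi>"
    using density_ensemble[OF _ assms(3)] finJ by blast
  define \<phi> where "\<phi> i x = of_real (sqrt (p i)) * \<psi> i x" for i x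
  note \<rho> = decomposition_ensemble(2)[OF finJ(1) dec, folded \<phi>_def]
  have P: "insert k (P - {k}) = P" using assms(2) by auto
  show ?thesis
  proof (rule EoA_nonneg_ensemble[where S = "{..<n} \<times> ?C" and \<phi> = "\<lambda>(i, c) (a, b). \<phi> i (a, c(k := b))"])
    fix x y assume "x \<in> {..<m} \<times> {..<d k}" "y \<in> {..<m} \<times> {..<d k}"
    then obtain a b a' b' where xy: "x = (a, b)" "y = (a', b')" "a < m" "a' < m" "b < d k" "b' < d k" by auto
    have "reduced_AB P d k \<rho> x y = (\<Sum>c\<in>?C. \<Sum>i<n. \<phi> i (a, c(k := b)) * cnj (\<phi> i (a', c(k := b'))))"
      unfolding reduced_AB_def xy(1,2)
      using xy joint_index_insert_upd[of _ d k _ "P - {k}", unfolded P] by (simp add: \<rho> ket_bra_def)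
    also have "\<dots> = (\<Sum>i<n. \<Sum>c\<in>?C. \<phi> i (a, c(k := b)) * cnj (\<phi> i (a', c(k := b'))))"
      by (rule sum.swap)
    finally show "reduced_AB P d k \<rho> x y =
        (\<Sum>s\<in>{..<n} \<times> ?C. ket_bra ((\<lambda>(i, c) (a, b). \<phi> i (a, c(k := b))) s) x y)"
      unfolding xy(1,2) by (simp add: sum_Times ket_bra_def)
  next
    show "(\<Sum>x\<in>{..<m} \<times> {..<d k}. reduced_AB P d k \<rho> x x) = 1"
    proof -
      have sumJ: "(\<Sum>c\<in>?J. F c) = (\<Sum>b<d k. \<Sum>c\<in>?C. F (c(k := b)))" for F :: "_ \<Rightarrow> complex"
        using sum_joint_index_insert[of k "P - {k}" F d] P by simp
      have "(\<Sum>a<m. \<Sum>c\<in>?J. \<rho> (a, c) (a, c)) = 1"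
        using assms(3) by (simp add: density_operator_def sum_Times)
      then show ?thesis unfolding sumJ by (simp add: reduced_AB_def sum_Times)
    qed
  qed (use finJ in auto)
qed

section \<open>Hamming weights\<close>

lemma hamming_weight_0: "hamming_weight 0 = 0"
  by (simp add: hamming_weight_def)

text \<open>Bit \<open>n\<close> of \<open>j\<close> is off, so adding \<open>2 ^ n\<close> sets one
  new bit without a carry.\<close>

lemma hamming_weight_add_power:
  assumes "j < 2 ^ n"
  shows "hamming_weight (j + 2 ^ n) = Suc (hamming_weight j)"
proof -
  have bits: "{i. bit (j + 2 ^ n) i} = insert n {i. bit j i}" and nb: "\<not> bit j n"
    and fin: "finite {i. bit j i}"
  proof -
    have lt: "i < n" if "bit j i" for i
      using that assms by (metis bit_take_bit_iff take_bit_nat_eq_self)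
    show nb: "\<not> bit j n" using lt by blast
    show "finite {i. bit j i}" by (rule finite_subset[of _ "{..<n}"]) (auto dest: lt)
    have "j + 2 ^ n = or j (2 ^ n)"
    proof (rule disjunctive_add_eq_or)
      show "and j (2 ^ n) = 0"
        by (rule bit_eqI) (use nb in \<open>auto simp: bit_simps\<close>)
    qed
    then show "{i. bit (j + 2 ^ n) i} = insert n {i. bit j i}"
      by (auto simp: bit_simps)
  qed
  then show ?thesis by (simp add: hamming_weight_def)
qed

section \<open>Power inequalities and Hamming-weighted sums\<close>

lemma powr_le_affine:
  fixes \<beta> :: real
  assumes "0 < y" "0 \<le> \<beta>" "\<beta> \<le> 1"
  shows "y powr \<beta> \<le> 1 + \<beta> * (y - 1)"
proof -
  define z where "z = ln y"
  define E where "E = exp (\<beta> * z)"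
  \<comment> \<open>Both \<open>y\<close> and 1 are written as multiples of
    \<open>y powr \<beta>\<close>. Applying \<open>1 + t \<le> exp t\<close> to them with weights
    \<open>\<beta>\<close> and \<open>1 - \<beta>\<close> makes the linear terms cancel.\<close>
  have y: "y = exp (z - \<beta> * z) * E" and one: "1 = exp (- (\<beta> * z)) * E"
    using assms(1) unfolding E_def z_def by (simp_all flip: exp_add)
  have "\<beta> * ((1 + (z - \<beta> * z)) * E) \<le> \<beta> * (exp (z - \<beta> * z) * E)"
    using assms(2) by (intro mult_left_mono mult_right_mono exp_ge_add_one_self) (auto simp: E_def)
  moreover have "(1 - \<beta>) * ((1 + - (\<beta> * z)) * E) \<le> (1 - \<beta>) * (exp (- (\<beta> * z)) * E)"
    using assms(3) by (intro mult_left_mono mult_right_mono exp_ge_add_one_self) (auto simp: E_def)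
  ultimately have "\<beta> * ((1 + (z - \<beta> * z)) * E) + (1 - \<beta>) * ((1 + - (\<beta> * z)) * E) \<le> \<beta> * y + (1 - \<beta>) * 1"
    using y one by (metis add_mono)
  moreover have "\<beta> * ((1 + (z - \<beta> * z)) * E) + (1 - \<beta>) * ((1 + - (\<beta> * z)) * E) = E"
    by (simp add: algebra_simps)
  moreover have "y powr \<beta> = E" using assms(1) by (simp add: powr_def E_def z_def)
  ultimately show ?thesis by (simp add: algebra_simps)
qed

text \<open>After division by \<open>x powr \<beta>\<close> it follows from \<open>(1 + t) powr
  \<beta> \<le> 1 + \<beta> * t \<le> 1 + \<beta> * t powr \<beta>\<close> with
  \<open>t = y / x\<close>; the second step is where \<open>y \<le> x\<close> enters.\<close>

lemma powr_add_le:
  fixes \<beta> :: real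
  assumes "0 < \<beta>" "\<beta> \<le> 1" "0 \<le> y" "y \<le> x"
  shows "(x + y) powr \<beta> \<le> x powr \<beta> + \<beta> * y powr \<beta>"
proof (cases "y = 0")
  case False
  then have pos: "0 < x" "0 < y" using assms by auto
  define t where "t = y / x"
  have t: "0 < t" "t \<le> 1" "y = x * t" using pos assms by (simp_all add: t_def)
  have "(1 + t) powr \<beta> \<le> 1 + \<beta> * t"
    using powr_le_affine[of "1 + t" \<beta>] t assms by simp
  moreover have "t \<le> t powr \<beta>"
    using powr_mono'[of \<beta> 1 t] t assms by simp
  then have "\<beta> * t \<le> \<beta> * t powr \<beta>" using assms by simp
  ultimately have "x powr \<beta> * (1 + t) powr \<beta> \<le> x powr \<beta> * (1 + \<beta> * t powr \<beta>)"
    by (intro mult_left_mono) auto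
  moreover have "(x + y) powr \<beta> = x powr \<beta> * (1 + t) powr \<beta>"
    using t pos by (simp add: distrib_left flip: powr_mult)
  moreover have "y powr \<beta> = x powr \<beta> * t powr \<beta>"
    using t pos by (simp flip: powr_mult)
  ultimately show ?thesis by (simp add: algebra_simps)
qed (use assms in simp)

lemma sum_power_double:
  fixes F :: "nat \<Rightarrow> 'z::comm_monoid_add"
  shows "(\<Sum>j<2 ^ Suc n. F j) = (\<Sum>j<2 ^ n. F j) + (\<Sum>j<2 ^ n. F (j + 2 ^ n))"
proof -
  have "(\<Sum>j<2 ^ Suc n. F j) = (\<Sum>j\<in>{..<2 ^ n} \<union> {2 ^ n..<2 ^ n + 2 ^ n}. F j)"
    by (intro sum.cong) auto
  also have "\<dots> = (\<Sum>j<2 ^ n. F j) + (\<Sum>j\<in>{0 + 2 ^ n..<2 ^ n + 2 ^ n}. F j)"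
    by (subst sum.union_disjoint) auto
  also have "(\<Sum>j\<in>{0 + 2 ^ n..<2 ^ n + 2 ^ n}. F j) = (\<Sum>j<2 ^ n. F (j + 2 ^ n))"
    unfolding sum.shift_bounds_nat_ivl by (simp add: atLeast0LessThan)
  finally show ?thesis .
qed

text \<open>Monotonicity at all indices lets the shifted sequence, which forms the upper half,
  satisfy the hypotheses again.\<close>

lemma hamming_weighted_power_sum_dyadic:
  fixes \<beta> :: real and x :: "nat \<Rightarrow> real"
  assumes "0 < \<beta>" "\<beta> \<le> 1"
    and "\<And>j. 0 \<le> x j" "\<And>i j. i \<le> j \<Longrightarrow> x j \<le> x i"
  shows "(\<Sum>j<2 ^ n. x j) powr \<beta> \<le> (\<Sum>j<2 ^ n. \<beta> ^ hamming_weight j * x j powr \<beta>)"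
  using assms(3,4)
proof (induction n arbitrary: x)
  case 0
  then show ?case by (simp add: hamming_weight_0)
next
  case (Suc n)
  let ?y = "\<lambda>j. x (j + 2 ^ n)"
  have "(\<Sum>j<2 ^ Suc n. x j) powr \<beta> = ((\<Sum>j<2 ^ n. x j) + (\<Sum>j<2 ^ n. ?y j)) powr \<beta>"
    by (simp only: sum_power_double)
  also have "\<dots> \<le> (\<Sum>j<2 ^ n. x j) powr \<beta> + \<beta> * (\<Sum>j<2 ^ n. ?y j) powr \<beta>"
    using Suc.prems by (intro powr_add_le assms sum_nonneg sum_mono) auto
  also have "\<dots> \<le> (\<Sum>j<2 ^ n. \<beta> ^ hamming_weight j * x j powr \<beta>) +
      \<beta> * (\<Sum>j<2 ^ n. \<beta> ^ hamming_weight j * ?y j powr \<beta>)"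
    using Suc.prems assms(1) by (intro add_mono mult_left_mono Suc.IH) auto
  also have "\<dots> = (\<Sum>j<2 ^ Suc n. \<beta> ^ hamming_weight j * x j powr \<beta>)"
    unfolding sum_power_double by (simp add: hamming_weight_add_power sum_distrib_left mult.assoc)
  finally show ?case .
qed

text \<open>Padding with zeros up to length \<open>2 ^ N\<close> keeps the sequence decreasing and
  adds nothing, as \<open>0 powr \<beta> = 0\<close>.\<close>

lemma hamming_weighted_power_sum:
  fixes \<beta> :: real and x :: "nat \<Rightarrow> real"
  assumes "0 < \<beta>" "\<beta> \<le> 1"
    and "\<And>j. j < N \<Longrightarrow> 0 \<le> x j" "\<And>i j. i \<le> j \<Longrightarrow> j < N \<Longrightarrow> x j \<le> x i"
  shows "(\<Sum>j<N. x j) powr \<beta> \<le> (\<Sum>j<N. \<beta> ^ hamming_weight j * x j powr \<beta>)"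
proof -
  define y where "y j = (if j < N then x j else 0)" for j
  have N: "{..<N} \<subseteq> {..<2 ^ N}" using less_exp[of N] by auto
  have "(\<Sum>j<2 ^ N. y j) powr \<beta> \<le> (\<Sum>j<2 ^ N. \<beta> ^ hamming_weight j * y j powr \<beta>)"
    using assms(3,4) by (intro hamming_weighted_power_sum_dyadic assms(1,2)) (auto simp: y_def)
  also have "(\<Sum>j<2 ^ N. y j) = (\<Sum>j<N. x j)"
    using N by (intro sum.mono_neutral_cong_right) (auto simp: y_def)
  also have "(\<Sum>j<2 ^ N. \<beta> ^ hamming_weight j * y j powr \<beta>) = (\<Sum>j<N. \<beta> ^ hamming_weight j * x j powr \<beta>)"
    using N by (intro sum.mono_neutral_cong_right) (auto simp: y_def)
  finally show ?thesis .
qed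

section \<open>Ordering of the subsystems and conclusion\<close>

lemma decreasing_enumeration:
  fixes f :: "'p \<Rightarrow> real"
  assumes "finite P"
  obtains B where "bij_betw B {..<card P} P" "\<And>i j. i \<le> j \<Longrightarrow> j < card P \<Longrightarrow> f (B j) \<le> f (B i)"
proof -
  obtain ps where ps: "set ps = P" "distinct ps" using finite_distinct_list[OF assms] by blast
  define qs where "qs = sort_key (\<lambda>p. - f p) ps"
  have qs: "set qs = P" "distinct qs" "length qs = card P"
    using ps by (auto simp: qs_def distinct_card[symmetric])
  have "sorted (map (\<lambda>p. - f p) qs)" unfolding qs_def by (rule sorted_sort_key)
  then have "f (qs ! j) \<le> f (qs ! i)" if "i \<le> j" "j < card P" for i j
    using that qs(3) sorted_nth_mono[of "map (\<lambda>p. - f p) qs" i j] by simp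
  moreover have "bij_betw (\<lambda>i. qs ! i) {..<card P} P"
    using qs by (intro bij_betw_nth) auto
  ultimately show ?thesis by (rule that[rotated])
qed

theorem theorem1:
  fixes \<beta> :: real and N m :: nat
    and P :: "'p set" and d :: "'p \<Rightarrow> nat"
    and \<rho> :: "(nat \<times> ('p \<Rightarrow> nat)) oper"
  assumes "0 \<le> \<beta>" and "\<beta> \<le> 1"
    and "N \<ge> 1"
    and "finite P" and "card P = N"
    and "density_operator ({..<m} \<times> joint_index P d) \<rho>"
  shows "\<exists>B. bij_betw B {..<N} P \<and>
    rpow (EoA m (joint_index P d) \<rho>) \<beta> \<le>
      (\<Sum>j<N. \<beta> ^ hamming_weight j *
        rpow (EoA m {..<d (B j)} (reduced_AB P d (B j) \<rho>)) \<beta>)"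
proof -
  define E where "E k = EoA m {..<d k} (reduced_AB P d k \<rho>)" for k
  obtain B where B: "bij_betw B {..<N} P" and dec: "\<And>i j. i \<le> j \<Longrightarrow> j < N \<Longrightarrow> E (B j) \<le> E (B i)"
    using decreasing_enumeration[OF assms(4), of E] assms(5) by blast
  have E0: "0 \<le> E (B j)" if "j < N" for j
    unfolding E_def using B that by (intro EoA_reduced_nonneg assms) (auto simp: bij_betw_def)
  have "rpow (EoA m (joint_index P d) \<rho>) \<beta> \<le> (\<Sum>j<N. \<beta> ^ hamming_weight j * rpow (E (B j)) \<beta>)"
  proof (cases "\<beta> = 0")
    \<comment> \<open>Every \<open>rpow\<close> is 1 here; the index \<open>j = 0\<close>, present
      because \<open>N \<ge> 1\<close>, has weight \<open>0 ^ 0 = 1\<close> and already balances the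
      left side.\<close>
    case True
    have "(0::real) ^ hamming_weight 0 \<le> (\<Sum>j<N. 0 ^ hamming_weight j)"
      using assms(3) by (intro member_le_sum) auto
    then show ?thesis using True by (simp add: rpow_def hamming_weight_0)
  next
    case False
    then have \<beta>: "0 < \<beta>" using assms(1) by simp
    have "EoA m (joint_index P d) \<rho> \<le> (\<Sum>k\<in>P. E k)"
      unfolding E_def by (rule polygamy_EoA[OF assms(4,6)])
    also have "\<dots> = (\<Sum>j<N. E (B j))"
      by (rule sum.reindex_bij_betw[OF B, symmetric])
    finally have "EoA m (joint_index P d) \<rho> powr \<beta> \<le> (\<Sum>j<N. E (B j)) powr \<beta>"
      using \<beta> EoA_nonneg[OF finite_joint_index[OF assms(4)] assms(6)] by (intro powr_mono2) auto
    also have "\<dots> \<le> (\<Sum>j<N. \<beta> ^ hamming_weight j * E (B j) powr \<beta>)"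
      by (intro hamming_weighted_power_sum \<beta> assms(2) E0 dec)
    finally show ?thesis using \<beta> by (simp add: rpow_def)
  qed
  with B show ?thesis unfolding E_def by blast
qed

end
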